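(* Consider the closed-loop system $$\begin{aligned} \dot\varphi&=D_t^T\omega\\ M\dot\omega&=-D_t\nabla U(\varphi)-A\omega+P_g-P_d\\ \tau_b\dot b&=[P_g-\nabla C^*(b)]^+_{b}\\ \tau_g\dot P_g&=[\mathbf 1\lambda-b+\rho\mathbf 1\mathbf 1^T(P_d-P_g)-\sigma^2\omega]^+_{P_g}\\ \tau_\lambda\dot\lambda&=\mathbf 1^T(P_d-P_g) \end{aligned}$$ with state $x=(\varphi,\omega,b,P_g,\lambda)$, $b\ge 0$, $P_g\ge 0$, and the set $$\mathcal X:=\{\bar x=(\bar\varphi,\bar\omega,\bar b,\bar P_g,\bar\lambda):\ \bar x\text{ is an equilibrium of the closed-loop system and } D^T(D_t^\dagger)^T\bar\varphi\in(-\pi/2,\pi/2)^m\}.$$ Then $\mathcal X$ is locally asymptotically stable under the closed-loop system. Moreover, the convergence is to a point: each trajectory initialized sufficiently close to $\mathcal X$ converges to a single point of $\mathcal X$.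
   Context: Vector inequalities are componentwise; $\mathbf 1$ is the all-ones vector of appropriate dimension. For scalars $a$ and $b\ge0$, $[a]^+_b=a$ if $b>0$ and $[a]^+_b=\max(a,0)$ if $b=0$; for vectors $[a]^+_b$ is defined componentwise. Network. $\mathcal G$ is a connected undirected graph with $n$ nodes (buses) and $m$ edges (lines), with arbitrarily chosen edge orientations and incidence matrix $D\in\mathbb R^{n\times m}$ ($D_{ik}=+1$ if $i$ is the positive end of edge $k$, $-1$ if $i$ is the negative end, $0$ otherwise). $\Gamma=\operatorname{diag}(\gamma_1,\dots,\gamma_m)$ with $\gamma_k=B_{ij}V_iV_j>0$ for the edge $k$ between nodes $i$ and $j$, where $B_{ij}=B_{ji}>0$ and $V_i>0$. $D_t\in\mathbb R^{n\times(n-1)}$ is the incidence matrix of an arbitrary tree on the node set $\{1,\dots,n\}$, $D_t^\dagger=(D_t^TD_t)^{-1}D_t^T$, and $U(\varphi)=-\mathbf 1^T\Gamma\,\mathbf{cos}(D^T(D_t^\dagger)^T\varphi)$ for $\varphi\in\mathbb R^{n-1}$, where $\mathbf{cos}$ is the elementwise cosine. $M,A\in\mathbb R^{n\times n}$ are diagonal with positive diagonal entries. The states are $\varphi\in\mathbb R^{n-1}$, $\omega\in\mathbb R^n$, $b\in\mathbb R^n_{\ge0}$, $P_g\in\mathbb R^n_{\ge0}$, $\lambda\in\mathbb R$. The design parameters are $\rho,\sigma,\tau_\lambda>0$ and diagonal positive definite matrices $\tau_b,\tau_g\in\mathbb R^{n\times n}$. An equilibrium is a point of the state space at which the right-hand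 sides all vanish. Solutions are absolutely continuous functions of time satisfying the closed-loop system almost everywhere, with initial conditions satisfying $b(0)\ge0$, $P_g(0)\ge0$ (so that $b(t)\ge 0$ and $P_g(t)\ge0$ for all $t\ge0$). Costs. For each $i\in\{1,\dots,n\}$, $C_i:\mathbb R_{\ge0}\to\mathbb R_{\ge0}$ is strongly convex on $\mathbb R_{\ge0}$ (twice continuously differentiable, with $\nabla^2C_i(x)>\mu_i$ for all $x\ge0$ and some constant $\mu_i>0$) and satisfies $\nabla C_i(0)\ge0$. Put $C(P_g)=\sum_iC_i(P_{gi})$. The load $P_d\in\mathbb R^n_{\ge0}$ satisfies $\mathbf 1^TP_d>0$. For $b_i\ge0$ the convex conjugate is $C_i^*(b_i)=\max_{P_{gi}\ge0}\{b_iP_{gi}-C_i(P_{gi})\}$, and $C^*(b)=\sum_iC_i^*(b_i)$; it is continuously differentiable with $\nabla C_i^*(b_i)=\operatorname{arg\,max}_{P_{gi}\ge0}\{b_iP_{gi}-C_i(P_{gi})\}$. Economic dispatch problem: minimize $C(P_g)$ subject to $\mathbf 1^TP_g=\mathbf 1^TP_d$ and $P_g\ge0$; it has a unique optimizer $P_g^*$. Standing assumptions: $P_{gi}^*>0$ for at least two distinct $i$; and for $P_g=P_g^*$ there exists an equilibrium $(\bar\varphi,\bar\omega)$ of $\dot\varphi=D_t^T\omega$, $M\dot\omega=-D_t\nabla U(\varphi)-A\omega+P_g-P_d$ with $D^T(D_t^\dagger)^T\bar\varphi\in(-\pi/2,\pi/2)^m$. Local asymptotic stability of the set $\mathcal X$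 means: $\mathcal X$ is Lyapunov stable (for every neighborhood $W$ of $\mathcal X$ there is a neighborhood $W'$ of $\mathcal X$ such that solutions starting in $W'$, with $b(0),P_g(0)\ge0$, remain in $W$ for all $t\ge0$) and there is a neighborhood of $\mathcal X$ such that every solution starting in it, with $b(0),P_g(0)\ge0$, has distance to $\mathcal X$ tending to $0$ as $t\to\infty$. *)

theory Defs
  imports "HOL-Analysis.Analysis"
begin

section \<open>Graphs and their incidence matrices\<close>

text \<open>
  A simple undirected graph on the node type \<open>'n\<close> with edge type \<open>'k\<close> is given together with an
  orientation: \<open>pos k\<close> and \<open>neg k\<close> are the positive and the negative end of the edge \<open>k\<close>.
\<close>

definition simple_graph :: "('k \<Rightarrow> 'n) \<Rightarrow> ('k \<Rightarrow> 'n) \<Rightarrow> bool" where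
  "simple_graph pos neg \<longleftrightarrow> (\<forall>k. pos k \<noteq> neg k) \<and> inj (\<lambda>k. {pos k, neg k})"

definition adjacent :: "('k \<Rightarrow> 'n) \<Rightarrow> ('k \<Rightarrow> 'n) \<Rightarrow> ('n \<times> 'n) set" where
  "adjacent pos neg = {(i, j). \<exists>k. {i, j} = {pos k, neg k}}"

definition connected_graph :: "('k \<Rightarrow> 'n) \<Rightarrow> ('k \<Rightarrow> 'n) \<Rightarrow> bool" where
  "connected_graph pos neg \<longleftrightarrow>
     simple_graph pos neg \<and> (\<forall>i j. (i, j) \<in> (adjacent pos neg)\<^sup>*)"

definition graph_cycle :: "('k \<Rightarrow> 'n) \<Rightarrow> ('k \<Rightarrow> 'n) \<Rightarrow> 'n list \<Rightarrow> bool" where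
  "graph_cycle pos neg c \<longleftrightarrow> 3 \<le> length c \<and> distinct c \<and>
     (\<forall>i < length c. (c ! i, c ! (Suc i mod length c)) \<in> adjacent pos neg)"

definition tree_graph :: "('k \<Rightarrow> 'n) \<Rightarrow> ('k \<Rightarrow> 'n) \<Rightarrow> bool" where
  "tree_graph pos neg \<longleftrightarrow> connected_graph pos neg \<and> (\<nexists>c. graph_cycle pos neg c)"

definition incidence :: "('k::finite \<Rightarrow> 'n::finite) \<Rightarrow> ('k \<Rightarrow> 'n) \<Rightarrow> real^'k^'n" where
  "incidence pos neg = (\<chi> i k. if i = pos k then 1 else if i = neg k then - 1 else 0)"


section \<open>Matrices and gradients\<close>

definition diag :: "real^'k \<Rightarrow> real^'k^'k" where
  "diag d = (\<chi> i j. if i = j then d $ i else 0)"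

definition is_diagonal :: "real^'k^'k \<Rightarrow> bool" where
  "is_diagonal M \<longleftrightarrow> (\<forall>i j. i \<noteq> j \<longrightarrow> M $ i $ j = 0)"

definition positive_definite :: "real^'k^'k \<Rightarrow> bool" where
  "positive_definite M \<longleftrightarrow> transpose M = M \<and> (\<forall>v. v \<noteq> 0 \<longrightarrow> v \<bullet> (M *v v) > 0)"

definition left_pinv :: "real^'t^'n \<Rightarrow> real^'n^'t" where
  "left_pinv N = matrix_inv (transpose N ** N) ** transpose N"

text \<open>
  Gradient relative to a set. On \<open>{0..}\<close>, which is the half-line or the nonnegative orthant, the
  gradient is unique wherever it exists; at boundary points it consists of one-sided derivatives.
\<close>

definition gradient_within :: "('a::real_inner \<Rightarrow> real) \<Rightarrow> 'a set \<Rightarrow> 'a \<Rightarrow> 'a" where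
  "gradient_within f S x = (THE g. (f has_derivative (\<lambda>h. g \<bullet> h)) (at x within S))"


section \<open>Costs and economic dispatch\<close>

definition strongly_convex_C2 :: "(real \<Rightarrow> real) \<Rightarrow> bool" where
  "strongly_convex_C2 f \<longleftrightarrow>
     (\<exists>f' f'' \<mu>. \<mu> > 0 \<and> continuous_on {0..} f'' \<and>
        (\<forall>x\<ge>0. (f has_real_derivative f' x) (at x within {0..}) \<and>
               (f' has_real_derivative f'' x) (at x within {0..}) \<and> f'' x > \<mu>))"

definition total_cost :: "('n::finite \<Rightarrow> real \<Rightarrow> real) \<Rightarrow> real^'n \<Rightarrow> real" where
  "total_cost C P = (\<Sum>i\<in>UNIV. C i (P $ i))"

definition conjugate :: "(real \<Rightarrow> real) \<Rightarrow> real \<Rightarrow> real" where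
  "conjugate f y = (SUP p\<in>{0..}. y * p - f p)"

definition total_conjugate :: "('n::finite \<Rightarrow> real \<Rightarrow> real) \<Rightarrow> real^'n \<Rightarrow> real" where
  "total_conjugate C b = (\<Sum>i\<in>UNIV. conjugate (C i) (b $ i))"

definition economic_dispatch_optimizer ::
  "('n::finite \<Rightarrow> real \<Rightarrow> real) \<Rightarrow> real^'n \<Rightarrow> real^'n \<Rightarrow> bool" where
  "economic_dispatch_optimizer C Pd P \<longleftrightarrow>
     is_arg_min (total_cost C) (\<lambda>Q. 1 \<bullet> Q = 1 \<bullet> Pd \<and> 0 \<le> Q) P"


section \<open>The closed-loop system\<close>

text \<open>
  Projection \<open>[a]\<^sup>+\<^sub>b\<close>. Only \<open>b \<ge> 0\<close> is meaningful; taking the positive part also for \<open>b < 0\<close> is a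
  convention under which trajectories that start at \<open>b \<ge> 0\<close> cannot leave \<open>b \<ge> 0\<close>.
\<close>

definition proj_plus :: "real \<Rightarrow> real \<Rightarrow> real" where
  "proj_plus a b = (if b > 0 then a else max a 0)"

definition vec_proj_plus :: "real^'n \<Rightarrow> real^'n \<Rightarrow> real^'n" where
  "vec_proj_plus a b = (\<chi> i. proj_plus (a $ i) (b $ i))"

definition edge_angles :: "real^'m^'n \<Rightarrow> real^'t^'n \<Rightarrow> real^'t \<Rightarrow> real^'m" where
  "edge_angles D Dt \<phi> = transpose D *v (transpose (left_pinv Dt) *v \<phi>)"

definition potential :: "real^'m^'m \<Rightarrow> real^'m^'n \<Rightarrow> real^'t^'n \<Rightarrow> real^'t \<Rightarrow> real" where
  "potential \<Gamma> D Dt \<phi> = - (1 \<bullet> (\<Gamma> *v (\<chi> k. cos (edge_angles D Dt \<phi> $ k))))"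

definition angles_secure :: "real^'m^'n \<Rightarrow> real^'t^'n \<Rightarrow> real^'t \<Rightarrow> bool" where
  "angles_secure D Dt \<phi> \<longleftrightarrow> (\<forall>k. edge_angles D Dt \<phi> $ k \<in> {- pi / 2 <..< pi / 2})"

definition swing_rhs ::
  "real^'m^'m \<Rightarrow> real^'m^'n \<Rightarrow> real^'t^'n \<Rightarrow> real^'n^'n \<Rightarrow> real^'n \<Rightarrow>
   real^'t \<Rightarrow> real^'n \<Rightarrow> real^'n \<Rightarrow> real^'n" where
  "swing_rhs \<Gamma> D Dt A Pd \<phi> \<omega> Pg =
     - (Dt *v gradient_within (potential \<Gamma> D Dt) UNIV \<phi>) - A *v \<omega> + Pg - Pd"

text \<open>The state is \<open>(\<phi>, \<omega>, b, Pg, l)\<close>; \<open>l\<close> and \<open>\<tau>l\<close> stand for the multiplier and its time constant.\<close>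

type_synonym ('n, 't) state = "(real, 't) vec \<times> (real, 'n) vec \<times> (real, 'n) vec \<times> (real, 'n) vec \<times> real"

definition state_space :: "('n::finite, 't::finite) state set" where
  "state_space = {(\<phi>, \<omega>, b, Pg, l). 0 \<le> b \<and> 0 \<le> Pg}"

definition closed_loop_rhs ::
  "real^'m^'m \<Rightarrow> real^'m^'n \<Rightarrow> real^'t^'n \<Rightarrow> real^'n^'n \<Rightarrow> ('n \<Rightarrow> real \<Rightarrow> real) \<Rightarrow> real^'n \<Rightarrow>
   real \<Rightarrow> real \<Rightarrow> ('n::finite, 't::finite) state \<Rightarrow> ('n, 't) state" where
  "closed_loop_rhs \<Gamma> D Dt A C Pd \<rho> \<sigma> = (\<lambda>(\<phi>, \<omega>, b, Pg, l).
     (transpose Dt *v \<omega>,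
      swing_rhs \<Gamma> D Dt A Pd \<phi> \<omega> Pg,
      vec_proj_plus (Pg - gradient_within (total_conjugate C) {0..} b) b,
      vec_proj_plus (l *\<^sub>R 1 - b + \<rho> *\<^sub>R ((1 \<bullet> (Pd - Pg)) *\<^sub>R 1) - \<sigma>\<^sup>2 *\<^sub>R \<omega>) Pg,
      1 \<bullet> (Pd - Pg)))"

text \<open>The left-hand sides of the system, as a function of the time derivative of the state.\<close>

definition closed_loop_lhs ::
  "real^'n^'n \<Rightarrow> real^'n^'n \<Rightarrow> real^'n^'n \<Rightarrow> real \<Rightarrow>
   ('n::finite, 't::finite) state \<Rightarrow> ('n, 't) state" where
  "closed_loop_lhs M \<tau>b \<tau>g \<tau>l = (\<lambda>(\<phi>', \<omega>', b', Pg', l').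
     (\<phi>', M *v \<omega>', \<tau>b *v b', \<tau>g *v Pg', \<tau>l * l'))"

definition target_set ::
  "real^'m^'m \<Rightarrow> real^'m^'n \<Rightarrow> real^'t^'n \<Rightarrow> real^'n^'n \<Rightarrow> ('n \<Rightarrow> real \<Rightarrow> real) \<Rightarrow> real^'n \<Rightarrow>
   real \<Rightarrow> real \<Rightarrow> ('n::finite, 't::finite) state set" where
  "target_set \<Gamma> D Dt A C Pd \<rho> \<sigma> =
     {x \<in> state_space. closed_loop_rhs \<Gamma> D Dt A C Pd \<rho> \<sigma> x = 0 \<and> angles_secure D Dt (fst x)}"


section \<open>Solutions and stability\<close>

definition absolutely_continuous_on :: "real \<Rightarrow> real \<Rightarrow> (real \<Rightarrow> 'a::real_normed_vector) \<Rightarrow> bool" where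
  "absolutely_continuous_on a b f \<longleftrightarrow>
     (\<forall>\<epsilon>>0. \<exists>\<delta>>0. \<forall>\<D>. \<D> division_of \<Union>\<D> \<longrightarrow> \<Union>\<D> \<subseteq> {a..b} \<longrightarrow> (\<Sum>K\<in>\<D>. Sup K - Inf K) < \<delta> \<longrightarrow>
        (\<Sum>K\<in>\<D>. norm (f (Sup K) - f (Inf K))) < \<epsilon>)"

text \<open>
  Solutions of \<open>L x' = F x\<close> on \<open>[0, \<infinity>)\<close> with initial condition in \<open>S\<close>; the values of \<open>x\<close> at negative
  times are irrelevant.
\<close>

definition solution ::
  "('a::real_normed_vector \<Rightarrow> 'a) \<Rightarrow> ('a \<Rightarrow> 'a) \<Rightarrow> 'a set \<Rightarrow> (real \<Rightarrow> 'a) \<Rightarrow> bool" where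
  "solution L F S x \<longleftrightarrow> x 0 \<in> S \<and>
     (\<forall>T\<ge>0. absolutely_continuous_on 0 T x) \<and>
     (AE t in lebesgue. 0 \<le> t \<longrightarrow>
        (\<exists>x'. (x has_vector_derivative x') (at t within {0..}) \<and> L x' = F (x t)))"

definition neighborhood :: "'a::topological_space set \<Rightarrow> 'a set \<Rightarrow> bool" where
  "neighborhood X W \<longleftrightarrow> X \<subseteq> interior W"

definition locally_asymptotically_stable ::
  "((real \<Rightarrow> 'a::metric_space) \<Rightarrow> bool) \<Rightarrow> 'a set \<Rightarrow> bool" where
  "locally_asymptotically_stable Sol X \<longleftrightarrow>
     (\<forall>W. neighborhood X W \<longrightarrow>
        (\<exists>W'. neighborhood X W' \<and> (\<forall>x. Sol x \<and> x 0 \<in> W' \<longrightarrow> (\<forall>t\<ge>0. x t \<in> W)))) \<and>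
     (\<exists>W. neighborhood X W \<and>
        (\<forall>x. Sol x \<and> x 0 \<in> W \<longrightarrow> ((\<lambda>t. infdist (x t) X) \<longlongrightarrow> 0) at_top))"

definition pointwise_convergent_near ::
  "((real \<Rightarrow> 'a::metric_space) \<Rightarrow> bool) \<Rightarrow> 'a set \<Rightarrow> bool" where
  "pointwise_convergent_near Sol X \<longleftrightarrow>
     (\<exists>W. neighborhood X W \<and>
        (\<forall>x. Sol x \<and> x 0 \<in> W \<longrightarrow> (\<exists>y\<in>X. (x \<longlongrightarrow> y) at_top)))"

end

theory Submission
  imports Defs
begin

text \<open>
  The proof is a Lyapunov argument for a discontinuous system. Every step is a statement about one given
  trajectory, and what links a trajectory to the vector field is that an absolutely continuous function whose derivative
  is at least \<open>c\<close> almost everywhere grows at least at rate \<open>c\<close> (\<open>absolutely_continuous_growth\<close>).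
  
  Every equilibrium \<open>x0\<close> in the target set has zero frequency deviation, covers the load, has outputs
  that are the derivatives of the conjugate costs at the bids, and satisfies the complementary slackness
  conditions of economic dispatch. For such an \<open>x0\<close> let \<open>lyapunov x0\<close> be the sum of \<open>\<sigma>\<^sup>2\<close> times the
  energy of the network (kinetic energy plus the Bregman distance of the potential) and of half the weighted
  squared distances of bids, generation and multiplier to \<open>x0\<close>. The cross terms cancel: the power
  \<open>\<sigma>\<^sup>2 \<omega> \<bullet> (Pg - Pg0)\<close> fed into the network is taken out by the feedback term \<open>- \<sigma>\<^sup>2 \<omega>\<close> of the
  generators, and projections onto the orthants only help. What remains (\<open>dissipation\<close>) is minus a
  weighted sum of \<open>\<omega>\<^sub>i\<^sup>2\<close>, of the squared imbalance, and of the squared deviations of the conjugate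
  derivatives \<open>G\<^sub>i (b\<^sub>i)\<close>. The function decreases along all trajectories, and strong convexity of the
  potential near secure angles bounds it below by a multiple of the squared distance to \<open>x0\<close> there. This
  gives stability of every single equilibrium of the target set (\<open>stability\<close>).
  
  A trajectory that stays near \<open>x0\<close> is bounded, hence Lipschitz in time, and Barbalat's lemma replaces
  LaSalle's principle. The dissipated quantities vanish in the limit; then the bids of the units with
  positive output at \<open>x0\<close> converge, then, applying the lemma to the bids and to the outputs of these
  units, their outputs and the multiplier; the balance forces the remaining outputs to zero; and the
  swing equation makes the angles converge. The bids of units that are idle at \<open>x0\<close> may settle anywhere
  in an interval, so the target set is in general a continuum. But every limit point of the trajectory
  is again in the target set (\<open>limit_point_in_target\<close>), and stability of that limit point turns
  subsequential convergence into convergence (\<open>attraction\<close>).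
\<close>

section \<open>Absolutely continuous functions\<close>

lemma absolutely_continuous_onD:
  assumes "absolutely_continuous_on a b f" "e > 0"
  obtains d where "d > 0"
    "\<And>\<D>. \<lbrakk>\<D> division_of \<Union>\<D>; \<Union>\<D> \<subseteq> {a..b}; (\<Sum>K\<in>\<D>. Sup K - Inf K) < d\<rbrakk>
        \<Longrightarrow> (\<Sum>K\<in>\<D>. norm (f (Sup K) - f (Inf K))) < e"
  using assms unfolding absolutely_continuous_on_def by meson

lemma absolutely_continuous_on_subinterval:
  assumes "absolutely_continuous_on a b f" "a \<le> c" "d \<le> b"
  shows "absolutely_continuous_on c d f"
  unfolding absolutely_continuous_on_def
proof (intro allI impI)
  fix e :: real assume "e > 0"
  obtain k where k: "k > 0"
    "\<And>\<D>. \<lbrakk>\<D> division_of \<Union>\<D>; \<Union>\<D> \<subseteq> {a..b}; (\<Sum>K\<in>\<D>. Sup K - Inf K) < k\<rbrakk>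
        \<Longrightarrow> (\<Sum>K\<in>\<D>. norm (f (Sup K) - f (Inf K))) < e"
    by (rule absolutely_continuous_onD[OF assms(1) \<open>e > 0\<close>]) auto
  have "{c..d} \<subseteq> {a..b}" using assms by auto
  then have "(\<Sum>K\<in>\<D>. norm (f (Sup K) - f (Inf K))) < e"
    if "\<D> division_of \<Union>\<D>" "\<Union>\<D> \<subseteq> {c..d}" "(\<Sum>K\<in>\<D>. Sup K - Inf K) < k" for \<D>
    using k(2)[OF that(1) _ that(3)] that(2) by (meson order_trans)
  then show "\<exists>\<delta>>0. \<forall>\<D>. \<D> division_of \<Union>\<D> \<longrightarrow> \<Union>\<D> \<subseteq> {c..d} \<longrightarrow> (\<Sum>K\<in>\<D>. Sup K - Inf K) < \<delta> \<longrightarrow>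
        (\<Sum>K\<in>\<D>. norm (f (Sup K) - f (Inf K))) < e"
    using k(1) by blast
qed

lemma division_of_real_ends:
  fixes \<D> :: "real set set"
  assumes "\<D> division_of S" "S \<subseteq> {a..b}" "K \<in> \<D>"
  obtains u v where "K = {u..v}" "u \<le> v" "Inf K = u" "Sup K = v" "u \<in> {a..b}" "v \<in> {a..b}"
proof -
  obtain u v where uv: "K = {u..v}" using division_ofD(4)[OF assms(1,3)] by auto
  have "u \<le> v" using division_ofD(3)[OF assms(1,3)] uv by auto
  moreover have "{u..v} \<subseteq> {a..b}" using division_ofD(2)[OF assms(1,3)] assms(2) uv by blast
  ultimately show ?thesis using that uv by auto
qed

lemma absolutely_continuous_on_lipschitz_image:
  assumes f: "absolutely_continuous_on a b f" and g: "L-lipschitz_on (f ` {a..b}) g"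
  shows "absolutely_continuous_on a b (\<lambda>t. g (f t))"
  unfolding absolutely_continuous_on_def
proof (intro allI impI)
  fix e :: real assume "e > 0"
  have L: "L \<ge> 0" using g lipschitz_on_nonneg by blast
  have pos: "e / (L + 1) > 0" using \<open>e > 0\<close> L by simp
  obtain d where d: "d > 0"
    "\<And>\<D>. \<lbrakk>\<D> division_of \<Union>\<D>; \<Union>\<D> \<subseteq> {a..b}; (\<Sum>K\<in>\<D>. Sup K - Inf K) < d\<rbrakk>
        \<Longrightarrow> (\<Sum>K\<in>\<D>. norm (f (Sup K) - f (Inf K))) < e / (L + 1)"
    by (rule absolutely_continuous_onD[OF f pos]) auto
  have "(\<Sum>K\<in>\<D>. norm (g (f (Sup K)) - g (f (Inf K)))) < e"
    if D: "\<D> division_of \<Union>\<D>" "\<Union>\<D> \<subseteq> {a..b}" "(\<Sum>K\<in>\<D>. Sup K - Inf K) < d" for \<D>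
  proof -
    have "(\<Sum>K\<in>\<D>. norm (g (f (Sup K)) - g (f (Inf K)))) \<le> (\<Sum>K\<in>\<D>. L * norm (f (Sup K) - f (Inf K)))"
    proof (rule sum_mono)
      fix K assume "K \<in> \<D>"
      then obtain u v where "Inf K = u" "Sup K = v" "u \<in> {a..b}" "v \<in> {a..b}"
        using division_of_real_ends[OF D(1,2)] by metis
      then show "norm (g (f (Sup K)) - g (f (Inf K))) \<le> L * norm (f (Sup K) - f (Inf K))"
        using lipschitz_on_normD[OF g] by auto
    qed
    also have "\<dots> = L * (\<Sum>K\<in>\<D>. norm (f (Sup K) - f (Inf K)))" by (simp add: sum_distrib_left)
    also have "\<dots> \<le> L * (e / (L + 1))"
      using d(2)[OF D] L by (intro mult_left_mono) auto
    also have "\<dots> < e" using L \<open>e > 0\<close> by (simp add: field_simps)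
    finally show ?thesis .
  qed
  then show "\<exists>\<delta>>0. \<forall>\<D>. \<D> division_of \<Union>\<D> \<longrightarrow> \<Union>\<D> \<subseteq> {a..b} \<longrightarrow> (\<Sum>K\<in>\<D>. Sup K - Inf K) < \<delta> \<longrightarrow>
        (\<Sum>K\<in>\<D>. norm (g (f (Sup K)) - g (f (Inf K)))) < e"
    using d(1) by blast
qed

lemma absolutely_continuous_on_add:
  assumes f: "absolutely_continuous_on a b f" and g: "absolutely_continuous_on a b g"
  shows "absolutely_continuous_on a b (\<lambda>t. f t + g t)"
  unfolding absolutely_continuous_on_def
proof (intro allI impI)
  fix e :: real assume "e > 0"
  then have half: "e / 2 > 0" by simp
  obtain d where d: "d > 0"
    "\<And>\<D>. \<lbrakk>\<D> division_of \<Union>\<D>; \<Union>\<D> \<subseteq> {a..b}; (\<Sum>K\<in>\<D>. Sup K - Inf K) < d\<rbrakk>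
        \<Longrightarrow> (\<Sum>K\<in>\<D>. norm (f (Sup K) - f (Inf K))) < e / 2"
    by (rule absolutely_continuous_onD[OF f half]) auto
  obtain d' where d': "d' > 0"
    "\<And>\<D>. \<lbrakk>\<D> division_of \<Union>\<D>; \<Union>\<D> \<subseteq> {a..b}; (\<Sum>K\<in>\<D>. Sup K - Inf K) < d'\<rbrakk>
        \<Longrightarrow> (\<Sum>K\<in>\<D>. norm (g (Sup K) - g (Inf K))) < e / 2"
    by (rule absolutely_continuous_onD[OF g half]) auto
  have "(\<Sum>K\<in>\<D>. norm (f (Sup K) + g (Sup K) - (f (Inf K) + g (Inf K)))) < e"
    if D: "\<D> division_of \<Union>\<D>" "\<Union>\<D> \<subseteq> {a..b}" "(\<Sum>K\<in>\<D>. Sup K - Inf K) < min d d'" for \<D>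
  proof -
    have "(\<Sum>K\<in>\<D>. norm (f (Sup K) + g (Sup K) - (f (Inf K) + g (Inf K))))
        \<le> (\<Sum>K\<in>\<D>. norm (f (Sup K) - f (Inf K)) + norm (g (Sup K) - g (Inf K)))"
      by (rule sum_mono) (metis add_diff_add norm_triangle_ineq)
    also have "\<dots> < e / 2 + e / 2"
      unfolding sum.distrib using d(2)[OF D(1,2)] d'(2)[OF D(1,2)] D(3) by (intro add_strict_mono) auto
    finally show ?thesis by simp
  qed
  then show "\<exists>\<delta>>0. \<forall>\<D>. \<D> division_of \<Union>\<D> \<longrightarrow> \<Union>\<D> \<subseteq> {a..b} \<longrightarrow> (\<Sum>K\<in>\<D>. Sup K - Inf K) < \<delta> \<longrightarrow>
        (\<Sum>K\<in>\<D>. norm (f (Sup K) + g (Sup K) - (f (Inf K) + g (Inf K)))) < e"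
    using d(1) d'(1) by (intro exI[of _ "min d d'"]) auto
qed

lemma absolutely_continuous_on_const: "absolutely_continuous_on a b (\<lambda>t. c)"
  unfolding absolutely_continuous_on_def by (auto intro: exI[of _ 1])

lemma absolutely_continuous_on_sum:
  assumes "finite I" "\<And>i. i \<in> I \<Longrightarrow> absolutely_continuous_on a b (f i)"
  shows "absolutely_continuous_on a b (\<lambda>t. \<Sum>i\<in>I. f i t)"
  using assms
  by (induction I rule: finite_induct) (auto intro: absolutely_continuous_on_add absolutely_continuous_on_const)

lemma absolutely_continuous_on_bounded_linear:
  assumes "absolutely_continuous_on a b f" "bounded_linear g"
  shows "absolutely_continuous_on a b (\<lambda>t. g (f t))"
proof -
  obtain L where "L-lipschitz_on UNIV g"
    using bounded_linear.lipschitz_boundE[OF assms(2)] by metis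
  then have "L-lipschitz_on (f ` {a..b}) g" using lipschitz_on_subset by blast
  then show ?thesis by (rule absolutely_continuous_on_lipschitz_image[OF assms(1)])
qed

lemma absolutely_continuous_on_imp_continuous_on:
  assumes f: "absolutely_continuous_on a b f"
  shows "continuous_on {a..b} f"
  unfolding continuous_on_iff
proof (intro ballI allI impI)
  fix x e :: real assume x: "x \<in> {a..b}" and "e > 0"
  obtain d where d: "d > 0"
    "\<And>\<D>. \<lbrakk>\<D> division_of \<Union>\<D>; \<Union>\<D> \<subseteq> {a..b}; (\<Sum>K\<in>\<D>. Sup K - Inf K) < d\<rbrakk>
        \<Longrightarrow> (\<Sum>K\<in>\<D>. norm (f (Sup K) - f (Inf K))) < e"
    by (rule absolutely_continuous_onD[OF f \<open>e > 0\<close>]) auto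
  have small: "norm (f v - f u) < e" if "u \<in> {a..b}" "v \<in> {a..b}" "u \<le> v" "v - u < d" for u v
  proof -
    have "{{u..v}} division_of \<Union>{{u..v}}" using that division_of_self[of u v] by auto
    then show ?thesis using d(2)[of "{{u..v}}"] that by auto
  qed
  show "\<exists>d>0. \<forall>x'\<in>{a..b}. dist x' x < d \<longrightarrow> dist (f x') (f x) < e"
  proof (intro exI[of _ d] conjI ballI impI)
    fix y assume y: "y \<in> {a..b}" "dist y x < d"
    then show "dist (f y) (f x) < e"
      using small[of x y] small[of y x] x
      by (cases "x \<le> y") (auto simp: dist_norm norm_minus_commute)
  qed (fact d(1))
qed

lemma absolutely_continuous_on_power2:
  fixes f :: "real \<Rightarrow> real"
  assumes f: "absolutely_continuous_on a b f"
  shows "absolutely_continuous_on a b (\<lambda>t. (f t)\<^sup>2)"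
proof -
  have "compact (f ` {a..b})"
    by (intro compact_continuous_image absolutely_continuous_on_imp_continuous_on f) simp
  then obtain R where R: "\<And>y. y \<in> f ` {a..b} \<Longrightarrow> \<bar>y\<bar> \<le> R" and "R > 0"
    using compact_imp_bounded bounded_pos by (metis real_norm_def)
  have "(2 * R)-lipschitz_on (f ` {a..b}) (\<lambda>y. y\<^sup>2)"
  proof (rule lipschitz_onI)
    fix y z assume "y \<in> f ` {a..b}" "z \<in> f ` {a..b}"
    then have "\<bar>y + z\<bar> \<le> 2 * R" using R[of y] R[of z] by linarith
    have "y\<^sup>2 - z\<^sup>2 = (y + z) * (y - z)" by (simp add: power2_eq_square algebra_simps)
    then show "dist (y\<^sup>2) (z\<^sup>2) \<le> 2 * R * dist y z"
      using \<open>\<bar>y + z\<bar> \<le> 2 * R\<close> by (simp add: dist_real_def abs_mult mult_right_mono)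
  qed (use \<open>R > 0\<close> in simp)
  then show ?thesis by (rule absolutely_continuous_on_lipschitz_image[OF f])
qed

text \<open>
  A tagged division may contain the same degenerate interval under several tags. Such intervals
  contribute nothing, so that sums over tags can be read as sums over the intervals themselves, to which
  absolute continuity of \<open>f\<close> (the assumption on all \<open>\<D>\<close>) applies.
\<close>
lemma tagged_sum_ends_less:
  fixes f :: "real \<Rightarrow> real"
  assumes q: "q tagged_partial_division_of {a..b}"
    and T: "open T" "T \<in> lmeasurable" "measure lebesgue T < d" "\<And>x K. (x, K) \<in> q \<Longrightarrow> K \<subseteq> T"
    and small: "\<And>\<D>. \<lbrakk>\<D> division_of \<Union>\<D>; \<Union>\<D> \<subseteq> {a..b}; (\<Sum>K\<in>\<D>. Sup K - Inf K) < d\<rbrakk>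
        \<Longrightarrow> (\<Sum>K\<in>\<D>. norm (f (Sup K) - f (Inf K))) < e"
  shows "(\<Sum>(x, K)\<in>q. \<bar>f (Sup K) - f (Inf K)\<bar>) < e" "(\<Sum>(x, K)\<in>q. Sup K - Inf K) < d"
proof -
  note Un = tagged_partial_division_of_Union_self[OF q]
  define \<D> where "\<D> = snd ` q"
  have div: "\<D> division_of \<Union>\<D>" unfolding \<D>_def by (rule division_of_tagged_division[OF Un])
  have sub: "\<Union>\<D> \<subseteq> {a..b}" using tagged_partial_division_ofD(3)[OF q] unfolding \<D>_def by force
  have deg: "u = v \<or> cbox u v = {}" if "box u v = {}" for u v :: real
    using that by (auto simp: box_real)
  have conv: "(\<Sum>(x, K)\<in>q. h (Sup K) (Inf K)) = (\<Sum>K\<in>\<D>. h (Sup K) (Inf K))"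
    if h: "\<And>u. h u u = 0" for h :: "real \<Rightarrow> real \<Rightarrow> real"
  proof -
    have "(\<Sum>(x, K)\<in>q. if K = {} then 0 else h (Sup K) (Inf K)) = (\<Sum>K\<in>\<D>. if K = {} then 0 else h (Sup K) (Inf K))"
      unfolding \<D>_def
      by (rule sum.over_tagged_division_lemma[OF Un]) (use deg h in \<open>fastforce simp: box_real\<close>)
    moreover have "(\<Sum>(x, K)\<in>q. if K = {} then 0 else h (Sup K) (Inf K)) = (\<Sum>(x, K)\<in>q. h (Sup K) (Inf K))"
      by (rule sum.cong) (use tagged_partial_division_ofD(2)[OF q] in fastforce)+
    moreover have "(\<Sum>K\<in>\<D>. if K = {} then 0 else h (Sup K) (Inf K)) = (\<Sum>K\<in>\<D>. h (Sup K) (Inf K))"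
      by (rule sum.cong) (use division_ofD(3)[OF div] in auto)
    ultimately show ?thesis by simp
  qed
  have "(\<Sum>K\<in>\<D>. Sup K - Inf K) = (\<Sum>K\<in>\<D>. measure lebesgue K)"
    by (rule sum.cong) (auto elim!: division_of_real_ends[OF div sub])
  also have "\<dots> = measure lebesgue (\<Union>\<D>)" using content_division[OF div] by simp
  also have "\<dots> \<le> measure lebesgue T"
  proof (rule measure_mono_fmeasurable)
    show "\<Union>\<D> \<subseteq> T" using T(4) unfolding \<D>_def by fastforce
  qed (use lmeasurable_division[OF div] T(2) in \<open>auto simp: fmeasurableD\<close>)
  finally have lt: "(\<Sum>K\<in>\<D>. Sup K - Inf K) < d" using T(3) by simp
  show "(\<Sum>(x, K)\<in>q. Sup K - Inf K) < d"
    using conv[of "\<lambda>u v. u - v"] lt by simp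
  show "(\<Sum>(x, K)\<in>q. \<bar>f (Sup K) - f (Inf K)\<bar>) < e"
    using conv[of "\<lambda>u v. \<bar>f u - f v\<bar>"] small[OF div sub lt] by simp
qed

text \<open>
  The straddle lemma: \<open>f\<close> is compared with its tangent at both ends, and since \<open>t\<close> lies between them the
  two errors add up to at most \<open>e (v - u)\<close>.
\<close>
lemma has_real_derivative_straddle_lower:
  fixes f :: "real \<Rightarrow> real"
  assumes "(f has_vector_derivative D) (at t within {a..b})" "D \<ge> c" "e > 0" "t \<in> {a..b}"
  obtains r where "r > 0"
    "\<And>u v. \<lbrakk>u \<in> {a..b}; v \<in> {a..b}; u \<le> t; t \<le> v; t - u < r; v - t < r\<rbrakk>
       \<Longrightarrow> f v - f u \<ge> (c - e) * (v - u)"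
proof -
  have "(f has_derivative (\<lambda>x. x *\<^sub>R D)) (at t within {a..b})"
    using assms(1) by (simp add: has_vector_derivative_def)
  then obtain r where r: "r > 0"
    "\<And>y. \<lbrakk>y \<in> {a..b}; norm (y - t) < r\<rbrakk> \<Longrightarrow> norm (f y - f t - (y - t) *\<^sub>R D) \<le> e * norm (y - t)"
    using \<open>e > 0\<close> unfolding has_derivative_within_alt by metis
  show thesis
  proof
    fix u v assume uv: "u \<in> {a..b}" "v \<in> {a..b}" "u \<le> t" "t \<le> v" "t - u < r" "v - t < r"
    have "f v - f t \<ge> (v - t) * D - e * (v - t)" using r(2)[of v] uv by (auto simp: abs_le_iff)
    moreover have "f t - f u \<ge> (t - u) * D - e * (t - u)"
      using r(2)[of u] uv by (auto simp: abs_le_iff algebra_simps)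
    ultimately have "f v - f u \<ge> (v - u) * D - e * (v - u)" by (simp add: algebra_simps)
    moreover have "(v - u) * D \<ge> (v - u) * c" using assms(2) uv by (intro mult_left_mono) auto
    ultimately show "f v - f u \<ge> (c - e) * (v - u)" by (simp add: algebra_simps)
  qed (fact r(1))
qed

text \<open>
  Cousin's lemma replaces integration. The gauge at a point with a derivative is small enough for
  linear growth at rate \<open>c - e\<close>; at an exceptional point it stays inside an open set of small measure
  around \<open>N\<close>, so that by absolute continuity the intervals tagged there contribute little to the
  increment of \<open>f\<close>.
\<close>
theorem absolutely_continuous_growth:
  fixes f :: "real \<Rightarrow> real"
  assumes ac: "absolutely_continuous_on a b f" and "a \<le> b" and N: "negligible N"
    and der: "\<And>t. \<lbrakk>t \<in> {a..b}; t \<notin> N\<rbrakk> \<Longrightarrow> \<exists>D\<ge>c. (f has_vector_derivative D) (at t within {a..b})"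
  shows "c * (b - a) \<le> f b - f a"
proof (rule field_le_epsilon)
  fix e0 :: real assume "e0 > 0"
  define e where "e = e0 / (b - a + \<bar>c\<bar> + 3)"
  have e: "e > 0" using \<open>e0 > 0\<close> \<open>a \<le> b\<close> by (simp add: e_def)
  obtain d where d: "d > 0"
    "\<And>\<D>. \<lbrakk>\<D> division_of \<Union>\<D>; \<Union>\<D> \<subseteq> {a..b}; (\<Sum>K\<in>\<D>. Sup K - Inf K) < d\<rbrakk>
        \<Longrightarrow> (\<Sum>K\<in>\<D>. norm (f (Sup K) - f (Inf K))) < e"
    by (rule absolutely_continuous_onD[OF ac e]) auto
  define d' where "d' = min d (min e 1)"
  have d': "d' > 0" "d' \<le> d" "d' \<le> e" "d' \<le> 1" using d e by (auto simp: d'_def)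
  obtain T where T: "open T" "N \<subseteq> T" "T \<in> lmeasurable" "measure lebesgue T < d'"
  proof -
    have nul: "N \<in> null_sets lebesgue" using N negligible_iff_null_sets by blast
    then obtain T where T: "open T" "N \<subseteq> T" "T - N \<in> lmeasurable" "emeasure lebesgue (T - N) < ennreal d'"
      using sets_lebesgue_outer_open[of N d'] d'(1) by blast
    have "T \<in> lmeasurable" "measure lebesgue T = measure lebesgue (T - N)"
    proof -
      have "T = (T - N) \<union> N" using T by auto
      then show "T \<in> lmeasurable"
        using T(3) nul by (metis fmeasurable.Un negligible_iff_null_sets N negligible_imp_measurable)
      then show "measure lebesgue T = measure lebesgue (T - N)"
        using nul by (simp add: measure_Diff_null_set fmeasurableD)
    qed
    moreover have "measure lebesgue (T - N) < d'"
      using T(3,4) d'(1) by (simp add: emeasure_eq_measure2 ennreal_less_iff)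
    ultimately show thesis using that T by metis
  qed
  have "\<exists>r>0. \<forall>u v. u \<in> {a..b} \<longrightarrow> v \<in> {a..b} \<longrightarrow> u \<le> t \<longrightarrow> t \<le> v \<longrightarrow> t - u < r \<longrightarrow> v - t < r
       \<longrightarrow> f v - f u \<ge> (c - e) * (v - u)" if "t \<in> {a..b}" "t \<notin> N" for t
    using der[OF that] has_real_derivative_straddle_lower[OF _ _ e that(1)] by metis
  then obtain r where r: "\<And>t. \<lbrakk>t \<in> {a..b}; t \<notin> N\<rbrakk> \<Longrightarrow> r t > 0"
    "\<And>t u v. \<lbrakk>t \<in> {a..b}; t \<notin> N; u \<in> {a..b}; v \<in> {a..b}; u \<le> t; t \<le> v; t - u < r t; v - t < r t\<rbrakk>
       \<Longrightarrow> f v - f u \<ge> (c - e) * (v - u)"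
    by metis
  define g where "g = (\<lambda>t. if t \<in> N then T else if t \<in> {a..b} then ball t (r t) else ball t 1)"
  have "gauge g" unfolding gauge_def g_def using T(1,2) r(1) by auto
  then obtain p where p: "p tagged_division_of {a..b}" "g fine p"
    using fine_division_exists_real by blast
  \<comment> \<open>the part of the division that is tagged in the exceptional set\<close>
  define q where "q = {(t, K) \<in> p. t \<in> N}"
  have fin: "finite p" "q \<subseteq> p" using p(1) by (auto simp: q_def)
  then have "finite q" by (rule rev_finite_subset)
  have q: "q tagged_partial_division_of {a..b}"
    using p(1) fin(2) tagged_partial_division_subset unfolding tagged_division_of_def by blast
  have "(\<Sum>(x, K)\<in>q. \<bar>f (Sup K) - f (Inf K)\<bar>) < e" "(\<Sum>(x, K)\<in>q. Sup K - Inf K) < d'"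
  proof -
    have sub: "\<And>x K. (x, K) \<in> q \<Longrightarrow> K \<subseteq> T"
      using p(2) unfolding fine_def q_def g_def by fastforce
    show "(\<Sum>(x, K)\<in>q. \<bar>f (Sup K) - f (Inf K)\<bar>) < e"
      by (rule tagged_sum_ends_less(1)[OF q T(1,3) _ sub d(2)]) (use T(4) d' in auto)
    show "(\<Sum>(x, K)\<in>q. Sup K - Inf K) < d'"
      by (rule tagged_sum_ends_less(2)[OF q T(1,3,4) sub, where f=f and e=e]) (use d(2) d' in auto)
  qed
  note bad = this
  have ends: "\<exists>u v. K = {u..v} \<and> u \<le> t \<and> t \<le> v \<and> u \<in> {a..b} \<and> v \<in> {a..b}" if "(t, K) \<in> p" for t K
    using tagged_division_ofD(2,3,4)[OF p(1) that] by fastforce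
  have good: "(c - e) * (Sup K - Inf K) \<le> f (Sup K) - f (Inf K)" if tK: "(t, K) \<in> p - q" for t K
  proof -
    obtain u v where uv: "K = {u..v}" "u \<le> t" "t \<le> v" "u \<in> {a..b}" "v \<in> {a..b}"
      using ends tK by blast
    have t: "t \<in> {a..b}" "t \<notin> N" using uv tK by (auto simp: q_def)
    have "{u..v} \<subseteq> ball t (r t)" using p(2) tK t uv unfolding fine_def g_def by force
    moreover have "u \<in> {u..v}" "v \<in> {u..v}" using uv(2,3) by auto
    ultimately have "u \<in> ball t (r t)" "v \<in> ball t (r t)" by blast+
    then have "t - u < r t" "v - t < r t" using uv(2,3) by (auto simp: dist_real_def)
    then show ?thesis using r(2)[OF t uv(4,5,2,3)] uv by simp
  qed
  have len: "0 \<le> Sup K - Inf K" if "(t, K) \<in> p" for t K using ends[OF that] by auto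
  define S1 where "S1 = (\<Sum>(x, K)\<in>q. Sup K - Inf K)"
  have S1: "0 \<le> S1" "S1 < d'" unfolding S1_def using bad(2) len fin(2)
    by (auto intro!: sum_nonneg)
  have tot: "(\<Sum>(x, K)\<in>p. Sup K - Inf K) = b - a"
    using additive_tagged_division_1[OF \<open>a \<le> b\<close> p(1), of "\<lambda>x. x"] by simp
  have "f b - f a = (\<Sum>(x, K)\<in>p. f (Sup K) - f (Inf K))"
    using additive_tagged_division_1[OF \<open>a \<le> b\<close> p(1), of f] by simp
  also have "\<dots> = (\<Sum>(x, K)\<in>p - q. f (Sup K) - f (Inf K)) + (\<Sum>(x, K)\<in>q. f (Sup K) - f (Inf K))"
    using fin by (simp add: sum.subset_diff)
  finally have eq: "f b - f a = \<dots>" .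
  have "(\<Sum>(x, K)\<in>p - q. f (Sup K) - f (Inf K)) \<ge> (\<Sum>(x, K)\<in>p - q. (c - e) * (Sup K - Inf K))"
    by (rule sum_mono) (use good in auto)
  moreover have "(\<Sum>(x, K)\<in>p - q. (c - e) * (Sup K - Inf K)) = (c - e) * (b - a - S1)"
  proof -
    have "(\<Sum>(x, K)\<in>p - q. (Sup K - Inf K)) = b - a - S1"
      using sum_diff[OF fin(1,2), of "\<lambda>(x, K). Sup K - Inf K"] tot S1_def by simp
    then show ?thesis by (simp add: sum_distrib_left case_prod_unfold flip: sum_distrib_left)
  qed
  moreover have "\<bar>\<Sum>(x, K)\<in>q. f (Sup K) - f (Inf K)\<bar> \<le> e"
    using bad(1) sum_abs[of "\<lambda>(x, K). f (Sup K) - f (Inf K)" q] unfolding case_prod_unfold by linarith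
  ultimately have "f b - f a \<ge> (c - e) * (b - a - S1) - e" using eq by linarith
  moreover have "(c - e) * (b - a - S1) \<ge> c * (b - a) - e * (b - a) - \<bar>c\<bar> * e"
  proof -
    have "c * S1 \<le> \<bar>c\<bar> * e" using S1 d' by (intro order_trans[OF mult_right_mono[OF abs_ge_self] mult_left_mono]) auto
    moreover have "0 \<le> e * S1" using e S1 by simp
    ultimately show ?thesis by (simp add: algebra_simps)
  qed
  moreover have "e * (b - a) + \<bar>c\<bar> * e + e \<le> e0"
  proof -
    have "e * (b - a + \<bar>c\<bar> + 3) = e0" using \<open>a \<le> b\<close> by (simp add: e_def)
    then show ?thesis using e by (simp add: algebra_simps)
  qed
  ultimately show "c * (b - a) \<le> f b - f a + e0" by linarith
qed

section \<open>Growth and Barbalat's lemma on the half-line\<close>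

lemma halfline_growth:
  fixes y :: "real \<Rightarrow> real"
  assumes ac: "\<And>T. T \<ge> 0 \<Longrightarrow> absolutely_continuous_on 0 T y" and N: "negligible N"
    and st: "0 \<le> s" "s \<le> t"
    and der: "\<And>u. \<lbrakk>s \<le> u; u \<le> t; u \<notin> N\<rbrakk> \<Longrightarrow> \<exists>D\<ge>c. (y has_vector_derivative D) (at u within {0..})"
  shows "c * (t - s) \<le> y t - y s"
proof (rule absolutely_continuous_growth[OF _ st(2) N])
  show "absolutely_continuous_on s t y"
    using ac[of t] st by (auto intro: absolutely_continuous_on_subinterval)
  fix u assume u: "u \<in> {s..t}" "u \<notin> N"
  then obtain D where "D \<ge> c" "(y has_vector_derivative D) (at u within {0..})"
    using der by auto
  moreover have "{s..t} \<subseteq> {0..}" using st by auto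
  ultimately show "\<exists>D\<ge>c. (y has_vector_derivative D) (at u within {s..t})"
    using has_vector_derivative_within_subset by blast
qed

text \<open>
  Testing the curve against the fixed vector \<open>x s - x t\<close> reduces the claim to growth of a scalar
  function.
\<close>
lemma halfline_speed_lipschitz:
  fixes x :: "real \<Rightarrow> 'a::real_inner"
  assumes ac: "\<And>T. T \<ge> 0 \<Longrightarrow> absolutely_continuous_on 0 T x" and N: "negligible N"
    and der: "\<And>u. \<lbrakk>0 \<le> u; u \<notin> N\<rbrakk> \<Longrightarrow> \<exists>D. norm D \<le> L \<and> (x has_vector_derivative D) (at u within {0..})"
    and "L \<ge> 0"
  shows "L-lipschitz_on {0..} x"
proof -
  have le: "norm (x t - x s) \<le> L * (t - s)" if st: "0 \<le> s" "s \<le> t" for s t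
  proof -
    define w where "w = x s - x t"
    have bl: "bounded_linear (\<lambda>z. w \<bullet> z)" by (rule bounded_linear_inner_right)
    have "- (norm w * L) * (t - s) \<le> w \<bullet> x t - w \<bullet> x s"
    proof (rule halfline_growth[OF _ N st])
      show "absolutely_continuous_on 0 T (\<lambda>u. w \<bullet> x u)" if "T \<ge> 0" for T
        by (rule absolutely_continuous_on_bounded_linear[OF ac[OF that] bl])
      fix u assume "s \<le> u" "u \<le> t" "u \<notin> N"
      then obtain D where D: "norm D \<le> L" "(x has_vector_derivative D) (at u within {0..})"
        using der[of u] st(1) by auto
      have "((\<lambda>u. w \<bullet> x u) has_vector_derivative w \<bullet> D) (at u within {0..})"
        by (rule bounded_linear.has_vector_derivative[OF bl D(2)])
      moreover have "- (norm w * L) \<le> w \<bullet> D"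
        using Cauchy_Schwarz_ineq2[of w D] mult_left_mono[OF D(1), of "norm w"] by (simp add: abs_le_iff)
      ultimately show "\<exists>D\<ge>- (norm w * L). ((\<lambda>u. w \<bullet> x u) has_vector_derivative D) (at u within {0..})"
        by blast
    qed
    moreover have "w \<bullet> x t - w \<bullet> x s = - (norm w)\<^sup>2"
      by (simp add: w_def power2_norm_eq_inner inner_diff_right)
    ultimately have "norm w * norm w \<le> norm w * (L * (t - s))"
      by (simp add: power2_eq_square algebra_simps)
    then have "norm w \<le> L * (t - s)"
      using \<open>L \<ge> 0\<close> st by (cases "norm w = 0") (auto simp: mult_le_cancel_left)
    then show ?thesis by (simp add: w_def norm_minus_commute)
  qed
  show ?thesis
  proof (rule lipschitz_onI)
    fix s t :: real assume "s \<in> {0..}" "t \<in> {0..}"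
    then show "dist (x s) (x t) \<le> L * dist s t"
      using le[of s t] le[of t s] by (cases "s \<le> t") (auto simp: dist_norm norm_minus_commute)
  qed fact
qed

text \<open>
  If \<open>g t \<ge> e\<close>, then uniform continuity keeps \<open>g\<close> above \<open>e / 2\<close> on an interval whose length does not
  depend on \<open>t\<close>, and \<open>y\<close> gains a fixed amount on it, which convergence of \<open>y\<close> excludes for late \<open>t\<close>. The
  one-sided form is made for projected dynamics, where the derivative is only known to dominate the
  drift before projection.
\<close>
lemma barbalat_upper:
  fixes y g :: "real \<Rightarrow> real"
  assumes ac: "\<And>T. T \<ge> 0 \<Longrightarrow> absolutely_continuous_on 0 T y" and N: "negligible N"
    and der: "\<forall>\<^sub>F u in at_top. u \<notin> N \<longrightarrow> (\<exists>D\<ge>g u. (y has_vector_derivative D) (at u within {0..}))"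
    and conv: "(y \<longlongrightarrow> c) at_top" and g: "uniformly_continuous_on {0..} g" and e: "e > 0"
  shows "\<forall>\<^sub>F t in at_top. g t < e"
proof -
  obtain d where d: "d > 0" "\<And>s t. \<lbrakk>s \<ge> 0; t \<ge> 0; dist s t < d\<rbrakk> \<Longrightarrow> dist (g s) (g t) < e / 2"
    using g[unfolded uniformly_continuous_on_def, rule_format, of "e / 2"] e by auto
  define h where "h = d / 2"
  have h: "h > 0" "h < d" using d by (auto simp: h_def)
  have "\<forall>\<^sub>F t in at_top. dist (y t) c < e * h / 4"
    using conv e h by (intro tendstoD) auto
  then obtain T where T: "\<And>t. t \<ge> T \<Longrightarrow> dist (y t) c < e * h / 4"
    by (auto simp: eventually_at_top_linorder)
  obtain T' where T': "\<And>u. \<lbrakk>u \<ge> T'; u \<notin> N\<rbrakk> \<Longrightarrow> \<exists>D\<ge>g u. (y has_vector_derivative D) (at u within {0..})"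
    using der by (auto simp: eventually_at_top_linorder)
  have "g t < e" if t: "t \<ge> max 0 (max T T')" for t
  proof (rule ccontr)
    assume "\<not> g t < e"
    have low: "g u \<ge> e / 2" if "t \<le> u" "u \<le> t + h" for u
    proof -
      have "dist (g u) (g t) < e / 2" using that t h by (intro d(2)) (auto simp: dist_real_def)
      then have "g u > g t - e / 2" unfolding dist_real_def by linarith
      then show ?thesis using \<open>\<not> g t < e\<close> by linarith
    qed
    have "e / 2 * (t + h - t) \<le> y (t + h) - y t"
    proof (rule halfline_growth[OF ac N])
      fix u assume u: "t \<le> u" "u \<le> t + h" "u \<notin> N"
      then obtain D where "D \<ge> g u" "(y has_vector_derivative D) (at u within {0..})"
        using T'[of u] t by auto
      then show "\<exists>D\<ge>e / 2. (y has_vector_derivative D) (at u within {0..})"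
        using low[OF u(1,2)] order_trans by blast
    qed (use t h in auto)
    then have "e * h / 2 \<le> y (t + h) - y t" by simp
    moreover have "dist (y (t + h)) c < e * h / 4" "dist (y t) c < e * h / 4" using T t h by auto
    ultimately show False unfolding dist_real_def by linarith
  qed
  then show ?thesis unfolding eventually_at_top_linorder by blast
qed

lemma barbalat_derivative:
  fixes y g :: "real \<Rightarrow> real"
  assumes ac: "\<And>T. T \<ge> 0 \<Longrightarrow> absolutely_continuous_on 0 T y" and N: "negligible N"
    and der: "\<forall>\<^sub>F u in at_top. u \<notin> N \<longrightarrow> (y has_vector_derivative g u) (at u within {0..})"
    and conv: "(y \<longlongrightarrow> c) at_top" and g: "uniformly_continuous_on {0..} g"
  shows "(g \<longlongrightarrow> 0) at_top"
proof (rule tendstoI)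
  fix e :: real assume e: "e > 0"
  have up: "\<forall>\<^sub>F t in at_top. g t < e"
    by (rule barbalat_upper[OF ac N _ conv g e]) (use der in \<open>auto elim!: eventually_mono\<close>)
  have bl: "bounded_linear (uminus :: real \<Rightarrow> real)" by (intro bounded_linear_minus bounded_linear_ident)
  have "\<forall>\<^sub>F t in at_top. - g t < e"
  proof (rule barbalat_upper[OF _ N _ tendsto_minus[OF conv] _ e])
    show "absolutely_continuous_on 0 T (\<lambda>t. - y t)" if "T \<ge> 0" for T
      by (rule absolutely_continuous_on_bounded_linear[OF ac[OF that] bl])
    show "\<forall>\<^sub>F u in at_top. u \<notin> N \<longrightarrow> (\<exists>D\<ge>- g u. ((\<lambda>t. - y t) has_vector_derivative D) (at u within {0..}))"
      using der by eventually_elim (auto intro: has_vector_derivative_minus)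
    show "uniformly_continuous_on {0..} (\<lambda>u. - g u)" by (rule uniformly_continuous_on_minus[OF g])
  qed
  with up show "\<forall>\<^sub>F t in at_top. dist (g t) 0 < e"
    by eventually_elim (auto simp: dist_real_def)
qed

text \<open>
  The form used for a Lyapunov function \<open>- y\<close> with dissipation \<open>k h\<^sup>2\<close>.
\<close>
lemma barbalat_square:
  fixes y h :: "real \<Rightarrow> real"
  assumes ac: "\<And>T. T \<ge> 0 \<Longrightarrow> absolutely_continuous_on 0 T y" and N: "negligible N"
    and der: "\<And>u. \<lbrakk>u \<ge> 0; u \<notin> N\<rbrakk> \<Longrightarrow> \<exists>D\<ge>k * (h u)\<^sup>2. (y has_vector_derivative D) (at u within {0..})"
    and conv: "(y \<longlongrightarrow> c) at_top" and g: "uniformly_continuous_on {0..} (\<lambda>u. (h u)\<^sup>2)" and k: "k > 0"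
  shows "(h \<longlongrightarrow> 0) at_top"
proof (rule tendstoI)
  fix e :: real assume e: "e > 0"
  have "\<forall>\<^sub>F t in at_top. k * (h t)\<^sup>2 < k * e\<^sup>2"
  proof (rule barbalat_upper[OF ac N _ conv])
    show "\<forall>\<^sub>F u in at_top. u \<notin> N \<longrightarrow> (\<exists>D\<ge>k * (h u)\<^sup>2. (y has_vector_derivative D) (at u within {0..}))"
      using eventually_ge_at_top[of 0] by eventually_elim (use der in auto)
    show "uniformly_continuous_on {0..} (\<lambda>u. k * (h u)\<^sup>2)"
      by (rule bounded_linear.uniformly_continuous_on[OF bounded_linear_mult_right g])
  qed (use e k in auto)
  then show "\<forall>\<^sub>F t in at_top. dist (h t) 0 < e"
  proof eventually_elim
    fix t assume "k * (h t)\<^sup>2 < k * e\<^sup>2"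
    then have "\<bar>h t\<bar>\<^sup>2 < e\<^sup>2" using k by simp
    then have "\<bar>h t\<bar> < e" by (rule power_less_imp_less_base) (use e in simp)
    then show "dist (h t) 0 < e" by (simp add: dist_real_def)
  qed
qed

lemma antimono_bounded_below_tendsto:
  fixes v :: "real \<Rightarrow> real"
  assumes mono: "\<And>s t. \<lbrakk>0 \<le> s; s \<le> t\<rbrakk> \<Longrightarrow> v t \<le> v s" and low: "\<And>t. t \<ge> 0 \<Longrightarrow> v t \<ge> b"
  obtains c where "(v \<longlongrightarrow> c) at_top"
proof -
  define c where "c = (INF t\<in>{0..}. v t)"
  have bdd: "bdd_below (v ` {0..})" using low by (intro bdd_belowI2[where m = b]) auto
  have "(v \<longlongrightarrow> c) at_top"
  proof (rule decreasing_tendsto)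
    show "\<forall>\<^sub>F t in at_top. c \<le> v t"
      using eventually_ge_at_top[of 0]
    proof eventually_elim
      fix t :: real assume "0 \<le> t"
      then show "c \<le> v t" unfolding c_def by (intro cINF_lower[OF bdd]) simp
    qed
    fix x assume "c < x"
    then have "\<exists>s\<in>{0..}. v s < x"
      unfolding c_def by (subst (asm) cINF_less_iff[OF _ bdd]) auto
    then obtain s where s: "s \<ge> 0" "v s < x" by auto
    show "\<forall>\<^sub>F t in at_top. v t < x"
      using eventually_ge_at_top[of s]
    proof eventually_elim
      fix t assume "s \<le> t"
      then show "v t < x" using mono[OF s(1)] s(2) by (meson le_less_trans)
    qed
  qed
  then show thesis by (rule that)
qed

text \<open>
  After the last time with \<open>y \<ge> 0\<close> the function would be nondecreasing. That time itself is added to the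
  exceptional set because nothing is known about the derivative there.
\<close>
lemma halfline_nonneg_invariant:
  fixes y :: "real \<Rightarrow> real"
  assumes ac: "\<And>T. T \<ge> 0 \<Longrightarrow> absolutely_continuous_on 0 T y" and N: "negligible N"
    and der: "\<And>u. \<lbrakk>u \<ge> 0; u \<notin> N; y u < 0\<rbrakk> \<Longrightarrow> \<exists>D\<ge>0. (y has_vector_derivative D) (at u within {0..})"
    and y0: "y 0 \<ge> 0" and t: "t \<ge> 0"
  shows "y t \<ge> 0"
proof (rule ccontr)
  assume neg: "\<not> y t \<ge> 0"
  define Z where "Z = {u \<in> {0..t}. 0 \<le> y u}"
  have cont: "continuous_on {0..t} y" by (rule absolutely_continuous_on_imp_continuous_on[OF ac[OF t]])
  have "Z = {0..t} \<inter> y -` {0..}" by (auto simp: Z_def)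
  then have "closed Z" using continuous_closed_preimage[OF cont closed_atLeastAtMost closed_atLeast] by simp
  moreover have "bounded Z" by (rule bounded_subset[of "{0..t}"]) (auto simp: Z_def)
  ultimately have "compact Z" by (simp add: compact_eq_bounded_closed)
  moreover have "Z \<noteq> {}" using y0 t by (auto simp: Z_def)
  ultimately obtain s where s: "s \<in> Z" "\<And>u. u \<in> Z \<Longrightarrow> u \<le> s" by (meson compact_attains_sup)
  have "0 * (t - s) \<le> y t - y s"
  proof (rule halfline_growth[OF ac])
    show "negligible (insert s N)" using N by simp
    fix u assume u: "s \<le> u" "u \<le> t" "u \<notin> insert s N"
    then have "u \<notin> Z" using s(2)[of u] by auto
    then have "y u < 0" "0 \<le> u" using u s(1) by (auto simp: Z_def)
    then show "\<exists>D\<ge>0. (y has_vector_derivative D) (at u within {0..})" using der u by blast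
  qed (use s(1) in \<open>auto simp: Z_def\<close>)
  then show False using neg s(1) by (auto simp: Z_def)
qed

section \<open>Convex conjugates of strongly convex costs\<close>

text \<open>
  The definition of \<open>gradient_within\<close> as a definite description is meaningful also on the boundary of
  the orthant: the positive coordinate directions stay admissible there, and they determine a linear
  functional.
\<close>
lemma gradient_within_orthant:
  fixes f :: "'a::ordered_euclidean_space \<Rightarrow> real"
  assumes "0 \<le> x" and f: "(f has_derivative (\<lambda>h. g \<bullet> h)) (at x within {0..})"
  shows "gradient_within f {0..} x = g"
  unfolding gradient_within_def
proof (rule the_equality)
  show "(f has_derivative (\<lambda>h. g \<bullet> h)) (at x within {0..})" by (rule f)
next
  fix g' assume g': "(f has_derivative (\<lambda>h. g' \<bullet> h)) (at x within {0..})"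
  have "(\<lambda>h. g' \<bullet> h) = (\<lambda>h. g \<bullet> h)"
  proof (rule frechet_derivative_unique_within[OF g' f])
    fix i :: 'a and e :: real assume i: "i \<in> Basis" "e > 0"
    have "x + (e / 2) *\<^sub>R i \<in> {0..}"
      using \<open>0 \<le> x\<close> i by (auto simp: eucl_le[where 'a='a] inner_add_left inner_Basis)
    then show "\<exists>d. 0 < \<bar>d\<bar> \<and> \<bar>d\<bar> < e \<and> x + d *\<^sub>R i \<in> {0..}"
      using i by (intro exI[of _ "e / 2"]) auto
  qed
  then show "g' = g" by (metis vector_eq_rdot)
qed

lemma halfline_mvt:
  fixes f F :: "real \<Rightarrow> real"
  assumes f: "\<And>x. x \<ge> 0 \<Longrightarrow> (f has_real_derivative F x) (at x within {0..})" and ab: "0 \<le> a" "a < b"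
  obtains z where "a < z" "z < b" "f b - f a = F z * (b - a)"
proof -
  have "(f has_derivative (\<lambda>h. F z * h)) (at z within {a..b})" if "a \<le> z" "z \<le> b" for z
  proof (rule has_derivative_subset)
    show "(f has_derivative (\<lambda>h. F z * h)) (at z within {0..})"
      using f[of z] that ab by (simp add: has_field_derivative_def)
  qed (use ab in auto)
  then have "\<exists>z\<in>{a<..<b}. f b - f a = F z * (b - a)"
    by (rule mvt_simple[OF ab(2)])
  then show thesis using that by auto
qed

lemma strongly_convex_marginal_cost:
  assumes "strongly_convex_C2 f"
  obtains F \<mu> where "\<mu> > 0" "continuous_on {0..} F"
    "\<And>x. x \<ge> 0 \<Longrightarrow> (f has_real_derivative F x) (at x within {0..})"
    "\<And>x y. \<lbrakk>0 \<le> x; x \<le> y\<rbrakk> \<Longrightarrow> \<mu> * (y - x) \<le> F y - F x"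
proof -
  obtain F F' \<mu> where \<mu>: "\<mu> > 0"
    and F: "\<And>x. x \<ge> 0 \<Longrightarrow> (f has_real_derivative F x) (at x within {0..})"
    and F': "\<And>x. x \<ge> 0 \<Longrightarrow> (F has_real_derivative F' x) (at x within {0..})"
    and low: "\<And>x. x \<ge> 0 \<Longrightarrow> F' x > \<mu>"
    using assms unfolding strongly_convex_C2_def by blast
  have "\<mu> * (y - x) \<le> F y - F x" if xy: "0 \<le> x" "x \<le> y" for x y
  proof (cases "x = y")
    case False
    then have "x < y" using xy by simp
    then obtain z where z: "x < z" "F y - F x = F' z * (y - x)"
      using halfline_mvt[OF F' xy(1)] by blast
    then show ?thesis using low[of z] xy by (auto intro!: mult_right_mono)
  qed simp
  moreover have "continuous_on {0..} F"
    unfolding continuous_on_eq_continuous_within 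
    by (auto intro: DERIV_continuous[OF F'])
  ultimately show thesis using that \<mu> F by blast
qed

lemma tangent_below:
  fixes f F :: "real \<Rightarrow> real"
  assumes f: "\<And>x. x \<ge> 0 \<Longrightarrow> (f has_real_derivative F x) (at x within {0..})"
    and F: "\<And>x y. \<lbrakk>0 \<le> x; x \<le> y\<rbrakk> \<Longrightarrow> F x \<le> F y"
    and "p \<ge> 0" "q \<ge> 0"
  shows "f p + F p * (q - p) \<le> f q"
proof -
  consider "p = q" | "p < q" | "q < p" by linarith
  then show ?thesis
  proof cases
    case 2
    then obtain z where z: "p < z" "z < q" "f q - f p = F z * (q - p)"
      using halfline_mvt[OF f \<open>p \<ge> 0\<close>] by blast
    then have "F p * (q - p) \<le> F z * (q - p)" using F[of p z] \<open>p \<ge> 0\<close> by (auto intro!: mult_right_mono)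
    then show ?thesis using z by linarith
  next
    case 3
    then obtain z where z: "q < z" "z < p" "f p - f q = F z * (p - q)"
      using halfline_mvt[OF f \<open>q \<ge> 0\<close>] by blast
    then have "F z * (p - q) \<le> F p * (p - q)" using F[of z p] \<open>q \<ge> 0\<close> by (auto intro!: mult_right_mono)
    then show ?thesis using z by (simp add: algebra_simps)
  qed simp
qed

lemma conjugate_eq:
  assumes "p \<ge> 0" "\<And>q. q \<ge> 0 \<Longrightarrow> y * q - f q \<le> y * p - f p"
  shows "conjugate f y = y * p - f p"
  unfolding conjugate_def
proof (rule cSup_eq_maximum)
  show "y * p - f p \<in> (\<lambda>p. y * p - f p) ` {0..}" using assms(1) by (intro imageI) simp
qed (use assms(2) in auto)

text \<open>
  For a strongly convex cost \<open>f\<close> with derivative \<open>F\<close>, the derivative \<open>G y\<close> of the conjugate is the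
  maximizer \<open>p\<close> of \<open>y p - f p\<close>. It is constructed from the first-order conditions \<open>p \<ge> 0\<close>, \<open>F p \<ge> y\<close>,
  with equality if \<open>p > 0\<close>, which amount to the variational inequality \<open>(F p - y) (q - p) \<ge> 0\<close> for
  \<open>q \<ge> 0\<close>. Adding the inequalities at \<open>y\<close> and \<open>z\<close> and using strong monotonicity of \<open>F\<close> gives the
  cocoercivity of \<open>G\<close>. Differentiability follows because two instances of Young's inequality enclose the
  increment of the conjugate between \<open>(z - y) G y\<close> and \<open>(z - y) G z\<close>.
\<close>
lemma conjugate_derivative_monotone:
  assumes sc: "strongly_convex_C2 f" and g0: "gradient_within f {0..} 0 \<ge> 0"
  obtains G F \<mu> where "\<mu> > 0" "continuous_on {0..} F" "G 0 = 0"
    "\<And>y. \<lbrakk>y \<ge> 0; G y > 0\<rbrakk> \<Longrightarrow> F (G y) = y"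
    "\<And>y z. \<lbrakk>y \<ge> 0; z \<ge> 0\<rbrakk> \<Longrightarrow> \<mu> * (G y - G z)\<^sup>2 \<le> (y - z) * (G y - G z)"
    "\<And>y. y \<ge> 0 \<Longrightarrow> (conjugate f has_real_derivative G y) (at y within {0..})"
proof -
  obtain F \<mu> where \<mu>: "\<mu> > 0" and contF: "continuous_on {0..} F"
    and f: "\<And>x. x \<ge> 0 \<Longrightarrow> (f has_real_derivative F x) (at x within {0..})"
    and F: "\<And>x y. \<lbrakk>0 \<le> x; x \<le> y\<rbrakk> \<Longrightarrow> \<mu> * (y - x) \<le> F y - F x"
    by (rule strongly_convex_marginal_cost[OF sc]) auto
  have Fmono: "F x \<le> F y" if "0 \<le> x" "x \<le> y" for x y
  proof -
    have "0 \<le> \<mu> * (y - x)" using \<mu> that by simp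
    then show ?thesis using F[OF that] by linarith
  qed
  have "gradient_within f {0..} 0 = F 0"
    by (rule gradient_within_orthant) (use f[of 0] in \<open>simp_all add: has_field_derivative_def\<close>)
  then have F0: "F 0 \<ge> 0" using g0 by simp
  have "\<exists>p\<ge>0. F p \<ge> y \<and> (p > 0 \<longrightarrow> F p = y)" for y
  proof (cases "F 0 \<ge> y")
    case False
    \<comment> \<open>strong monotonicity makes the marginal cost reach \<open>y\<close> before \<open>R\<close>\<close>
    define R where "R = (y - F 0) / \<mu>"
    have R: "R \<ge> 0" "F R \<ge> y" using F[of 0 R] False \<mu> by (auto simp: R_def)
    have "continuous_on {0..R} F" by (rule continuous_on_subset[OF contF]) auto
    then have "\<exists>p. 0 \<le> p \<and> p \<le> R \<and> F p = y" using False R by (intro IVT') auto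
    then show ?thesis by auto
  qed auto
  then obtain G where G: "\<And>y. G y \<ge> 0" "\<And>y. F (G y) \<ge> y" "\<And>y. G y > 0 \<Longrightarrow> F (G y) = y"
    by metis
  have G0: "G 0 = 0"
  proof (rule ccontr)
    assume "G 0 \<noteq> 0"
    then have "G 0 > 0" using G(1)[of 0] by simp
    then have "\<mu> * G 0 > 0" "F (G 0) = 0" using \<mu> G(3) by auto
    then show False using F[of 0 "G 0"] G(1) F0 by simp
  qed
  have strong: "\<mu> * (p - q)\<^sup>2 \<le> (F p - F q) * (p - q)" if "p \<ge> 0" "q \<ge> 0" for p q
  proof (cases "q \<le> p")
    case True
    then have "\<mu> * (p - q) * (p - q) \<le> (F p - F q) * (p - q)"
      using F[of q p] that by (intro mult_right_mono) auto
    then show ?thesis by (simp add: power2_eq_square mult.assoc)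
  next
    case False
    then have "\<mu> * (q - p) * (q - p) \<le> (F q - F p) * (q - p)"
      using F[of p q] that by (intro mult_right_mono) auto
    then show ?thesis by (simp add: power2_eq_square algebra_simps)
  qed
  have vi: "(F (G y) - y) * (q - G y) \<ge> 0" if "q \<ge> 0" for q y
    using G(1,2,3)[of y] that by (cases "G y > 0") auto
  have mono: "\<mu> * (G y - G z)\<^sup>2 \<le> (y - z) * (G y - G z)" for y z
    using strong[OF G(1)[of y] G(1)[of z]] vi[OF G(1), of y z] vi[OF G(1), of z y]
    by (simp add: algebra_simps)
  have opt: "y * q - f q \<le> y * G y - f (G y)" if "q \<ge> 0" for q y
    using tangent_below[OF f Fmono G(1) that, of y] vi[OF that, of y] by (simp add: algebra_simps)
  have conj: "conjugate f y = y * G y - f (G y)" for y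
    by (rule conjugate_eq[OF G(1) opt])
  have young: "y * q - f q \<le> conjugate f y" if "q \<ge> 0" for q y
    using opt[OF that] conj by simp
  have quad: "\<bar>conjugate f z - conjugate f y - (z - y) * G y\<bar> \<le> (z - y)\<^sup>2 / \<mu>" for y z
  proof -
    have "0 \<le> conjugate f z - conjugate f y - (z - y) * G y"
      using young[OF G(1)[of y], of z] conj[of y] by (simp add: algebra_simps)
    moreover have "conjugate f z - conjugate f y - (z - y) * G y \<le> (z - y) * (G z - G y)"
      using young[OF G(1)[of z], of y] conj[of z] by (simp add: algebra_simps)
    moreover have "(z - y) * (G z - G y) \<le> (z - y)\<^sup>2 / \<mu>"
    proof -
      have "0 \<le> (z - y - \<mu> * (G z - G y))\<^sup>2" by simp
      also have "\<dots> = (z - y)\<^sup>2 - 2 * \<mu> * ((z - y) * (G z - G y)) + \<mu> * (\<mu> * (G z - G y)\<^sup>2)"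
        by (simp add: power2_eq_square algebra_simps)
      also have "\<mu> * (\<mu> * (G z - G y)\<^sup>2) \<le> \<mu> * ((z - y) * (G z - G y))"
        using mono[of z y] \<mu> by (intro mult_left_mono) auto
      finally have "\<mu> * ((z - y) * (G z - G y)) \<le> (z - y)\<^sup>2" by (simp add: algebra_simps)
      then show ?thesis using \<mu> by (simp add: field_simps)
    qed
    ultimately show ?thesis by linarith
  qed
  have der: "(conjugate f has_real_derivative G y) (at y within {0..})" for y
  proof -
    have "((\<lambda>z. (conjugate f z - conjugate f y) / (z - y) - G y) \<longlongrightarrow> 0) (at y within {0..})"
    proof (rule Lim_null_comparison)
      show "\<forall>\<^sub>F z in at y within {0..}. norm ((conjugate f z - conjugate f y) / (z - y) - G y) \<le> \<bar>z - y\<bar> / \<mu>"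
        unfolding eventually_at_filter
      proof (rule always_eventually, intro allI impI)
        fix z assume "z \<noteq> y"
        then have "(conjugate f z - conjugate f y) / (z - y) - G y = (conjugate f z - conjugate f y - (z - y) * G y) / (z - y)"
          by (simp add: field_simps)
        then have "norm ((conjugate f z - conjugate f y) / (z - y) - G y) \<le> ((z - y)\<^sup>2 / \<mu>) / \<bar>z - y\<bar>"
          using divide_right_mono[OF quad[of z y], of "\<bar>z - y\<bar>"] by (simp only: real_norm_def abs_divide)
        also have "\<dots> = \<bar>z - y\<bar> / \<mu>"
        proof -
          define d where "d = \<bar>z - y\<bar>"
          have "(z - y)\<^sup>2 = d * d" "d \<noteq> 0" using \<open>z \<noteq> y\<close> by (auto simp: d_def power2_eq_square)
          then show ?thesis unfolding d_def[symmetric] by simp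
        qed
        finally show "norm ((conjugate f z - conjugate f y) / (z - y) - G y) \<le> \<bar>z - y\<bar> / \<mu>" .
      qed
      have "((\<lambda>z. \<bar>z - y\<bar> / \<mu>) \<longlongrightarrow> \<bar>y - y\<bar> / \<mu>) (at y within {0..})"
        by (intro tendsto_intros) (use \<mu> in auto)
      then show "((\<lambda>z. \<bar>z - y\<bar> / \<mu>) \<longlongrightarrow> 0) (at y within {0..})" by simp
    qed
    then show ?thesis unfolding has_field_derivative_iff by (rule iffD2[OF Lim_null])
  qed
  show thesis
    by (rule that[of \<mu> F G]) (use \<mu> contF G0 G(3) mono der in auto)
qed

lemma gradient_total_conjugate:
  fixes b :: "real^'n::finite"
  assumes "\<And>i y. y \<ge> 0 \<Longrightarrow> (conjugate (C i) has_real_derivative G i y) (at y within {0..})" and b: "0 \<le> b"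
  shows "gradient_within (total_conjugate C) {0..} b = (\<chi> i. G i (b $ i))"
proof (rule gradient_within_orthant[OF b])
  have "((\<lambda>b. conjugate (C i) (b $ i)) has_derivative (\<lambda>h. G i (b $ i) * h $ i)) (at b within {0..})" for i
  proof -
    have "(conjugate (C i) has_derivative (\<lambda>h. G i (b $ i) * h)) (at (b $ i) within (\<lambda>b. b $ i) ` {0..})"
      using assms(1)[of "b $ i" i] b unfolding has_field_derivative_def
      by (rule_tac has_derivative_subset[where s = "{0..}"]) (auto simp: less_eq_vec_def)
    then show ?thesis
      by (rule has_derivative_in_compose[OF bounded_linear_imp_has_derivative[OF bounded_linear_vec_nth]])
  qed
  then have "((\<lambda>b. \<Sum>i\<in>UNIV. conjugate (C i) (b $ i)) has_derivative (\<lambda>h. \<Sum>i\<in>UNIV. G i (b $ i) * h $ i)) (at b within {0..})"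
    by (intro has_derivative_sum)
  then show "(total_conjugate C has_derivative (\<bullet>) (\<chi> i. G i (b $ i))) (at b within {0..})"
    unfolding total_conjugate_def inner_vec_def by simp
qed

section \<open>Incidence matrices and edge angles\<close>

text \<open>
  The closed loop is stated with transposed matrices acting on column vectors; this keeps the simplifier
  from turning them into products with row vectors.
\<close>
declare transpose_matrix_vector [simp del]

lemma transpose_incidence_nth:
  assumes "simple_graph pos neg"
  shows "(transpose (incidence pos neg) *v w) $ k = w $ pos k - w $ neg k"
proof -
  have ne: "neg k \<noteq> pos k" using assms by (metis simple_graph_def)
  have "(transpose (incidence pos neg) *v w) $ k
      = (\<Sum>i\<in>UNIV. (if i = pos k then w $ i else 0) - (if i = neg k then w $ i else 0))"
    unfolding matrix_vector_mult_def transpose_def incidence_def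
    by (simp, rule sum.cong) (use ne in auto)
  then show ?thesis by (simp add: sum_subtractf)
qed

lemma transpose_incidence_one:
  assumes "simple_graph pos neg"
  shows "transpose (incidence pos neg) *v 1 = 0"
  by (simp add: vec_eq_iff transpose_incidence_nth[OF assms])

text \<open>
  A vector in the kernel takes equal values at the two ends of every edge, hence along every path.
\<close>
lemma transpose_incidence_kernel:
  assumes "connected_graph pos neg" and "transpose (incidence pos neg) *v w = 0"
  obtains c where "w = c *\<^sub>R 1"
proof -
  have sg: "simple_graph pos neg" and path: "\<And>i j. (i, j) \<in> (adjacent pos neg)\<^sup>*"
    using assms(1) by (auto simp: connected_graph_def)
  have "w $ pos k = w $ neg k" for k
    using transpose_incidence_nth[OF sg, of w k] assms(2) by simp
  then have step: "w $ i = w $ j" if "(i, j) \<in> adjacent pos neg" for i j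
    using that by (auto simp: adjacent_def doubleton_eq_iff)
  have eq: "w $ i = w $ j" for i j
    using path[of i j] by (induction rule: rtrancl_induct) (auto dest: step)
  obtain i0 :: 'b where True by simp
  have "w = (w $ i0) *\<^sub>R 1" using eq by (simp add: vec_eq_iff)
  then show thesis by (rule that)
qed

lemma inner_matrix_vector: "w \<bullet> (N *v z) = (transpose N *v w) \<bullet> (z :: real^'k)"
  by (simp add: dot_lmul_matrix transpose_matrix_vector)

text \<open>
  A connected graph with one edge less than it has nodes: a vector orthogonal to all columns is
  constant, and if it is also orthogonal to \<open>1\<close> it vanishes. So the \<open>CARD('n) - 1\<close> columns span a
  subspace of codimension at most one and are therefore independent.
\<close>
lemma spanning_incidence_injective:
  fixes tpos tneg :: "'t::finite \<Rightarrow> 'n::finite"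
  assumes g: "connected_graph tpos tneg" and card: "CARD('t) = CARD('n) - 1"
    and z: "incidence tpos tneg *v z = 0"
  shows "z = 0"
proof -
  let ?N = "incidence tpos tneg"
  have sg: "simple_graph tpos tneg" using g by (simp add: connected_graph_def)
  have "dim (insert 1 (columns ?N)) \<ge> CARD('n)"
  proof (rule ccontr)
    assume "\<not> ?thesis"
    then have "dim (insert 1 (columns ?N)) < DIM(real^'n)" by simp
    then obtain w where w: "w \<noteq> 0" "\<And>v. v \<in> span (insert 1 (columns ?N)) \<Longrightarrow> orthogonal w v"
      using orthogonal_to_subspace_exists by blast
    have col: "column k ?N \<bullet> w = 0" for k
    proof -
      have "column k ?N \<in> span (insert 1 (columns ?N))" by (rule span_base) (auto simp: columns_def)
      then show ?thesis using w(2)[of "column k ?N"] by (simp add: orthogonal_def inner_commute[of w])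
    qed
    have "transpose ?N *v w = 0"
      unfolding vec_eq_iff
    proof
      fix k show "(transpose ?N *v w) $ k = 0 $ k"
        using col[of k] by (simp add: matrix_vector_mult_def transpose_def column_def inner_vec_def)
    qed
    then obtain c where "w = c *\<^sub>R 1" using transpose_incidence_kernel[OF g] by blast
    moreover have "w \<bullet> 1 = 0" using w(2)[of 1] by (simp add: span_base orthogonal_def)
    ultimately show False using w(1) by simp
  qed
  then have "CARD('n) \<le> rank ?N + 1"
    by (simp add: dim_insert column_rank_def split: if_splits)
  then have "CARD('t) \<le> rank ?N" using card by linarith
  then have "rank ?N = CARD('t)" using rank_bound[of ?N] by simp
  then have "inj (\<lambda>z. ?N *v z)" by (simp add: full_rank_injective)
  then show ?thesis using z injD[of "\<lambda>z. ?N *v z" z 0] by simp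
qed

text \<open>
  The transposed pseudoinverse maps \<open>\<phi>\<close> to a vector of node angles in the range of the tree's incidence
  matrix, which is orthogonal to \<open>1\<close>. If all edge angles vanish, this vector is also constant, hence
  zero.
\<close>
lemma edge_angles_injective:
  fixes pos neg :: "'m::finite \<Rightarrow> 'n::finite" and tpos tneg :: "'t::finite \<Rightarrow> 'n"
  assumes g: "connected_graph pos neg" and t: "connected_graph tpos tneg"
    and card: "CARD('t) = CARD('n) - 1"
    and z: "edge_angles (incidence pos neg) (incidence tpos tneg) \<phi> = 0"
  shows "\<phi> = 0"
proof -
  let ?N = "incidence tpos tneg"
  have inj: "?N *v y = 0 \<Longrightarrow> y = 0" for y by (rule spanning_incidence_injective[OF t card])
  have sgt: "simple_graph tpos tneg" using t by (simp add: connected_graph_def)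
  define Q where "Q = transpose ?N ** ?N"
  have gram: "?N *v y = 0" if "transpose ?N *v (?N *v y) = 0" for y
  proof -
    have "(?N *v y) \<bullet> (?N *v y) = y \<bullet> (transpose ?N *v (?N *v y))"
      using inner_matrix_vector[of "?N *v y" ?N y] by (simp only: inner_commute)
    then show ?thesis using that by simp
  qed
  have "inj ((*v) Q)"
    unfolding matrix_left_invertible_injective[symmetric] matrix_left_invertible_ker
    by (auto simp: Q_def intro!: inj gram simp flip: matrix_vector_mul_assoc)
  then have "invertible Q" by (simp add: invertible_left_inverse matrix_left_invertible_injective)
  then have "Q ** matrix_inv Q = mat 1 \<and> matrix_inv Q ** Q = mat 1"
    unfolding invertible_def matrix_inv_def by (rule someI_ex)
  then have Q: "Q ** matrix_inv Q = mat 1" "matrix_inv Q ** Q = mat 1" by auto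
  have symQ: "transpose Q = Q" by (simp add: Q_def matrix_transpose_mul)
  have sym: "transpose (matrix_inv Q) = matrix_inv Q"
  proof -
    have "transpose (matrix_inv Q) ** Q = mat 1"
      using arg_cong[OF Q(1), of transpose] by (simp add: matrix_transpose_mul symQ)
    then show ?thesis by (metis Q(1) matrix_mul_assoc matrix_mul_lid matrix_mul_rid)
  qed
  define y where "y = matrix_inv Q *v \<phi>"
  have lift: "transpose (left_pinv ?N) *v \<phi> = ?N *v y"
    unfolding left_pinv_def y_def
    by (simp add: matrix_transpose_mul sym matrix_vector_mul_assoc flip: Q_def)
  have "transpose (incidence pos neg) *v (?N *v y) = 0"
    using z unfolding edge_angles_def lift .
  then obtain c where c: "?N *v y = c *\<^sub>R 1" using transpose_incidence_kernel[OF g] by blast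
  have "transpose ?N *v (?N *v y) = c *\<^sub>R (transpose ?N *v 1)"
    unfolding c by (simp add: matrix_vector_mult_scaleR)
  then have "transpose ?N *v (?N *v y) = 0" by (simp add: transpose_incidence_one[OF sgt])
  then have "y = 0" using gram inj by blast
  then have "Q *v (matrix_inv Q *v \<phi>) = 0" by (simp add: y_def)
  then show ?thesis by (simp add: matrix_vector_mul_assoc Q)
qed

section \<open>The coupling potential\<close>

lemma weighted_square_sum_lower:
  fixes d :: "'n::finite \<Rightarrow> real"
  assumes "\<And>i. d i > 0"
  obtains k where "k > 0" "\<And>v::real^'n. k * (norm v)\<^sup>2 \<le> (\<Sum>i\<in>UNIV. d i * (v $ i)\<^sup>2)"
proof
  let ?k = "Min (range d)"
  show "?k > 0" using assms by simp
  fix v :: "real^'n"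
  have "?k * (norm v)\<^sup>2 = (\<Sum>i\<in>UNIV. ?k * (v $ i)\<^sup>2)"
    by (simp add: norm_vec_def L2_set_def sum_nonneg sum_distrib_left)
  also have "\<dots> \<le> (\<Sum>i\<in>UNIV. d i * (v $ i)\<^sup>2)"
    by (intro sum_mono mult_right_mono) auto
  finally show "?k * (norm v)\<^sup>2 \<le> (\<Sum>i\<in>UNIV. d i * (v $ i)\<^sup>2)" .
qed

lemma sin_strongly_monotone:
  fixes \<theta> :: real
  assumes "\<theta> < pi / 2" "\<bar>a\<bar> \<le> \<theta>" "\<bar>b\<bar> \<le> \<theta>"
  shows "cos \<theta> * (b - a)\<^sup>2 \<le> (sin b - sin a) * (b - a)"
proof -
  have le: "cos \<theta> * (y - x) \<le> sin y - sin x" if xy: "x < y" "\<bar>x\<bar> \<le> \<theta>" "\<bar>y\<bar> \<le> \<theta>" for x y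
  proof -
    obtain z where z: "x < z" "z < y" "sin y - sin x = (y - x) * cos z"
      using MVT2[OF xy(1), of sin cos] DERIV_sin by blast
    have "cos \<theta> \<le> cos \<bar>z\<bar>"
      using z xy assms(1) by (intro cos_monotone_0_pi_le) auto
    then have "cos \<theta> \<le> cos z" by (simp add: abs_if split: if_splits)
    then show ?thesis using z xy(1) by (simp add: mult.commute mult_left_mono)
  qed
  consider "a = b" | "a < b" | "b < a" by linarith
  then show ?thesis
  proof cases
    case 2
    then have "cos \<theta> * (b - a) * (b - a) \<le> (sin b - sin a) * (b - a)"
      using le[OF 2 assms(2,3)] by (intro mult_right_mono) auto
    then show ?thesis by (simp add: power2_eq_square mult.assoc)
  next
    case 3
    then have "cos \<theta> * (a - b) * (a - b) \<le> (sin a - sin b) * (a - b)"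
      using le[OF 3 assms(3,2)] by (intro mult_right_mono) auto
    moreover have "cos \<theta> * (a - b) * (a - b) = cos \<theta> * (b - a)\<^sup>2" by (simp add: power2_eq_square algebra_simps)
    moreover have "(sin a - sin b) * (a - b) = (sin b - sin a) * (b - a)" by (simp add: algebra_simps)
    ultimately show ?thesis by simp
  qed simp
qed

lemma neg_cos_strongly_convex:
  fixes \<theta> :: real
  assumes \<theta>: "\<theta> < pi / 2" and ab: "\<bar>a\<bar> \<le> \<theta>" "\<bar>b\<bar> \<le> \<theta>"
  shows "cos \<theta> / 2 * (b - a)\<^sup>2 \<le> cos a - cos b - sin a * (b - a)"
proof -
  \<comment> \<open>convexity of this function on \<open>[- \<theta>, \<theta>]\<close>, with \<open>?h a\<close> as its minimum, is the claim\<close>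
  let ?h = "\<lambda>x. - cos x - sin a * x - cos \<theta> / 2 * (x - a)\<^sup>2"
  let ?h' = "\<lambda>x. sin x - sin a - cos \<theta> * (x - a)"
  have der: "(?h has_real_derivative ?h' x) (at x)" for x
    by (auto intro!: derivative_eq_intros)
  have sgn: "?h' z * (z - a) \<ge> 0" if "\<bar>z\<bar> \<le> \<theta>" for z
    using sin_strongly_monotone[OF \<theta> ab(1) that] by (simp add: power2_eq_square algebra_simps)
  have "?h a \<le> ?h b"
  proof (cases a b rule: linorder_cases)
    case less
    then obtain z where z: "a < z" "z < b" "?h b - ?h a = (b - a) * ?h' z"
      using MVT2[OF less, of ?h ?h'] der by blast
    have "?h' z \<ge> 0" using sgn[of z] z ab by (simp add: zero_le_mult_iff)
    then show ?thesis using z(3) less by (smt (verit) mult_nonneg_nonneg)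
  next
    case greater
    then obtain z where z: "b < z" "z < a" "?h a - ?h b = (a - b) * ?h' z"
      using MVT2[OF greater, of ?h ?h'] der by blast
    have "?h' z \<le> 0" using sgn[of z] z ab by (simp add: zero_le_mult_iff)
    then show ?thesis using z(3) greater by (smt (verit) mult_nonneg_nonpos)
  qed simp
  then show ?thesis by (simp add: algebra_simps)
qed

lemma edge_angles_matrix:
  "edge_angles D Dt \<phi> = (transpose D ** transpose (left_pinv Dt)) *v \<phi>"
  by (simp add: edge_angles_def matrix_vector_mul_assoc)

text \<open>
  The gradient of the potential: the sines are the edge flows, and the transposed edge angle map takes
  them back to the angle coordinates.
\<close>
definition coupling_gradient :: "real^'m::finite \<Rightarrow> real^'m^'n::finite \<Rightarrow> real^'t^'n \<Rightarrow> real^'t::finite \<Rightarrow> real^'t" where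
  "coupling_gradient \<gamma> D Dt \<phi> =
     transpose (transpose D ** transpose (left_pinv Dt)) *v (\<chi> k. \<gamma> $ k * sin (edge_angles D Dt \<phi> $ k))"

lemma inner_coupling_gradient:
  "coupling_gradient \<gamma> D Dt \<phi> \<bullet> h = (\<Sum>k\<in>UNIV. \<gamma> $ k * sin (edge_angles D Dt \<phi> $ k) * edge_angles D Dt h $ k)"
  unfolding coupling_gradient_def
  unfolding edge_angles_matrix inner_matrix_vector[symmetric] by (simp add: inner_vec_def)

lemma potential_diag:
  "potential (diag \<gamma>) D Dt \<phi> = - (\<Sum>k\<in>UNIV. \<gamma> $ k * cos (edge_angles D Dt \<phi> $ k))"
proof -
  have "(diag \<gamma> *v v) $ k = \<gamma> $ k * v $ k" for v and k
    unfolding diag_def matrix_vector_mult_def by (simp add: if_distrib[of "\<lambda>x. x * _"] cong: if_cong)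
  then show ?thesis unfolding potential_def inner_vec_def by simp
qed

lemma bounded_linear_edge_angle: "bounded_linear (\<lambda>\<phi>. edge_angles D Dt \<phi> $ k)"
  unfolding edge_angles_matrix
  by (rule bounded_linear_compose[OF bounded_linear_vec_nth matrix_vector_mul_bounded_linear])

lemma potential_has_derivative:
  "(potential (diag \<gamma>) D Dt has_derivative (\<lambda>h. coupling_gradient \<gamma> D Dt \<phi> \<bullet> h)) (at \<phi>)"
proof -
  have "((\<lambda>\<phi>. - (\<Sum>k\<in>UNIV. \<gamma> $ k * cos (edge_angles D Dt \<phi> $ k))) has_derivative
     (\<lambda>h. - (\<Sum>k\<in>UNIV. \<gamma> $ k * (edge_angles D Dt h $ k * - sin (edge_angles D Dt \<phi> $ k))))) (at \<phi>)"
    by (intro has_derivative_minus has_derivative_sum has_derivative_mult_right has_derivative_cos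
        bounded_linear_imp_has_derivative bounded_linear_edge_angle)
  then show ?thesis
    unfolding potential_diag inner_coupling_gradient by (simp add: sum_negf mult_ac)
qed

lemma continuous_coupling_gradient: "continuous_on S (coupling_gradient \<gamma> D Dt)"
  unfolding coupling_gradient_def
  by (intro bounded_linear.continuous_on[OF matrix_vector_mul_bounded_linear] continuous_on_vec_lambda
      continuous_intros bounded_linear.continuous_on[OF bounded_linear_edge_angle])

lemma cos_1_lipschitz: "1-lipschitz_on S (cos :: real \<Rightarrow> real)"
proof (rule lipschitz_onI)
  fix x y :: real
  show "dist (cos x) (cos y) \<le> 1 * dist x y"
    unfolding dist_norm
    by (rule field_differentiable_bound[OF convex_UNIV, of cos "\<lambda>x. - sin x"])
       (auto intro: DERIV_cos has_field_derivative_at_within)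
qed simp

lemma absolutely_continuous_on_potential:
  assumes "absolutely_continuous_on a b \<phi>"
  shows "absolutely_continuous_on a b (\<lambda>t. potential (diag \<gamma>) D Dt (\<phi> t))"
proof -
  have "absolutely_continuous_on a b (\<lambda>t. edge_angles D Dt (\<phi> t) $ k)" for k
    by (rule absolutely_continuous_on_bounded_linear[OF assms bounded_linear_edge_angle])
  then have "absolutely_continuous_on a b (\<lambda>t. cos (edge_angles D Dt (\<phi> t) $ k))" for k
    by (rule absolutely_continuous_on_lipschitz_image[OF _ cos_1_lipschitz])
  then have "absolutely_continuous_on a b (\<lambda>t. \<gamma> $ k * cos (edge_angles D Dt (\<phi> t) $ k))" for k
    by (rule absolutely_continuous_on_bounded_linear[OF _ bounded_linear_mult_right])
  then have "absolutely_continuous_on a b (\<lambda>t. \<Sum>k\<in>UNIV. \<gamma> $ k * cos (edge_angles D Dt (\<phi> t) $ k))"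
    by (intro absolutely_continuous_on_sum) auto
  then show ?thesis
    unfolding potential_diag
    by (rule absolutely_continuous_on_bounded_linear[OF _ bounded_linear_minus[OF bounded_linear_ident]])
qed

text \<open>
  Near a secure point all edge angles stay in an interval \<open>[- \<theta>, \<theta>]\<close> with \<open>\<theta> < pi / 2\<close>, on which
  \<open>- cos\<close> has curvature at least \<open>cos \<theta> > 0\<close>. Injectivity of the edge angles carries the strong
  convexity over to \<open>\<phi>\<close>.
\<close>
lemma potential_strongly_convex_near_secure:
  fixes D :: "real^'m^'n" and Dt :: "real^'t^'n" and \<gamma> :: "real^'m"
  assumes \<gamma>: "\<And>k. \<gamma> $ k > 0" and inj: "\<And>\<phi>. edge_angles D Dt \<phi> = 0 \<Longrightarrow> \<phi> = 0"
    and sec: "angles_secure D Dt \<phi>0"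
  obtains r \<kappa> where "r > 0" "\<kappa> > 0"
    "\<And>\<phi>. \<phi> \<in> ball \<phi>0 r \<Longrightarrow> \<kappa> * (norm (\<phi> - \<phi>0))\<^sup>2 \<le> potential (diag \<gamma>) D Dt \<phi>
        - potential (diag \<gamma>) D Dt \<phi>0 - coupling_gradient \<gamma> D Dt \<phi>0 \<bullet> (\<phi> - \<phi>0)"
    "\<And>\<phi>. \<phi> \<in> ball \<phi>0 r \<Longrightarrow> \<kappa> * (norm (\<phi> - \<phi>0))\<^sup>2
        \<le> (coupling_gradient \<gamma> D Dt \<phi> - coupling_gradient \<gamma> D Dt \<phi>0) \<bullet> (\<phi> - \<phi>0)"
proof -
  let ?e = "edge_angles D Dt"
  have diff: "?e (x - y) = ?e x - ?e y" for x y
    by (simp add: edge_angles_matrix matrix_vector_mult_diff_distrib)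
  define \<theta>0 where "\<theta>0 = Max (range (\<lambda>k. \<bar>?e \<phi>0 $ k\<bar>))"
  have "\<theta>0 \<in> range (\<lambda>k. \<bar>?e \<phi>0 $ k\<bar>)" unfolding \<theta>0_def by (rule Max_in) auto
  then obtain k0 where "\<theta>0 = \<bar>?e \<phi>0 $ k0\<bar>" by auto
  moreover have "- (pi / 2) < ?e \<phi>0 $ k0" "?e \<phi>0 $ k0 < pi / 2" using sec by (auto simp: angles_secure_def)
  ultimately have th0: "0 \<le> \<theta>0" "\<theta>0 < pi / 2" by linarith+
  define \<theta> where "\<theta> = (\<theta>0 + pi / 2) / 2"
  have th: "0 < \<theta>" "\<theta> < pi / 2" "\<theta>0 < \<theta>" using th0 by (auto simp: \<theta>_def)
  then have c: "cos \<theta> > 0" by (intro cos_gt_zero)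
  have in0: "\<bar>?e \<phi>0 $ k\<bar> < \<theta>" for k
  proof -
    have "\<bar>?e \<phi>0 $ k\<bar> \<le> \<theta>0" unfolding \<theta>0_def by (rule Max_ge) auto
    then show ?thesis using th(3) by simp
  qed
  let ?O = "\<Inter>k. {\<phi>. \<bar>?e \<phi> $ k\<bar> < \<theta>}"
  have "open ?O"
    by (intro open_INT finite ballI open_Collect_less continuous_intros
        bounded_linear.continuous_on[OF bounded_linear_edge_angle])
  moreover have "\<phi>0 \<in> ?O" using in0 by simp
  ultimately obtain r where r: "r > 0" "ball \<phi>0 r \<subseteq> ?O" by (meson open_contains_ball)
  have "linear ?e" unfolding edge_angles_matrix by simp
  moreover have "inj ?e"
    by (rule injI) (metis diff eq_iff_diff_eq_0 inj)
  ultimately obtain B where B: "B > 0" "\<And>v. B * norm v \<le> norm (?e v)"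
    by (rule linear_inj_bounded_below_pos) auto
  obtain g where g: "g > 0" "\<And>v::real^'m. g * (norm v)\<^sup>2 \<le> (\<Sum>k\<in>UNIV. \<gamma> $ k * (v $ k)\<^sup>2)"
    using weighted_square_sum_lower[of "\<lambda>k. \<gamma> $ k"] \<gamma> by blast
  define \<kappa> where "\<kappa> = cos \<theta> / 2 * (g * B\<^sup>2)"
  have \<kappa>: "\<kappa> > 0" using c g B by (simp add: \<kappa>_def)
  have low: "\<kappa> * (norm v)\<^sup>2 \<le> (\<Sum>k\<in>UNIV. \<gamma> $ k * (cos \<theta> / 2 * (?e v $ k)\<^sup>2))" for v
  proof -
    have "(B * norm v)\<^sup>2 \<le> (norm (?e v))\<^sup>2" using B by (intro power_mono) auto
    then have "g * (B\<^sup>2 * (norm v)\<^sup>2) \<le> g * (norm (?e v))\<^sup>2"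
      using g(1) by (intro mult_left_mono) (auto simp: power_mult_distrib)
    also have "\<dots> \<le> (\<Sum>k\<in>UNIV. \<gamma> $ k * (?e v $ k)\<^sup>2)" by (rule g(2))
    finally have "cos \<theta> / 2 * (g * (B\<^sup>2 * (norm v)\<^sup>2)) \<le> cos \<theta> / 2 * (\<Sum>k\<in>UNIV. \<gamma> $ k * (?e v $ k)\<^sup>2)"
      using c by (intro mult_left_mono) auto
    then show ?thesis by (simp add: \<kappa>_def sum_distrib_left mult_ac)
  qed
  show thesis
  proof (rule that[OF r(1) \<kappa>])
    fix \<phi> assume "\<phi> \<in> ball \<phi>0 r"
    then have "\<phi> \<in> ?O" using r(2) by blast
    then have b: "\<bar>?e \<phi> $ k\<bar> \<le> \<theta>" "\<bar>?e \<phi>0 $ k\<bar> \<le> \<theta>" for k using in0[of k] by (auto intro: less_imp_le)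
    have "(\<Sum>k\<in>UNIV. \<gamma> $ k * (cos \<theta> / 2 * (?e (\<phi> - \<phi>0) $ k)\<^sup>2)) \<le>
        (\<Sum>k\<in>UNIV. \<gamma> $ k * (cos (?e \<phi>0 $ k) - cos (?e \<phi> $ k) - sin (?e \<phi>0 $ k) * (?e \<phi> $ k - ?e \<phi>0 $ k)))"
      using neg_cos_strongly_convex[OF th(2) b(2) b(1)] \<gamma>
      by (intro sum_mono mult_left_mono) (auto simp: diff less_imp_le)
    also have "\<dots> = potential (diag \<gamma>) D Dt \<phi> - potential (diag \<gamma>) D Dt \<phi>0 - coupling_gradient \<gamma> D Dt \<phi>0 \<bullet> (\<phi> - \<phi>0)"
      unfolding potential_diag inner_coupling_gradient diff
      by (simp add: sum_subtractf sum.distrib algebra_simps)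
    finally show "\<kappa> * (norm (\<phi> - \<phi>0))\<^sup>2 \<le> \<dots>" using low[of "\<phi> - \<phi>0"] by linarith
    have "(\<Sum>k\<in>UNIV. \<gamma> $ k * (cos \<theta> / 2 * (?e (\<phi> - \<phi>0) $ k)\<^sup>2)) \<le>
        (\<Sum>k\<in>UNIV. \<gamma> $ k * ((sin (?e \<phi> $ k) - sin (?e \<phi>0 $ k)) * (?e \<phi> $ k - ?e \<phi>0 $ k)))"
    proof (intro sum_mono mult_left_mono)
      fix k
      have "cos \<theta> / 2 * (?e (\<phi> - \<phi>0) $ k)\<^sup>2 \<le> cos \<theta> * (?e \<phi> $ k - ?e \<phi>0 $ k)\<^sup>2"
        using c by (simp add: diff)
      then show "cos \<theta> / 2 * (?e (\<phi> - \<phi>0) $ k)\<^sup>2 \<le> (sin (?e \<phi> $ k) - sin (?e \<phi>0 $ k)) * (?e \<phi> $ k - ?e \<phi>0 $ k)"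
        using sin_strongly_monotone[OF th(2) b(2)[of k] b(1)[of k]] by linarith
    qed (use \<gamma> in \<open>auto intro: less_imp_le\<close>)
    also have "\<dots> = (coupling_gradient \<gamma> D Dt \<phi> - coupling_gradient \<gamma> D Dt \<phi>0) \<bullet> (\<phi> - \<phi>0)"
      unfolding inner_diff_left inner_coupling_gradient diff
      by (simp add: sum_subtractf sum.distrib algebra_simps)
    finally show "\<kappa> * (norm (\<phi> - \<phi>0))\<^sup>2 \<le> \<dots>" using low[of "\<phi> - \<phi>0"] by linarith
  qed
qed

section \<open>The closed loop and its equilibria\<close>

lemma proj_plus_ge: "a \<le> proj_plus a b"
  by (simp add: proj_plus_def)

lemma abs_proj_plus_le: "\<bar>proj_plus a b\<bar> \<le> \<bar>a\<bar>"
  by (auto simp: proj_plus_def max_def)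

lemma proj_plus_inner_le:
  assumes "0 \<le> b" "0 \<le> c"
  shows "(b - c) * proj_plus a b \<le> (b - c) * a"
proof (cases "b > 0")
  case False
  then have "b = 0" using assms by simp
  then show ?thesis using assms(2) by (simp add: proj_plus_def mult_left_mono)
qed (simp add: proj_plus_def)

lemma diagonal_matrix_vector_nth:
  assumes "is_diagonal N"
  shows "(N *v v) $ i = N $ i $ i * v $ i"
proof -
  have "(\<Sum>j\<in>UNIV. N $ i $ j * v $ j) = (\<Sum>j\<in>UNIV. if j = i then N $ i $ i * v $ i else 0)"
    by (rule sum.cong) (use assms in \<open>auto simp: is_diagonal_def\<close>)
  then show ?thesis by (simp add: matrix_vector_mult_def)
qed

lemma inner_one_vec: "1 \<bullet> (v :: real^'n) = (\<Sum>i\<in>UNIV. v $ i)"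
  by (simp add: inner_vec_def)

abbreviation angle :: "('n::finite, 't::finite) state \<Rightarrow> real^'t" where "angle x \<equiv> fst x"
abbreviation freq :: "('n::finite, 't::finite) state \<Rightarrow> real^'n" where "freq x \<equiv> fst (snd x)"
abbreviation bid :: "('n::finite, 't::finite) state \<Rightarrow> real^'n" where "bid x \<equiv> fst (snd (snd x))"
abbreviation gen :: "('n::finite, 't::finite) state \<Rightarrow> real^'n" where "gen x \<equiv> fst (snd (snd (snd x)))"
abbreviation mul :: "('n::finite, 't::finite) state \<Rightarrow> real" where "mul x \<equiv> snd (snd (snd (snd x)))"

lemma state_space_iff: "x \<in> state_space \<longleftrightarrow> (\<forall>i. 0 \<le> bid x $ i) \<and> (\<forall>i. 0 \<le> gen x $ i)"
  by (auto simp: state_space_def less_eq_vec_def split: prod.splits)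

lemma bounded_linear_state:
  "bounded_linear (\<lambda>x :: ('n::finite, 't::finite) state. freq x $ i)"
  "bounded_linear (\<lambda>x :: ('n, 't) state. bid x $ i)"
  "bounded_linear (\<lambda>x :: ('n, 't) state. gen x $ i)"
  "bounded_linear (mul :: ('n, 't) state \<Rightarrow> real)"
  "bounded_linear (angle :: ('n, 't) state \<Rightarrow> real^'t)"
  by (intro bounded_linear_intros bounded_linear_vec_nth[THEN bounded_linear_compose])+

text \<open>
  What the stability analysis uses of the network and of the costs. The function \<open>gU\<close> is the gradient of
  the potential, \<open>G i\<close> the derivative of the conjugate of the cost of unit \<open>i\<close>, i.e. its optimal output
  as a function of the bid, and \<open>F i\<close> its marginal cost.
\<close>
locale closed_loop =
  fixes \<Gamma> :: "real^'m::finite^'m" and D :: "real^'m^'n::finite" and Dt :: "real^'t::finite^'n"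
    and M A \<tau>b \<tau>g :: "real^'n^'n" and \<rho> \<sigma> \<tau>l :: real
    and C :: "'n \<Rightarrow> real \<Rightarrow> real" and Pd :: "real^'n"
    and gU :: "real^'t \<Rightarrow> real^'t" and G F :: "'n \<Rightarrow> real \<Rightarrow> real" and \<mu> :: "'n \<Rightarrow> real"
  assumes diagonal: "is_diagonal M" "is_diagonal A" "is_diagonal \<tau>b" "is_diagonal \<tau>g"
    and pos: "\<And>i. M $ i $ i > 0" "\<And>i. A $ i $ i > 0" "\<And>i. \<tau>b $ i $ i > 0" "\<And>i. \<tau>g $ i $ i > 0"
      "\<rho> > 0" "\<sigma> > 0" "\<tau>l > 0" "\<And>i. \<mu> i > 0"
    and load: "1 \<bullet> Pd > 0"
    and tree_kernel: "\<And>w. transpose Dt *v w = 0 \<Longrightarrow> \<exists>c. w = c *\<^sub>R 1"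
    and tree_one: "transpose Dt *v 1 = 0"
    and tree_inj: "\<And>z. Dt *v z = 0 \<Longrightarrow> z = 0"
    and U_derivative: "\<And>\<phi>. (potential \<Gamma> D Dt has_derivative (\<lambda>h. gU \<phi> \<bullet> h)) (at \<phi>)"
    and gU_continuous: "continuous_on UNIV gU"
    and U_absolutely_continuous: "\<And>a b \<phi>. absolutely_continuous_on a b \<phi> \<Longrightarrow>
          absolutely_continuous_on a b (\<lambda>t. potential \<Gamma> D Dt (\<phi> t))"
    and U_strongly_convex: "\<And>\<phi>0. angles_secure D Dt \<phi>0 \<Longrightarrow> \<exists>r>0. \<exists>\<kappa>>0. \<forall>\<phi>\<in>ball \<phi>0 r.
          \<kappa> * (norm (\<phi> - \<phi>0))\<^sup>2 \<le> potential \<Gamma> D Dt \<phi> - potential \<Gamma> D Dt \<phi>0 - gU \<phi>0 \<bullet> (\<phi> - \<phi>0) \<and>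
          \<kappa> * (norm (\<phi> - \<phi>0))\<^sup>2 \<le> (gU \<phi> - gU \<phi>0) \<bullet> (\<phi> - \<phi>0)"
    and conj_gradient: "\<And>b. 0 \<le> b \<Longrightarrow> gradient_within (total_conjugate C) {0..} b = (\<chi> i. G i (b $ i))"
    and F_continuous: "\<And>i. continuous_on {0..} (F i)"
    and G_0: "\<And>i. G i 0 = 0"
    and F_G: "\<And>i y. \<lbrakk>y \<ge> 0; G i y > 0\<rbrakk> \<Longrightarrow> F i (G i y) = y"
    and G_cocoercive: "\<And>i y z. \<lbrakk>y \<ge> 0; z \<ge> 0\<rbrakk> \<Longrightarrow> \<mu> i * (G i y - G i z)\<^sup>2 \<le> (y - z) * (G i y - G i z)"
begin

abbreviation U :: "real^'t \<Rightarrow> real" where "U \<equiv> potential \<Gamma> D Dt"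
abbreviation lhs :: "('n, 't) state \<Rightarrow> ('n, 't) state" where "lhs \<equiv> closed_loop_lhs M \<tau>b \<tau>g \<tau>l"
abbreviation rhs :: "('n, 't) state \<Rightarrow> ('n, 't) state" where "rhs \<equiv> closed_loop_rhs \<Gamma> D Dt A C Pd \<rho> \<sigma>"
abbreviation target :: "('n, 't) state set" where "target \<equiv> target_set \<Gamma> D Dt A C Pd \<rho> \<sigma>"
abbreviation trajectory :: "(real \<Rightarrow> ('n, 't) state) \<Rightarrow> bool" where
  "trajectory \<equiv> solution lhs rhs state_space"

text \<open>
  The right-hand sides before the projection, which are continuous on the state space.
\<close>
definition freq_drift :: "'n \<Rightarrow> ('n, 't) state \<Rightarrow> real" where
  "freq_drift i x = - (Dt *v gU (angle x)) $ i - A $ i $ i * freq x $ i + gen x $ i - Pd $ i"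

definition bid_drift :: "'n \<Rightarrow> ('n, 't) state \<Rightarrow> real" where
  "bid_drift i x = gen x $ i - G i (bid x $ i)"

definition gen_drift :: "'n \<Rightarrow> ('n, 't) state \<Rightarrow> real" where
  "gen_drift i x = mul x - bid x $ i + \<rho> * (1 \<bullet> (Pd - gen x)) - \<sigma>\<^sup>2 * freq x $ i"

lemma gradient_U: "gradient_within U UNIV \<phi> = gU \<phi>"
  unfolding gradient_within_def
proof (rule the_equality)
  show "(U has_derivative (\<lambda>h. gU \<phi> \<bullet> h)) (at \<phi>)" by (rule U_derivative)
  fix g assume "(U has_derivative (\<lambda>h. g \<bullet> h)) (at \<phi>)"
  then have "(\<lambda>h. g \<bullet> h) = (\<lambda>h. gU \<phi> \<bullet> h)" by (rule has_derivative_unique[OF _ U_derivative])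
  then show "g = gU \<phi>" by (metis vector_eq_rdot)
qed

text \<open>
  The bid component is left in terms of the gradient, because outside the state space the gradient of
  the conjugate has no better description.
\<close>
lemma rhs_components:
  "angle (rhs x) = transpose Dt *v freq x"
  "freq (rhs x) $ i = freq_drift i x"
  "gen (rhs x) $ i = proj_plus (gen_drift i x) (gen x $ i)"
  "mul (rhs x) = 1 \<bullet> (Pd - gen x)"
  "bid (rhs x) $ i = proj_plus (gen x $ i - gradient_within (total_conjugate C) {0..} (bid x) $ i) (bid x $ i)"
  by (auto simp: closed_loop_rhs_def swing_rhs_def gradient_U freq_drift_def gen_drift_def vec_proj_plus_def
      diagonal_matrix_vector_nth[OF diagonal(2)] split: prod.splits)

lemma rhs_bid:
  assumes "x \<in> state_space"
  shows "bid (rhs x) $ i = proj_plus (bid_drift i x) (bid x $ i)"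
proof -
  have "0 \<le> bid x" using assms by (simp add: state_space_iff less_eq_vec_def)
  then show ?thesis by (simp add: rhs_components conj_gradient bid_drift_def)
qed

lemma lhs_components:
  "angle (lhs x) = angle x"
  "freq (lhs x) $ i = M $ i $ i * freq x $ i"
  "bid (lhs x) $ i = \<tau>b $ i $ i * bid x $ i"
  "gen (lhs x) $ i = \<tau>g $ i $ i * gen x $ i"
  "mul (lhs x) = \<tau>l * mul x"
  by (auto simp: closed_loop_lhs_def diagonal_matrix_vector_nth[OF diagonal(1)]
      diagonal_matrix_vector_nth[OF diagonal(3)] diagonal_matrix_vector_nth[OF diagonal(4)] split: prod.splits)

lemma velocity:
  assumes "lhs x' = rhs x"
  shows "angle x' = transpose Dt *v freq x"
    and "freq x' $ i = freq_drift i x / M $ i $ i"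
    and "gen x' $ i = proj_plus (gen_drift i x) (gen x $ i) / \<tau>g $ i $ i"
    and "mul x' = 1 \<bullet> (Pd - gen x) / \<tau>l"
  using arg_cong[OF assms, of angle] arg_cong[OF assms, of "\<lambda>x. freq x $ i"]
    arg_cong[OF assms, of "\<lambda>x. gen x $ i"] arg_cong[OF assms, of mul]
    pos(1)[of i] pos(4)[of i] pos(7)
  by (simp_all add: lhs_components rhs_components nonzero_eq_divide_eq mult.commute less_imp_neq[symmetric])

lemma velocity_bid:
  assumes "lhs x' = rhs x" "x \<in> state_space"
  shows "bid x' $ i = proj_plus (bid_drift i x) (bid x $ i) / \<tau>b $ i $ i"
  using arg_cong[OF assms(1), of "\<lambda>x. bid x $ i"] pos(3)[of i] rhs_bid[OF assms(2), of i]
  by (simp add: lhs_components nonzero_eq_divide_eq mult.commute less_imp_neq[symmetric])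

lemma inner_Dt: "w \<bullet> (Dt *v z) = (transpose Dt *v w) \<bullet> z"
  by (rule inner_matrix_vector)

lemma target_secure: "x0 \<in> target \<Longrightarrow> angles_secure D Dt (angle x0)"
  and target_state: "x0 \<in> target \<Longrightarrow> x0 \<in> state_space"
  by (auto simp: target_set_def)

lemma target_balance: "x0 \<in> target \<Longrightarrow> 1 \<bullet> gen x0 = 1 \<bullet> Pd"
  using rhs_components(4)[of x0] by (simp add: target_set_def inner_diff_right)

text \<open>
  Summing the swing equations over all nodes cancels the line flows, and since generation covers the
  load only the damping of the common frequency remains.
\<close>
lemma target_freq:
  assumes x0: "x0 \<in> target"
  shows "freq x0 = 0"
proof -
  have r: "rhs x0 = 0" using x0 by (simp add: target_set_def)
  then have "transpose Dt *v freq x0 = 0" using rhs_components(1)[of x0] by simp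
  then obtain c where c: "freq x0 = c *\<^sub>R 1" using tree_kernel by blast
  have "(\<Sum>i\<in>UNIV. freq_drift i x0) = 0" using r rhs_components(2)[of x0] by simp
  moreover have "(\<Sum>i\<in>UNIV. freq_drift i x0) = - (1 \<bullet> (Dt *v gU (angle x0))) - c * (\<Sum>i\<in>UNIV. A $ i $ i)
      + (1 \<bullet> gen x0 - 1 \<bullet> Pd)"
    unfolding freq_drift_def c inner_one_vec
    by (simp add: sum.distrib sum_subtractf sum_negf sum_distrib_left mult.commute)
  moreover have "1 \<bullet> (Dt *v gU (angle x0)) = 0" by (simp add: inner_Dt tree_one)
  ultimately have "c * (\<Sum>i\<in>UNIV. A $ i $ i) = 0" using target_balance[OF x0] by simp
  moreover have "(\<Sum>i\<in>UNIV. A $ i $ i) > 0" using pos(2) by (intro sum_pos) auto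
  ultimately show ?thesis using c by simp
qed

lemma target_flow:
  assumes x0: "x0 \<in> target"
  shows "Pd $ i = gen x0 $ i - (Dt *v gU (angle x0)) $ i"
  using rhs_components(2)[of x0 i] x0 target_freq[OF x0] by (simp add: target_set_def freq_drift_def)

text \<open>
  Where the bid is zero, the projection only yields that the output is at most \<open>G i 0 = 0\<close>; then it is
  zero because it is nonnegative.
\<close>
lemma target_gen:
  assumes x0: "x0 \<in> target"
  shows "gen x0 $ i = G i (bid x0 $ i)"
proof -
  have S: "x0 \<in> state_space" "0 \<le> bid x0 $ i" "0 \<le> gen x0 $ i" and r: "rhs x0 = 0"
    using x0 by (auto simp: target_set_def state_space_iff)
  have "proj_plus (bid_drift i x0) (bid x0 $ i) = 0" using rhs_bid[OF S(1), of i] r by simp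
  then show ?thesis using S G_0[of i] by (auto simp: proj_plus_def bid_drift_def max_def split: if_splits)
qed

lemma target_mul:
  assumes x0: "x0 \<in> target"
  shows "mul x0 \<le> bid x0 $ i" "gen x0 $ i > 0 \<Longrightarrow> bid x0 $ i = mul x0"
proof -
  have r: "rhs x0 = 0" using x0 by (simp add: target_set_def)
  have "proj_plus (gen_drift i x0) (gen x0 $ i) = 0" using rhs_components(3)[of x0 i] r by simp
  moreover have "gen_drift i x0 = mul x0 - bid x0 $ i"
    using target_balance[OF x0] target_freq[OF x0] by (simp add: gen_drift_def inner_diff_right)
  ultimately show "mul x0 \<le> bid x0 $ i" "gen x0 $ i > 0 \<Longrightarrow> bid x0 $ i = mul x0"
    by (auto simp: proj_plus_def max_def split: if_splits)
qed

text \<open>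
  The complementary slackness condition of the dispatch problem: \<open>mul x0\<close> is the price, and
  \<open>bid x0 $ i - mul x0\<close> is the multiplier of the constraint \<open>0 \<le> Pg $ i\<close>.
\<close>
lemma target_slack:
  assumes "x0 \<in> target" "0 \<le> p"
  shows "(p - gen x0 $ i) * (mul x0 - bid x0 $ i) \<le> 0"
proof (cases "gen x0 $ i > 0")
  case False
  then have "gen x0 $ i = 0" using target_state[OF assms(1)] by (simp add: state_space_iff order.antisym not_less)
  then show ?thesis using assms target_mul(1)[OF assms(1), of i] by (simp add: mult_nonneg_nonpos)
qed (simp add: target_mul(2)[OF assms(1)])

lemma targetI:
  assumes "x0 \<in> target" "angle y = angle x0" "freq y = 0" "gen y = gen x0" "mul y = mul x0" "y \<in> state_space"
    and "\<And>i. G i (bid y $ i) = gen x0 $ i"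
    and "\<And>i. gen x0 $ i > 0 \<Longrightarrow> bid y $ i = mul x0" "\<And>i. mul x0 \<le> bid y $ i"
  shows "y \<in> target"
proof -
  have "angle (rhs y) = 0" using assms(3) by (simp add: rhs_components)
  moreover have "freq (rhs y) = 0"
    unfolding vec_eq_iff
  proof
    fix i show "freq (rhs y) $ i = 0 $ i"
      unfolding rhs_components freq_drift_def assms(2-4) target_flow[OF assms(1), of i] by simp
  qed
  moreover have "bid (rhs y) = 0"
    using assms(4,7) by (simp add: vec_eq_iff rhs_bid[OF assms(6)] bid_drift_def proj_plus_def)
  moreover have "gen (rhs y) = 0"
    unfolding vec_eq_iff
  proof
    fix i
    have "gen_drift i y = mul x0 - bid y $ i"
      using assms(3-5) target_balance[OF assms(1)] by (simp add: gen_drift_def inner_diff_right)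
    then show "gen (rhs y) $ i = 0 $ i"
      using assms(4) assms(8)[of i] assms(9)[of i] by (simp add: rhs_components proj_plus_def)
  qed
  moreover have "mul (rhs y) = 0"
    using assms(4) target_balance[OF assms(1)] by (simp add: rhs_components inner_diff_right)
  ultimately have "rhs y = 0" by (simp add: prod_eq_iff)
  then show ?thesis using assms(2,6) target_secure[OF assms(1)] by (simp add: target_set_def)
qed

text \<open>
  The first summand is the Bregman distance of the potential. The factor \<open>\<sigma>\<^sup>2\<close> of the network energy
  matches the frequency feedback of the generators.
\<close>
definition lyapunov :: "('n, 't) state \<Rightarrow> ('n, 't) state \<Rightarrow> real" where
  "lyapunov x0 x = \<sigma>\<^sup>2 * (U (angle x) - U (angle x0) - gU (angle x0) \<bullet> (angle x - angle x0))
     + \<sigma>\<^sup>2 / 2 * (\<Sum>i\<in>UNIV. M $ i $ i * (freq x $ i)\<^sup>2)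
     + 1 / 2 * (\<Sum>i\<in>UNIV. \<tau>b $ i $ i * (bid x $ i - bid x0 $ i)\<^sup>2)
     + 1 / 2 * (\<Sum>i\<in>UNIV. \<tau>g $ i $ i * (gen x $ i - gen x0 $ i)\<^sup>2)
     + \<tau>l / 2 * (mul x - mul x0)\<^sup>2"

definition lyapunov_rate :: "('n, 't) state \<Rightarrow> ('n, 't) state \<Rightarrow> ('n, 't) state \<Rightarrow> real" where
  "lyapunov_rate x0 x x' = \<sigma>\<^sup>2 * ((gU (angle x) - gU (angle x0)) \<bullet> angle x')
     + \<sigma>\<^sup>2 * (\<Sum>i\<in>UNIV. M $ i $ i * (freq x $ i * freq x' $ i))
     + (\<Sum>i\<in>UNIV. \<tau>b $ i $ i * ((bid x $ i - bid x0 $ i) * bid x' $ i))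
     + (\<Sum>i\<in>UNIV. \<tau>g $ i $ i * ((gen x $ i - gen x0 $ i) * gen x' $ i))
     + \<tau>l * ((mul x - mul x0) * mul x')"

lemma lyapunov_has_derivative: "(lyapunov x0 has_derivative lyapunov_rate x0 x) (at x)"
proof -
  have sq: "((\<lambda>x. (l x - c)\<^sup>2) has_derivative (\<lambda>h. 2 * ((l x - c) * l h))) (at x)"
    if "bounded_linear l" for l :: "('n, 't) state \<Rightarrow> real" and c
    using bounded_linear_imp_has_derivative[OF that, of "at x"]
    by (auto intro!: derivative_eq_intros)
  have U: "((\<lambda>x. U (angle x)) has_derivative (\<lambda>h. gU (angle x) \<bullet> angle h)) (at x)"
    by (rule has_derivative_compose[OF has_derivative_fst[OF has_derivative_ident] U_derivative])
  have "((\<lambda>x. \<sigma>\<^sup>2 * (U (angle x) - U (angle x0) - gU (angle x0) \<bullet> (angle x - angle x0))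
     + \<sigma>\<^sup>2 / 2 * (\<Sum>i\<in>UNIV. M $ i $ i * (freq x $ i - 0)\<^sup>2)
     + 1 / 2 * (\<Sum>i\<in>UNIV. \<tau>b $ i $ i * (bid x $ i - bid x0 $ i)\<^sup>2)
     + 1 / 2 * (\<Sum>i\<in>UNIV. \<tau>g $ i $ i * (gen x $ i - gen x0 $ i)\<^sup>2)
     + \<tau>l / 2 * (mul x - mul x0)\<^sup>2) has_derivative
    (\<lambda>x'. \<sigma>\<^sup>2 * (gU (angle x) \<bullet> angle x' - 0 - gU (angle x0) \<bullet> (angle x' - 0))
     + \<sigma>\<^sup>2 / 2 * (\<Sum>i\<in>UNIV. M $ i $ i * (2 * ((freq x $ i - 0) * freq x' $ i)))
     + 1 / 2 * (\<Sum>i\<in>UNIV. \<tau>b $ i $ i * (2 * ((bid x $ i - bid x0 $ i) * bid x' $ i)))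
     + 1 / 2 * (\<Sum>i\<in>UNIV. \<tau>g $ i $ i * (2 * ((gen x $ i - gen x0 $ i) * gen x' $ i)))
     + \<tau>l / 2 * (2 * ((mul x - mul x0) * mul x')))) (at x)"
    by (intro has_derivative_add has_derivative_mult_right has_derivative_diff has_derivative_sum
        U has_derivative_const has_derivative_inner_right has_derivative_fst has_derivative_ident
        sq bounded_linear_state)
  then show ?thesis
    by (simp add: lyapunov_def[abs_def] lyapunov_rate_def[abs_def] inner_diff_left sum_distrib_left mult.left_commute)
qed

end

section \<open>Dissipation and stability\<close>

context closed_loop
begin

lemma lyapunov_target: "lyapunov x0 x0 = (\<sigma>\<^sup>2 / 2) * (\<Sum>i\<in>UNIV. M $ i $ i * (freq x0 $ i)\<^sup>2)"
  by (simp add: lyapunov_def)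

text \<open>
  Everything is local to a node except for the imbalance \<open>q\<close>, which is itself a sum over the nodes. At
  a single node the terms in the line flows and in \<open>\<sigma>\<^sup>2 \<omega> (Pg - Pg0)\<close> cancel exactly, and there remain
  the damping, the product \<open>- (b - b0) (G b - G b0)\<close>, which cocoercivity turns into a square, and the
  complementary slackness term, which is not positive.
\<close>
lemma dissipation:
  assumes x: "x \<in> state_space" and x0: "x0 \<in> target" and x': "lhs x' = rhs x"
  shows "lyapunov_rate x0 x x' \<le> - (\<sigma>\<^sup>2 * (\<Sum>i\<in>UNIV. A $ i $ i * (freq x $ i)\<^sup>2)
     + \<rho> * (1 \<bullet> (gen x - gen x0))\<^sup>2 + (\<Sum>i\<in>UNIV. \<mu> i * (G i (bid x $ i) - gen x0 $ i)\<^sup>2))"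
proof -
  define q where "q = 1 \<bullet> (gen x - gen x0)"
  have s: "1 \<bullet> (Pd - gen x) = - q"
    using target_balance[OF x0] by (simp add: q_def inner_diff_right)
  have nn: "0 \<le> bid x $ i" "0 \<le> gen x $ i" "0 \<le> bid x0 $ i" "0 \<le> gen x0 $ i" for i
    using x target_state[OF x0] by (auto simp: state_space_iff)
  have angle_part: "(gU (angle x) - gU (angle x0)) \<bullet> angle x'
      = (\<Sum>i\<in>UNIV. freq x $ i * ((Dt *v gU (angle x)) $ i - (Dt *v gU (angle x0)) $ i))"
  proof -
    have "(gU (angle x) - gU (angle x0)) \<bullet> angle x' = freq x \<bullet> (Dt *v (gU (angle x) - gU (angle x0)))"
      by (simp only: inner_Dt velocity(1)[OF x'] inner_commute)
    then show ?thesis by (simp add: matrix_vector_mult_diff_distrib inner_vec_def)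
  qed
  have freq_part: "M $ i $ i * (freq x $ i * freq x' $ i) = freq x $ i * freq_drift i x" for i
    using pos(1)[of i] by (simp add: velocity(2)[OF x'])
  have bid_part: "\<tau>b $ i $ i * ((bid x $ i - bid x0 $ i) * bid x' $ i) \<le> (bid x $ i - bid x0 $ i) * bid_drift i x" for i
    using pos(3)[of i] proj_plus_inner_le[OF nn(1,3)[of i], of "bid_drift i x"]
    by (simp add: velocity_bid[OF x' x])
  have gen_part: "\<tau>g $ i $ i * ((gen x $ i - gen x0 $ i) * gen x' $ i) \<le> (gen x $ i - gen x0 $ i) * gen_drift i x" for i
    using pos(4)[of i] proj_plus_inner_le[OF nn(2,4)[of i], of "gen_drift i x"]
    by (simp add: velocity(3)[OF x'])
  have mul_part: "\<tau>l * ((mul x - mul x0) * mul x') = - ((mul x - mul x0) * q)"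
    using pos(7) by (simp add: velocity(4)[OF x'] s)
  have q_sum: "c * q = (\<Sum>i\<in>UNIV. c * (gen x $ i - gen x0 $ i))" for c
    by (simp add: q_def inner_vec_def sum_distrib_left)
  have local: "\<sigma>\<^sup>2 * (freq x $ i * ((Dt *v gU (angle x)) $ i - (Dt *v gU (angle x0)) $ i)) + \<sigma>\<^sup>2 * (freq x $ i * freq_drift i x)
       + (bid x $ i - bid x0 $ i) * bid_drift i x + (gen x $ i - gen x0 $ i) * gen_drift i x
       - (mul x - mul x0) * (gen x $ i - gen x0 $ i)
     \<le> - (\<sigma>\<^sup>2 * (A $ i $ i * (freq x $ i)\<^sup>2)) - \<rho> * q * (gen x $ i - gen x0 $ i) - \<mu> i * (G i (bid x $ i) - gen x0 $ i)\<^sup>2" for i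
  proof -
    define w b b0 p p0 g where "w = freq x $ i" "b = bid x $ i" "b0 = bid x0 $ i" "p = gen x $ i" "p0 = gen x0 $ i" "g = G i b"
    note d = this
    define f f0 where "f = (Dt *v gU (angle x)) $ i" "f0 = (Dt *v gU (angle x0)) $ i"
    have fd: "freq_drift i x = - f - A $ i $ i * w + p - (p0 - f0)"
      unfolding freq_drift_def target_flow[OF x0, of i] d f_f0_def by simp
    have bd: "bid_drift i x = p - g" by (simp add: bid_drift_def d)
    have gd: "gen_drift i x = mul x - b - \<rho> * q - \<sigma>\<^sup>2 * w" by (simp add: gen_drift_def s d)
    have "\<mu> i * (g - p0)\<^sup>2 \<le> (b - b0) * (g - p0)"
      using G_cocoercive[OF nn(1) nn(3), of i i i] target_gen[OF x0, of i] by (simp add: d)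
    moreover have "(p - p0) * (mul x0 - b0) \<le> 0"
      using target_slack[OF x0 nn(2)] by (simp add: d)
    moreover have "\<sigma>\<^sup>2 * (w * (f - f0)) + \<sigma>\<^sup>2 * (w * (- f - A $ i $ i * w + p - (p0 - f0)))
       + (b - b0) * (p - g) + (p - p0) * (mul x - b - \<rho> * q - \<sigma>\<^sup>2 * w) - (mul x - mul x0) * (p - p0)
      = - (\<sigma>\<^sup>2 * (A $ i $ i * w\<^sup>2)) - \<rho> * q * (p - p0) - (b - b0) * (g - p0) + (p - p0) * (mul x0 - b0)"
      by (simp add: power2_eq_square algebra_simps)
    ultimately show ?thesis unfolding fd bd gd d[symmetric] f_f0_def[symmetric] by linarith
  qed
  have bids: "(\<Sum>i\<in>UNIV. \<tau>b $ i $ i * ((bid x $ i - bid x0 $ i) * bid x' $ i)) \<le> (\<Sum>i\<in>UNIV. (bid x $ i - bid x0 $ i) * bid_drift i x)"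
    by (rule sum_mono) (rule bid_part)
  have gens: "(\<Sum>i\<in>UNIV. \<tau>g $ i $ i * ((gen x $ i - gen x0 $ i) * gen x' $ i)) \<le> (\<Sum>i\<in>UNIV. (gen x $ i - gen x0 $ i) * gen_drift i x)"
    by (rule sum_mono) (rule gen_part)
  have "lyapunov_rate x0 x x' \<le> \<sigma>\<^sup>2 * (\<Sum>i\<in>UNIV. freq x $ i * ((Dt *v gU (angle x)) $ i - (Dt *v gU (angle x0)) $ i))
     + \<sigma>\<^sup>2 * (\<Sum>i\<in>UNIV. freq x $ i * freq_drift i x) + (\<Sum>i\<in>UNIV. (bid x $ i - bid x0 $ i) * bid_drift i x)
     + (\<Sum>i\<in>UNIV. (gen x $ i - gen x0 $ i) * gen_drift i x) - (mul x - mul x0) * q"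
    unfolding lyapunov_rate_def angle_part freq_part mul_part
    using bids gens by linarith
  also have "\<dots> = (\<Sum>i\<in>UNIV. \<sigma>\<^sup>2 * (freq x $ i * ((Dt *v gU (angle x)) $ i - (Dt *v gU (angle x0)) $ i)) + \<sigma>\<^sup>2 * (freq x $ i * freq_drift i x)
       + (bid x $ i - bid x0 $ i) * bid_drift i x + (gen x $ i - gen x0 $ i) * gen_drift i x
       - (mul x - mul x0) * (gen x $ i - gen x0 $ i))"
    by (simp only: q_sum sum.distrib sum_subtractf sum_distrib_left)
  also have "\<dots> \<le> (\<Sum>i\<in>UNIV. - (\<sigma>\<^sup>2 * (A $ i $ i * (freq x $ i)\<^sup>2)) - \<rho> * q * (gen x $ i - gen x0 $ i) - \<mu> i * (G i (bid x $ i) - gen x0 $ i)\<^sup>2)"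
    by (rule sum_mono) (rule local)
  also have "\<dots> = - (\<sigma>\<^sup>2 * (\<Sum>i\<in>UNIV. A $ i $ i * (freq x $ i)\<^sup>2)) - \<rho> * q * q - (\<Sum>i\<in>UNIV. \<mu> i * (G i (bid x $ i) - gen x0 $ i)\<^sup>2)"
    by (simp only: q_sum sum_subtractf sum_negf sum_distrib_left)
  finally show ?thesis by (simp add: q_def power2_eq_square mult.assoc)
qed

lemma lyapunov_chain:
  assumes "(x has_vector_derivative x') (at t within S)"
  shows "((\<lambda>t. lyapunov x0 (x t)) has_vector_derivative lyapunov_rate x0 (x t) x') (at t within S)"
proof -
  have "((\<lambda>t. lyapunov x0 (x t)) has_derivative (\<lambda>h. lyapunov_rate x0 (x t) (h *\<^sub>R x'))) (at t within S)"
    by (rule has_derivative_compose[OF assms[unfolded has_vector_derivative_def] lyapunov_has_derivative])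
  moreover have "lyapunov_rate x0 (x t) (h *\<^sub>R x') = h *\<^sub>R lyapunov_rate x0 (x t) x'" for h
    by (rule linear_scale[OF has_derivative_linear[OF lyapunov_has_derivative]])
  ultimately show ?thesis by (simp add: has_vector_derivative_def)
qed

lemma lyapunov_absolutely_continuous:
  assumes ac: "absolutely_continuous_on a b x"
  shows "absolutely_continuous_on a b (\<lambda>t. lyapunov x0 (x t))"
proof -
  note lin = absolutely_continuous_on_bounded_linear[OF ac]
  have sq: "absolutely_continuous_on a b (\<lambda>t. k * (f (x t) + c)\<^sup>2)" if "bounded_linear f" for f :: "('n, 't) state \<Rightarrow> real" and c k
    by (intro absolutely_continuous_on_bounded_linear[OF _ bounded_linear_mult_right]
        absolutely_continuous_on_power2 absolutely_continuous_on_add absolutely_continuous_on_const lin that)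
  have "absolutely_continuous_on a b (\<lambda>t. \<sigma>\<^sup>2 * (U (angle (x t)) + (- gU (angle x0)) \<bullet> angle (x t) + (gU (angle x0) \<bullet> angle x0 - U (angle x0)))
     + \<sigma>\<^sup>2 / 2 * (\<Sum>i\<in>UNIV. M $ i $ i * (freq (x t) $ i + 0)\<^sup>2)
     + 1 / 2 * (\<Sum>i\<in>UNIV. \<tau>b $ i $ i * (bid (x t) $ i + - bid x0 $ i)\<^sup>2)
     + 1 / 2 * (\<Sum>i\<in>UNIV. \<tau>g $ i $ i * (gen (x t) $ i + - gen x0 $ i)\<^sup>2)
     + \<tau>l / 2 * (mul (x t) + - mul x0)\<^sup>2)"
    by (intro absolutely_continuous_on_add absolutely_continuous_on_sum sq bounded_linear_state finite
        absolutely_continuous_on_const U_absolutely_continuous lin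
        absolutely_continuous_on_bounded_linear[OF _ bounded_linear_mult_right[of "_ :: real"]]
        absolutely_continuous_on_bounded_linear[OF _ bounded_linear_inner_right])
  then show ?thesis by (simp add: lyapunov_def inner_diff_right algebra_simps)
qed

text \<open>
  The orthants are invariant because the projection makes the derivative of a negative bid or output
  nonnegative.
\<close>
lemma trajectory_facts:
  assumes "trajectory x"
  obtains N where "negligible N" "\<And>T. T \<ge> 0 \<Longrightarrow> absolutely_continuous_on 0 T x"
    "\<And>t. \<lbrakk>t \<ge> 0; t \<notin> N\<rbrakk> \<Longrightarrow> \<exists>x'. (x has_vector_derivative x') (at t within {0..}) \<and> lhs x' = rhs (x t)"
    "\<And>t. t \<ge> 0 \<Longrightarrow> x t \<in> state_space"
proof -
  have x0: "x 0 \<in> state_space" and ac: "\<And>T. T \<ge> 0 \<Longrightarrow> absolutely_continuous_on 0 T x"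
    and ae: "AE t in lebesgue. 0 \<le> t \<longrightarrow> (\<exists>x'. (x has_vector_derivative x') (at t within {0..}) \<and> lhs x' = rhs (x t))"
    using assms by (auto simp: solution_def)
  obtain N where null: "N \<in> null_sets lebesgue"
    and sub: "{t \<in> space lebesgue. \<not> (0 \<le> t \<longrightarrow> (\<exists>x'. (x has_vector_derivative x') (at t within {0..}) \<and> lhs x' = rhs (x t)))} \<subseteq> N"
    using ae unfolding eventually_ae_filter by blast
  have N: "negligible N" using null by (simp add: negligible_iff_null_sets)
  have der: "\<exists>x'. (x has_vector_derivative x') (at t within {0..}) \<and> lhs x' = rhs (x t)" if "t \<ge> 0" "t \<notin> N" for t
    using sub that by auto
  have component: "f (x t) \<ge> 0"
    if f: "bounded_linear f" and inward: "\<And>x x'. \<lbrakk>lhs x' = rhs x; f x < 0\<rbrakk> \<Longrightarrow> f x' \<ge> 0" and "f (x 0) \<ge> 0" "t \<ge> 0"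
    for f :: "('n, 't) state \<Rightarrow> real" and t
  proof (rule halfline_nonneg_invariant[where y = "\<lambda>t. f (x t)", OF _ N])
    show "absolutely_continuous_on 0 T (\<lambda>t. f (x t))" if "T \<ge> 0" for T
      by (rule absolutely_continuous_on_bounded_linear[OF ac[OF that] f])
    fix u assume u: "u \<ge> 0" "u \<notin> N" "f (x u) < 0"
    then obtain x' where "(x has_vector_derivative x') (at u within {0..})" "lhs x' = rhs (x u)" using der by blast
    then have "((\<lambda>t. f (x t)) has_vector_derivative f x') (at u within {0..})" "f x' \<ge> 0"
      using bounded_linear.has_vector_derivative[OF f] inward u(3) by blast+
    then show "\<exists>D\<ge>0. ((\<lambda>t. f (x t)) has_vector_derivative D) (at u within {0..})" by blast
  qed (use that in auto)
  have "0 \<le> bid (x t) $ i" if "t \<ge> 0" for t i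
  proof (rule component[of "\<lambda>x. bid x $ i"])
    show "bounded_linear (\<lambda>x. bid x $ i)" by (rule bounded_linear_state)
    fix z z' assume z: "lhs z' = rhs z" "bid z $ i < 0"
    have "\<tau>b $ i $ i * bid z' $ i \<ge> 0"
      using arg_cong[OF z(1), of "\<lambda>x. bid x $ i"] z(2) by (simp add: lhs_components rhs_components proj_plus_def)
    then show "bid z' $ i \<ge> 0" using pos(3)[of i] by (simp add: zero_le_mult_iff)
  qed (use x0 that in \<open>auto simp: state_space_iff\<close>)
  moreover have "0 \<le> gen (x t) $ i" if "t \<ge> 0" for t i
  proof (rule component[of "\<lambda>x. gen x $ i"])
    show "bounded_linear (\<lambda>x. gen x $ i)" by (rule bounded_linear_state)
    fix z z' assume z: "lhs z' = rhs z" "gen z $ i < 0"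
    then show "gen z' $ i \<ge> 0"
      using pos(4)[of i] velocity(3)[OF z(1), of i] by (simp add: proj_plus_def)
  qed (use x0 that in \<open>auto simp: state_space_iff\<close>)
  ultimately show thesis using that N ac der by (simp add: state_space_iff)
qed

lemma lyapunov_decreasing:
  assumes x: "trajectory x" and x0: "x0 \<in> target" and st: "0 \<le> s" "s \<le> t"
  shows "lyapunov x0 (x t) \<le> lyapunov x0 (x s)"
proof -
  obtain N where N: "negligible N" and ac: "\<And>T. T \<ge> 0 \<Longrightarrow> absolutely_continuous_on 0 T x"
    and der: "\<And>t. \<lbrakk>t \<ge> 0; t \<notin> N\<rbrakk> \<Longrightarrow> \<exists>x'. (x has_vector_derivative x') (at t within {0..}) \<and> lhs x' = rhs (x t)"
    and S: "\<And>t. t \<ge> 0 \<Longrightarrow> x t \<in> state_space"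
    by (rule trajectory_facts[OF x]) auto
  have "0 * (t - s) \<le> - lyapunov x0 (x t) - - lyapunov x0 (x s)"
  proof (rule halfline_growth[OF _ N st])
    show "absolutely_continuous_on 0 T (\<lambda>t. - lyapunov x0 (x t))" if "T \<ge> 0" for T
      by (intro absolutely_continuous_on_bounded_linear[OF lyapunov_absolutely_continuous[OF ac[OF that]]]
          bounded_linear_minus bounded_linear_ident)
    fix u assume u: "s \<le> u" "u \<notin> N"
    then obtain x' where x': "(x has_vector_derivative x') (at u within {0..})" "lhs x' = rhs (x u)"
      using der[of u] st by auto
    have "((\<lambda>t. - lyapunov x0 (x t)) has_vector_derivative - lyapunov_rate x0 (x u) x') (at u within {0..})"
      by (rule has_vector_derivative_minus[OF lyapunov_chain[OF x'(1)]])
    moreover have "0 \<le> - lyapunov_rate x0 (x u) x'"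
    proof -
      have "0 \<le> \<sigma>\<^sup>2 * (\<Sum>i\<in>UNIV. A $ i $ i * (freq (x u) $ i)\<^sup>2)
         + \<rho> * (1 \<bullet> (gen (x u) - gen x0))\<^sup>2 + (\<Sum>i\<in>UNIV. \<mu> i * (G i (bid (x u) $ i) - gen x0 $ i)\<^sup>2)"
        using pos by (intro add_nonneg_nonneg mult_nonneg_nonneg sum_nonneg) (auto intro: less_imp_le)
      then show ?thesis using dissipation[OF S x0 x'(2)] u st by force
    qed
    ultimately show "\<exists>D\<ge>0. ((\<lambda>t. - lyapunov x0 (x t)) has_vector_derivative D) (at u within {0..})" by blast
  qed
  then show ?thesis by simp
qed

lemma lyapunov_lower:
  assumes x0: "x0 \<in> target"
  obtains r k where "r > 0" "k > 0"
    "\<And>x. angle x \<in> ball (angle x0) r \<Longrightarrow> k * (norm (x - x0))\<^sup>2 \<le> lyapunov x0 x"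
proof -
  obtain r \<kappa> where r: "r > 0" "\<kappa> > 0"
    "\<And>\<phi>. \<phi> \<in> ball (angle x0) r \<Longrightarrow> \<kappa> * (norm (\<phi> - angle x0))\<^sup>2 \<le> U \<phi> - U (angle x0) - gU (angle x0) \<bullet> (\<phi> - angle x0)"
    using U_strongly_convex[OF target_secure[OF x0]] by blast
  obtain km where km: "km > 0" "\<And>v::real^'n. km * (norm v)\<^sup>2 \<le> (\<Sum>i\<in>UNIV. M $ i $ i * (v $ i)\<^sup>2)"
    using weighted_square_sum_lower[of "\<lambda>i. M $ i $ i"] pos(1) by blast
  obtain kb where kb: "kb > 0" "\<And>v::real^'n. kb * (norm v)\<^sup>2 \<le> (\<Sum>i\<in>UNIV. \<tau>b $ i $ i * (v $ i)\<^sup>2)"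
    using weighted_square_sum_lower[of "\<lambda>i. \<tau>b $ i $ i"] pos(3) by blast
  obtain kg where kg: "kg > 0" "\<And>v::real^'n. kg * (norm v)\<^sup>2 \<le> (\<Sum>i\<in>UNIV. \<tau>g $ i $ i * (v $ i)\<^sup>2)"
    using weighted_square_sum_lower[of "\<lambda>i. \<tau>g $ i $ i"] pos(4) by blast
  \<comment> \<open>the smallest of the five quadratic growth rates\<close>
  define k where "k = Min {\<sigma>\<^sup>2 * \<kappa>, \<sigma>\<^sup>2 / 2 * km, 1 / 2 * kb, 1 / 2 * kg, \<tau>l / 2}"
  have k: "k > 0" "k \<le> \<sigma>\<^sup>2 * \<kappa>" "k \<le> \<sigma>\<^sup>2 / 2 * km" "k \<le> 1 / 2 * kb" "k \<le> 1 / 2 * kg" "k \<le> \<tau>l / 2"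
    using r(2) km(1) kb(1) kg(1) pos(6,7) by (auto simp: k_def)
  show thesis
  proof (rule that[OF r(1) k(1)])
    fix x :: "('n, 't) state" assume ball: "angle x \<in> ball (angle x0) r"
    have "(norm (x - x0))\<^sup>2 = (norm (angle x - angle x0))\<^sup>2 + ((norm (freq x))\<^sup>2 + ((norm (bid x - bid x0))\<^sup>2
       + ((norm (gen x - gen x0))\<^sup>2 + (mul x - mul x0)\<^sup>2)))"
      using target_freq[OF x0] by (simp add: norm_prod_def)
    then have "k * (norm (x - x0))\<^sup>2 = k * (norm (angle x - angle x0))\<^sup>2 + k * (norm (freq x))\<^sup>2 + k * (norm (bid x - bid x0))\<^sup>2
       + k * (norm (gen x - gen x0))\<^sup>2 + k * (mul x - mul x0)\<^sup>2"
      by (simp add: distrib_left)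
    also have "\<dots> \<le> \<sigma>\<^sup>2 * \<kappa> * (norm (angle x - angle x0))\<^sup>2 + \<sigma>\<^sup>2 / 2 * km * (norm (freq x))\<^sup>2
       + 1 / 2 * kb * (norm (bid x - bid x0))\<^sup>2 + 1 / 2 * kg * (norm (gen x - gen x0))\<^sup>2 + \<tau>l / 2 * (mul x - mul x0)\<^sup>2"
      using k by (intro add_mono mult_right_mono) auto
    also have "\<dots> \<le> lyapunov x0 x"
      unfolding lyapunov_def mult.assoc
      using r(3)[OF ball] km(2)[of "freq x"] kb(2)[of "bid x - bid x0"] kg(2)[of "gen x - gen x0"] pos(7)
      by (intro add_mono mult_left_mono) auto
    finally show "k * (norm (x - x0))\<^sup>2 \<le> lyapunov x0 x" .
  qed
qed

text \<open>
  Only the quadratic lower bound of the Lyapunov function is local, its decrease is not. So a trajectory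
  that starts below the level \<open>k e'\<^sup>2\<close> cannot cross the sphere of radius \<open>e'\<close>. The starting time is
  arbitrary, so that the lemma also applies to the tail of a trajectory, near one of its limit points.
\<close>
lemma stability:
  assumes x0: "x0 \<in> target" and "e > 0"
  obtains d where "d > 0"
    "\<And>x s t. \<lbrakk>trajectory x; 0 \<le> s; s \<le> t; x s \<in> ball x0 d\<rbrakk> \<Longrightarrow> x t \<in> ball x0 e"
proof -
  obtain r k where r: "r > 0" "k > 0"
    "\<And>x. angle x \<in> ball (angle x0) r \<Longrightarrow> k * (norm (x - x0))\<^sup>2 \<le> lyapunov x0 x"
    using lyapunov_lower[OF x0] by blast
  define e' where "e' = min e (r / 2)"
  have e': "e' > 0" "e' \<le> e" "e' < r" using r(1) \<open>e > 0\<close> by (auto simp: e'_def)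
  have "isCont (lyapunov x0) x0" by (rule has_derivative_continuous[OF lyapunov_has_derivative])
  then have "\<forall>\<^sub>F x in at x0. lyapunov x0 x < k * e'\<^sup>2"
    by (intro order_tendstoD(2)[of _ "lyapunov x0 x0"])
       (use r(2) e'(1) in \<open>auto simp: isCont_def lyapunov_target target_freq[OF x0]\<close>)
  moreover have zero: "lyapunov x0 x0 < k * e'\<^sup>2"
    using r(2) e'(1) by (simp add: lyapunov_target target_freq[OF x0])
  ultimately obtain d0 where d0: "d0 > 0" "\<And>x. dist x x0 < d0 \<Longrightarrow> lyapunov x0 x < k * e'\<^sup>2"
  proof -
    assume ev: "\<forall>\<^sub>F x in at x0. lyapunov x0 x < k * e'\<^sup>2"
    then obtain d0 where "d0 > 0" "\<And>x. \<lbrakk>x \<noteq> x0; dist x x0 < d0\<rbrakk> \<Longrightarrow> lyapunov x0 x < k * e'\<^sup>2"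
      unfolding eventually_at by auto
    then show thesis using that zero by metis
  qed
  show thesis
  proof (rule that[of "min d0 e'"])
    show "min d0 e' > 0" using d0 e' by simp
    fix x s t assume x: "trajectory x" and st: "0 \<le> s" "s \<le> t" and "x s \<in> ball x0 (min d0 e')"
    then have start: "dist (x s) x0 < d0" "dist (x s) x0 < e'" by (auto simp: dist_commute)
    have "absolutely_continuous_on 0 t x" using x st by (simp add: solution_def)
    then have "continuous_on {0..t} x" by (rule absolutely_continuous_on_imp_continuous_on)
    then have "continuous_on {s..t} x" by (rule continuous_on_subset) (use st in auto)
    then have cont: "continuous_on {s..t} (\<lambda>u. dist (x u) x0)" by (intro continuous_intros)
    have "dist (x t) x0 < e'"
    proof (rule ccontr)
      assume "\<not> dist (x t) x0 < e'"
      then obtain u where u: "s \<le> u" "u \<le> t" "dist (x u) x0 = e'"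
        using IVT'[of "\<lambda>u. dist (x u) x0" s e' t] start(2) st(2) cont by force
      have "dist (angle (x u)) (angle x0) \<le> dist (x u) x0" by (rule dist_fst_le)
      then have "angle (x u) \<in> ball (angle x0) r" using u(3) e'(3) by (simp add: dist_commute)
      then have "k * e'\<^sup>2 \<le> lyapunov x0 (x u)" using r(3)[of "x u"] u(3) by (simp add: dist_norm)
      also have "\<dots> \<le> lyapunov x0 (x s)" by (rule lyapunov_decreasing[OF x x0 st(1) u(1)])
      also have "\<dots> < k * e'\<^sup>2" by (rule d0(2)[OF start(1)])
      finally show False by simp
    qed
    then show "x t \<in> ball x0 e" using e'(2) by (simp add: dist_commute)
  qed
qed

end

section \<open>Convergence of trajectories near an equilibrium\<close>

lemma closed_state_space: "closed (state_space :: ('n::finite, 't::finite) state set)"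
proof -
  have "state_space = (\<Inter>i. {x :: ('n, 't) state. 0 \<le> bid x $ i}) \<inter> (\<Inter>i. {x. 0 \<le> gen x $ i})"
    by (auto simp: state_space_iff)
  moreover have "closed \<dots>"
    by (intro closed_Int closed_INT ballI closed_Collect_le continuous_intros)
  ultimately show ?thesis by simp
qed

context closed_loop
begin

lemma continuous_G: "continuous_on {0..} (G i)"
proof -
  have "(1 / \<mu> i)-lipschitz_on {0..} (G i)"
  proof (rule lipschitz_onI)
    fix y z :: real assume "y \<in> {0..}" "z \<in> {0..}"
    then have le: "\<mu> i * (G i y - G i z)\<^sup>2 \<le> (y - z) * (G i y - G i z)" using G_cocoercive by simp
    define g where "g = \<bar>G i y - G i z\<bar>"
    have "\<mu> i * g\<^sup>2 \<le> \<bar>y - z\<bar> * g"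
      using le abs_ge_self[of "(y - z) * (G i y - G i z)"] unfolding g_def power2_abs abs_mult by linarith
    then have "g * (\<mu> i * g) \<le> g * \<bar>y - z\<bar>" by (simp add: power2_eq_square mult_ac)
    then have "\<mu> i * g \<le> \<bar>y - z\<bar>" by (cases "g = 0") (auto simp: g_def mult_le_cancel_left)
    then have "\<mu> i * \<bar>G i y - G i z\<bar> \<le> \<bar>y - z\<bar>" by (simp add: g_def)
    then show "dist (G i y) (G i z) \<le> 1 / \<mu> i * dist y z"
      using pos(8)[of i] by (simp add: dist_real_def field_simps)
  qed (use pos(8)[of i] in simp)
  then show ?thesis by (rule lipschitz_on_continuous_on)
qed

lemma continuous_supply: "continuous_on state_space (\<lambda>x. G i (bid x $ i))"
  by (rule continuous_on_compose2[OF continuous_G]) (auto intro!: continuous_intros simp: state_space_iff)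

lemma continuous_drifts:
  "continuous_on S (freq_drift i)"
  "continuous_on state_space (bid_drift i)"
  "continuous_on S (gen_drift i)"
proof -
  have gU: "continuous_on S (\<lambda>x. gU (angle x))"
    by (rule continuous_on_compose2[OF gU_continuous]) (auto intro!: continuous_intros)
  show "continuous_on S (freq_drift i)"
    unfolding freq_drift_def
    by (intro continuous_intros bounded_linear.continuous_on[OF matrix_vector_mul_bounded_linear] gU)
  show "continuous_on state_space (bid_drift i)"
    unfolding bid_drift_def by (intro continuous_intros continuous_supply)
  show "continuous_on S (gen_drift i)"
    unfolding gen_drift_def by (intro continuous_intros)
qed

definition speed_bound :: "('n, 't) state \<Rightarrow> real" where
  "speed_bound x = norm (transpose Dt *v freq x) + ((\<Sum>i\<in>UNIV. \<bar>freq_drift i x\<bar> / M $ i $ i)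
     + ((\<Sum>i\<in>UNIV. \<bar>bid_drift i x\<bar> / \<tau>b $ i $ i) + ((\<Sum>i\<in>UNIV. \<bar>gen_drift i x\<bar> / \<tau>g $ i $ i)
     + \<bar>1 \<bullet> (Pd - gen x)\<bar> / \<tau>l)))"

lemma continuous_speed_bound: "continuous_on state_space speed_bound"
  unfolding speed_bound_def divide_inverse
  by (intro continuous_intros continuous_drifts bounded_linear.continuous_on[OF matrix_vector_mul_bounded_linear])

lemma speed_bound:
  assumes "lhs x' = rhs x" "x \<in> state_space"
  shows "norm x' \<le> speed_bound x"
proof -
  have "norm (freq x') \<le> (\<Sum>i\<in>UNIV. \<bar>freq_drift i x\<bar> / M $ i $ i)"
    using norm_le_l1_cart[of "freq x'"] pos(1) by (simp add: velocity(2)[OF assms(1)] abs_divide less_imp_le)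
  moreover have "norm (bid x') \<le> (\<Sum>i\<in>UNIV. \<bar>bid_drift i x\<bar> / \<tau>b $ i $ i)"
  proof (rule order_trans[OF norm_le_l1_cart sum_mono])
    fix i show "\<bar>bid x' $ i\<bar> \<le> \<bar>bid_drift i x\<bar> / \<tau>b $ i $ i"
      using pos(3)[of i] abs_proj_plus_le by (simp add: velocity_bid[OF assms] abs_divide divide_right_mono)
  qed
  moreover have "norm (gen x') \<le> (\<Sum>i\<in>UNIV. \<bar>gen_drift i x\<bar> / \<tau>g $ i $ i)"
  proof (rule order_trans[OF norm_le_l1_cart sum_mono])
    fix i show "\<bar>gen x' $ i\<bar> \<le> \<bar>gen_drift i x\<bar> / \<tau>g $ i $ i"
      using pos(4)[of i] abs_proj_plus_le by (simp add: velocity(3)[OF assms(1)] abs_divide divide_right_mono)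
  qed
  moreover have "norm (angle x') = norm (transpose Dt *v freq x)" "norm (mul x') = \<bar>1 \<bullet> (Pd - gen x)\<bar> / \<tau>l"
    using pos(7) by (simp_all add: velocity[OF assms(1)] abs_divide)
  moreover have "norm x' \<le> norm (angle x') + (norm (freq x') + (norm (bid x') + (norm (gen x') + norm (mul x'))))"
    using norm_Pair_le[of "angle x'" "snd x'"] norm_Pair_le[of "freq x'" "snd (snd x')"]
      norm_Pair_le[of "bid x'" "snd (snd (snd x'))"] norm_Pair_le[of "gen x'" "mul x'"] by simp
  ultimately show ?thesis unfolding speed_bound_def by linarith
qed

end

text \<open>
  A trajectory that stays so close to an equilibrium \<open>x0\<close> of the target set that the gradient of the
  potential is strongly monotone along it.
\<close>
locale trapped_trajectory = closed_loop \<Gamma> D Dt M A \<tau>b \<tau>g \<rho> \<sigma> \<tau>l C Pd gU G F \<mu>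
  for \<Gamma> :: "real^'m::finite^'m" and D :: "real^'m^'n::finite" and Dt :: "real^'t::finite^'n"
    and M A \<tau>b \<tau>g \<rho> \<sigma> \<tau>l C Pd gU G F \<mu> +
  fixes x :: "real \<Rightarrow> ('n, 't) state" and x0 :: "('n, 't) state" and N :: "real set" and e \<kappa> :: real
  assumes x: "trajectory x" and N: "negligible N"
    and der: "\<And>t. \<lbrakk>t \<ge> 0; t \<notin> N\<rbrakk> \<Longrightarrow> \<exists>x'. (x has_vector_derivative x') (at t within {0..}) \<and> lhs x' = rhs (x t)"
    and state: "\<And>t. t \<ge> 0 \<Longrightarrow> x t \<in> state_space"
    and x0: "x0 \<in> target"
    and near: "\<And>t. t \<ge> 0 \<Longrightarrow> x t \<in> ball x0 e"
    and \<kappa>: "\<kappa> > 0"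
    and monotone: "\<And>\<phi>. \<phi> \<in> ball (angle x0) e \<Longrightarrow> \<kappa> * (norm (\<phi> - angle x0))\<^sup>2 \<le> (gU \<phi> - gU (angle x0)) \<bullet> (\<phi> - angle x0)"
begin

lemma ac: "T \<ge> 0 \<Longrightarrow> absolutely_continuous_on 0 T x"
  using x by (simp add: solution_def)

definition K :: "('n, 't) state set" where "K = cball x0 e \<inter> state_space"

lemma compact_K: "compact K"
  unfolding K_def by (intro compact_Int_closed compact_cball closed_state_space)

lemma in_K: "t \<ge> 0 \<Longrightarrow> x t \<in> K"
  using near state by (auto simp: K_def less_imp_le)

lemma uniformly_continuous_trajectory: "uniformly_continuous_on {0..} x"
proof -
  have "compact (speed_bound ` K)"
    by (intro compact_continuous_image compact_K continuous_on_subset[OF continuous_speed_bound]) (auto simp: K_def)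
  then obtain L where L: "L > 0" "\<And>z. z \<in> K \<Longrightarrow> speed_bound z \<le> L"
    using compact_imp_bounded bounded_pos by (metis abs_le_D1 image_eqI real_norm_def)
  have "L-lipschitz_on {0..} x"
  proof (rule halfline_speed_lipschitz[OF ac N])
    fix u assume u: "0 \<le> u" "u \<notin> N"
    then obtain x' where x': "(x has_vector_derivative x') (at u within {0..})" "lhs x' = rhs (x u)" using der by blast
    then have "norm x' \<le> L" using speed_bound[OF x'(2) state[OF u(1)]] L(2)[OF in_K[OF u(1)]] by linarith
    then show "\<exists>D. norm D \<le> L \<and> (x has_vector_derivative D) (at u within {0..})" using x' by blast
  qed (use L in auto)
  then show ?thesis by (rule lipschitz_on_uniformly_continuous)
qed

text \<open>
  Together with compactness of \<open>K\<close> this reduces the hypotheses of Barbalat's lemma to continuity of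
  functions on the state space; the vector field itself is discontinuous.
\<close>
lemma uniformly_continuous_along:
  fixes h :: "('n, 't) state \<Rightarrow> real"
  assumes "continuous_on state_space h"
  shows "uniformly_continuous_on {0..} (\<lambda>t. h (x t))"
proof -
  have "uniformly_continuous_on K h"
    by (intro compact_uniformly_continuous compact_K continuous_on_subset[OF assms]) (auto simp: K_def)
  moreover have "x ` {0..} \<subseteq> K" using in_K by auto
  ultimately have "uniformly_continuous_on (x ` {0..}) h"
    unfolding uniformly_continuous_on_def by (meson subsetD)
  from uniformly_continuous_on_compose[OF uniformly_continuous_trajectory this]
  show ?thesis by (simp add: o_def)
qed

text \<open>
  The condition \<open>P\<close> singles out the part of the state space where the coordinate \<open>f\<close> moves without
  projection.
\<close>
lemma coordinate_drift_vanishes: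
  fixes f g :: "('n, 't) state \<Rightarrow> real"
  assumes f: "bounded_linear f" and g: "continuous_on state_space g"
    and rate: "\<And>z z'. \<lbrakk>z \<in> state_space; lhs z' = rhs z; P z\<rbrakk> \<Longrightarrow> f z' = g z"
    and P: "\<forall>\<^sub>F t in at_top. P (x t)" and lim: "((\<lambda>t. f (x t)) \<longlongrightarrow> c) at_top"
  shows "((\<lambda>t. g (x t)) \<longlongrightarrow> 0) at_top"
proof (rule barbalat_derivative[where y = "\<lambda>t. f (x t)", OF _ N _ lim uniformly_continuous_along[OF g]])
  show "absolutely_continuous_on 0 T (\<lambda>t. f (x t))" if "T \<ge> 0" for T
    by (rule absolutely_continuous_on_bounded_linear[OF ac[OF that] f])
  show "\<forall>\<^sub>F u in at_top. u \<notin> N \<longrightarrow> ((\<lambda>t. f (x t)) has_vector_derivative g (x u)) (at u within {0..})"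
    using P eventually_ge_at_top[of 0]
  proof eventually_elim
    fix u assume u: "P (x u)" "0 \<le> u"
    show "u \<notin> N \<longrightarrow> ((\<lambda>t. f (x t)) has_vector_derivative g (x u)) (at u within {0..})"
    proof
      assume "u \<notin> N"
      then obtain x' where x': "(x has_vector_derivative x') (at u within {0..})" "lhs x' = rhs (x u)" using der u by blast
      then show "((\<lambda>t. f (x t)) has_vector_derivative g (x u)) (at u within {0..})"
        using bounded_linear.has_vector_derivative[OF f x'(1)] rate[OF state[OF u(2)] x'(2) u(1)] by simp
    qed
  qed
qed

lemma dissipated_vanishes:
  fixes h :: "('n, 't) state \<Rightarrow> real"
  assumes h: "continuous_on state_space h" and k: "k > 0"
    and le: "\<And>z. k * (h z)\<^sup>2 \<le> \<sigma>\<^sup>2 * (\<Sum>i\<in>UNIV. A $ i $ i * (freq z $ i)\<^sup>2)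
     + \<rho> * (1 \<bullet> (gen z - gen x0))\<^sup>2 + (\<Sum>i\<in>UNIV. \<mu> i * (G i (bid z $ i) - gen x0 $ i)\<^sup>2)"
  shows "((\<lambda>t. h (x t)) \<longlongrightarrow> 0) at_top"
proof -
  let ?y = "\<lambda>t. - lyapunov x0 (x t)"
  have ac_y: "absolutely_continuous_on 0 T ?y" if "T \<ge> 0" for T
    by (intro absolutely_continuous_on_bounded_linear[OF lyapunov_absolutely_continuous[OF ac[OF that]]]
        bounded_linear_minus bounded_linear_ident)
  have der_y: "\<exists>D\<ge>k * (h (x u))\<^sup>2. (?y has_vector_derivative D) (at u within {0..})" if u: "u \<ge> 0" "u \<notin> N" for u
  proof -
    obtain x' where x': "(x has_vector_derivative x') (at u within {0..})" "lhs x' = rhs (x u)" using der u by blast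
    have "k * (h (x u))\<^sup>2 \<le> - lyapunov_rate x0 (x u) x'"
      using dissipation[OF state[OF u(1)] x0 x'(2)] le[of "x u"] by linarith
    then show ?thesis using has_vector_derivative_minus[OF lyapunov_chain[OF x'(1)]] by blast
  qed
  have cont: "continuous_on K (lyapunov x0)"
    by (rule has_derivative_continuous_on) (rule has_derivative_at_withinI[OF lyapunov_has_derivative])
  obtain b where "\<And>z. z \<in> K \<Longrightarrow> b \<le> lyapunov x0 z"
    using continuous_attains_inf[OF compact_K _ cont] in_K[of 0] by (metis empty_iff order_refl)
  then have low: "lyapunov x0 (x t) \<ge> b" if "t \<ge> 0" for t using in_K[OF that] by blast
  obtain c where "((\<lambda>t. lyapunov x0 (x t)) \<longlongrightarrow> c) at_top"
    by (rule antimono_bounded_below_tendsto[of "\<lambda>t. lyapunov x0 (x t)" b]) (use lyapunov_decreasing[OF x x0] low in auto)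
  then have lim: "(?y \<longlongrightarrow> - c) at_top" by (rule tendsto_minus)
  show ?thesis
    by (rule barbalat_square[OF ac_y N der_y lim _ k])
       (auto intro!: uniformly_continuous_along continuous_intros h)
qed

lemma dissipation_terms_nonneg:
  "0 \<le> \<sigma>\<^sup>2 * (\<Sum>i\<in>UNIV. A $ i $ i * (freq z $ i)\<^sup>2)"
  "0 \<le> \<rho> * (1 \<bullet> (gen z - gen x0))\<^sup>2"
  "0 \<le> (\<Sum>i\<in>UNIV. \<mu> i * (G i (bid z $ i) - gen x0 $ i)\<^sup>2)"
  using pos by (simp_all add: sum_nonneg less_imp_le)

lemma freq_vanishes: "((\<lambda>t. freq (x t) $ i) \<longlongrightarrow> 0) at_top"
proof (rule dissipated_vanishes[of _ "\<sigma>\<^sup>2 * A $ i $ i"])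
  fix z
  have "A $ i $ i * (freq z $ i)\<^sup>2 \<le> (\<Sum>i\<in>UNIV. A $ i $ i * (freq z $ i)\<^sup>2)"
    using pos(2) by (intro member_le_sum) (auto simp: less_imp_le)
  then have "\<sigma>\<^sup>2 * (A $ i $ i * (freq z $ i)\<^sup>2) \<le> \<sigma>\<^sup>2 * (\<Sum>i\<in>UNIV. A $ i $ i * (freq z $ i)\<^sup>2)"
    by (intro mult_left_mono) auto
  then show "\<sigma>\<^sup>2 * A $ i $ i * (freq z $ i)\<^sup>2 \<le> \<sigma>\<^sup>2 * (\<Sum>i\<in>UNIV. A $ i $ i * (freq z $ i)\<^sup>2)
     + \<rho> * (1 \<bullet> (gen z - gen x0))\<^sup>2 + (\<Sum>i\<in>UNIV. \<mu> i * (G i (bid z $ i) - gen x0 $ i)\<^sup>2)"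
    using dissipation_terms_nonneg[of z] unfolding mult.assoc by linarith
qed (use pos in \<open>auto intro!: continuous_intros\<close>)

lemma balance_restored: "((\<lambda>t. 1 \<bullet> (gen (x t) - gen x0)) \<longlongrightarrow> 0) at_top"
proof (rule dissipated_vanishes[of _ \<rho>])
  fix z show "\<rho> * (1 \<bullet> (gen z - gen x0))\<^sup>2 \<le> \<sigma>\<^sup>2 * (\<Sum>i\<in>UNIV. A $ i $ i * (freq z $ i)\<^sup>2)
     + \<rho> * (1 \<bullet> (gen z - gen x0))\<^sup>2 + (\<Sum>i\<in>UNIV. \<mu> i * (G i (bid z $ i) - gen x0 $ i)\<^sup>2)"
    using dissipation_terms_nonneg[of z] by linarith
qed (use pos in \<open>auto intro!: continuous_intros\<close>)

lemma supply_converges: "((\<lambda>t. G i (bid (x t) $ i)) \<longlongrightarrow> gen x0 $ i) at_top"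
proof -
  have "((\<lambda>t. G i (bid (x t) $ i) - gen x0 $ i) \<longlongrightarrow> 0) at_top"
  proof (rule dissipated_vanishes[of _ "\<mu> i"])
    fix z
    have "\<mu> i * (G i (bid z $ i) - gen x0 $ i)\<^sup>2 \<le> (\<Sum>i\<in>UNIV. \<mu> i * (G i (bid z $ i) - gen x0 $ i)\<^sup>2)"
      using pos(8) by (intro member_le_sum) (auto simp: less_imp_le)
    then show "\<mu> i * (G i (bid z $ i) - gen x0 $ i)\<^sup>2 \<le> \<sigma>\<^sup>2 * (\<Sum>i\<in>UNIV. A $ i $ i * (freq z $ i)\<^sup>2)
       + \<rho> * (1 \<bullet> (gen z - gen x0))\<^sup>2 + (\<Sum>i\<in>UNIV. \<mu> i * (G i (bid z $ i) - gen x0 $ i)\<^sup>2)"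
      using dissipation_terms_nonneg[of z] by linarith
  qed (use pos in \<open>auto intro!: continuous_intros continuous_supply\<close>)
  then show ?thesis by (rule iffD2[OF Lim_null])
qed

lemma eventually_state: "\<forall>\<^sub>F t in at_top. 0 \<le> bid (x t) $ i \<and> 0 \<le> gen (x t) $ i"
  using eventually_ge_at_top[of 0] by eventually_elim (use state in \<open>auto simp: state_space_iff\<close>)

text \<open>
  Where the conjugate derivative is positive, the marginal cost inverts it.
\<close>
lemma active_bid_converges:
  assumes act: "gen x0 $ i > 0"
  shows "((\<lambda>t. bid (x t) $ i) \<longlongrightarrow> bid x0 $ i) at_top"
proof -
  have b0: "0 \<le> bid x0 $ i" using target_state[OF x0] by (simp add: state_space_iff)
  have ev: "\<forall>\<^sub>F t in at_top. G i (bid (x t) $ i) > 0" by (rule order_tendstoD(1)[OF supply_converges act])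
  have "((\<lambda>t. F i (G i (bid (x t) $ i))) \<longlongrightarrow> F i (gen x0 $ i)) at_top"
  proof (rule continuous_on_tendsto_compose[OF F_continuous supply_converges])
    show "\<forall>\<^sub>F t in at_top. G i (bid (x t) $ i) \<in> {0..}" using ev by eventually_elim simp
  qed (use act in auto)
  moreover have "F i (gen x0 $ i) = bid x0 $ i"
    using F_G[OF b0, of i] act target_gen[OF x0, of i] by simp
  moreover have "\<forall>\<^sub>F t in at_top. F i (G i (bid (x t) $ i)) = bid (x t) $ i"
    using ev eventually_state[of i] by eventually_elim (use F_G in auto)
  ultimately show ?thesis by (simp add: tendsto_cong)
qed

lemma active_gen_converges:
  assumes act: "gen x0 $ i > 0"
  shows "((\<lambda>t. gen (x t) $ i) \<longlongrightarrow> gen x0 $ i) at_top"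
proof -
  have "bid x0 $ i > 0"
    using act target_gen[OF x0, of i] G_0[of i] target_state[OF x0]
    by (metis less_eq_real_def less_irrefl state_space_iff)
  then have ev: "\<forall>\<^sub>F t in at_top. bid (x t) $ i > 0" by (rule order_tendstoD(1)[OF active_bid_converges[OF act]])
  have "((\<lambda>t. bid_drift i (x t) / \<tau>b $ i $ i) \<longlongrightarrow> 0) at_top"
  proof (rule coordinate_drift_vanishes[where f = "\<lambda>z. bid z $ i" and P = "\<lambda>z. bid z $ i > 0" and g = "\<lambda>z. bid_drift i z / \<tau>b $ i $ i", OF bounded_linear_state(2) _ _ ev active_bid_converges[OF act]])
    show "continuous_on state_space (\<lambda>z. bid_drift i z / \<tau>b $ i $ i)"
      unfolding divide_inverse by (intro continuous_intros continuous_drifts)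
    show "bid z' $ i = bid_drift i z / \<tau>b $ i $ i" if "z \<in> state_space" "lhs z' = rhs z" "0 < bid z $ i" for z z'
      using velocity_bid[OF that(2,1), of i] that(3) by (simp add: proj_plus_def)
  qed
  from tendsto_mult_left[OF this, of "\<tau>b $ i $ i"]
  have "((\<lambda>t. bid_drift i (x t)) \<longlongrightarrow> 0) at_top" using pos(3)[of i] by simp
  from tendsto_add[OF this supply_converges[of i]] show ?thesis by (simp add: bid_drift_def)
qed

text \<open>
  Since the load is positive, some unit is active at \<open>x0\<close>. Its output is eventually positive and thus
  moves without projection, and its drift reveals the multiplier.
\<close>
lemma mul_converges: "((\<lambda>t. mul (x t)) \<longlongrightarrow> mul x0) at_top"
proof -
  have "(\<Sum>i\<in>UNIV. gen x0 $ i) > 0" using load target_balance[OF x0] by (simp add: inner_one_vec)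
  then obtain i where act: "gen x0 $ i > 0" by (metis not_less sum_nonpos)
  have ev: "\<forall>\<^sub>F t in at_top. gen (x t) $ i > 0" by (rule order_tendstoD(1)[OF active_gen_converges[OF act] act])
  have "((\<lambda>t. gen_drift i (x t) / \<tau>g $ i $ i) \<longlongrightarrow> 0) at_top"
  proof (rule coordinate_drift_vanishes[where f = "\<lambda>z. gen z $ i" and P = "\<lambda>z. gen z $ i > 0" and g = "\<lambda>z. gen_drift i z / \<tau>g $ i $ i", OF bounded_linear_state(3) _ _ ev active_gen_converges[OF act]])
    show "continuous_on state_space (\<lambda>z. gen_drift i z / \<tau>g $ i $ i)"
      unfolding divide_inverse by (intro continuous_intros continuous_drifts)
    show "gen z' $ i = gen_drift i z / \<tau>g $ i $ i" if "lhs z' = rhs z" "0 < gen z $ i" for z z'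
      using velocity(3)[OF that(1), of i] that(2) by (simp add: proj_plus_def)
  qed
  from tendsto_mult_left[OF this, of "\<tau>g $ i $ i"]
  have "((\<lambda>t. gen_drift i (x t)) \<longlongrightarrow> 0) at_top" using pos(4)[of i] by simp
  from tendsto_add[OF tendsto_add[OF tendsto_add[OF this active_bid_converges[OF act]]
      tendsto_mult_left[OF balance_restored, of \<rho>]] tendsto_mult_left[OF freq_vanishes[of i], of "\<sigma>\<^sup>2"]]
  have "((\<lambda>t. gen_drift i (x t) + bid (x t) $ i + \<rho> * (1 \<bullet> (gen (x t) - gen x0)) + \<sigma>\<^sup>2 * freq (x t) $ i) \<longlongrightarrow> bid x0 $ i) at_top"
    by simp
  moreover have "gen_drift i z + bid z $ i + \<rho> * (1 \<bullet> (gen z - gen x0)) + \<sigma>\<^sup>2 * freq z $ i = mul z" for z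
    using target_balance[OF x0] by (simp add: gen_drift_def inner_diff_right algebra_simps)
  ultimately show ?thesis using target_mul(2)[OF x0 act] by simp
qed

text \<open>
  The outputs of the idle units are nonnegative, and their sum vanishes in the limit by the balance and
  the convergence of the active outputs.
\<close>
lemma gen_converges: "((\<lambda>t. gen (x t) $ i) \<longlongrightarrow> gen x0 $ i) at_top"
proof (cases "gen x0 $ i > 0")
  case True then show ?thesis by (rule active_gen_converges)
next
  case False
  have nn: "gen x0 $ j \<ge> 0" for j using target_state[OF x0] by (simp add: state_space_iff)
  let ?I = "{j. gen x0 $ j > 0}"
  have zero: "gen x0 $ j = 0" if "j \<notin> ?I" for j using that nn[of j] by simp
  have total: "((\<lambda>t. 1 \<bullet> (gen (x t) - gen x0) - (\<Sum>j\<in>?I. gen (x t) $ j - gen x0 $ j)) \<longlongrightarrow> 0 - (\<Sum>j\<in>?I. gen x0 $ j - gen x0 $ j)) at_top"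
    by (rule tendsto_diff[OF balance_restored tendsto_sum[OF tendsto_diff[OF active_gen_converges tendsto_const]]]) simp
  have rest: "1 \<bullet> (gen z - gen x0) - (\<Sum>j\<in>?I. gen z $ j - gen x0 $ j) = (\<Sum>j\<in>-?I. gen z $ j)" for z
  proof -
    have "1 \<bullet> (gen z - gen x0) = (\<Sum>j\<in>?I. gen z $ j - gen x0 $ j) + (\<Sum>j\<in>-?I. gen z $ j - gen x0 $ j)"
      unfolding inner_one_vec vector_minus_component Compl_eq_Diff_UNIV
      by (subst add.commute, rule sum.subset_diff) simp_all
    moreover have "(\<Sum>j\<in>-?I. gen z $ j - gen x0 $ j) = (\<Sum>j\<in>-?I. gen z $ j)"
    proof (rule sum.cong)
      fix j assume "j \<in> -?I"
      then have "gen x0 $ j = 0" by (intro zero) simp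
      then show "gen z $ j - gen x0 $ j = gen z $ j" by simp
    qed simp
    ultimately show ?thesis by linarith
  qed
  have lim: "((\<lambda>t. \<Sum>j\<in>-?I. gen (x t) $ j) \<longlongrightarrow> 0) at_top" using total unfolding rest by simp
  have "((\<lambda>t. gen (x t) $ i) \<longlongrightarrow> 0) at_top"
  proof (rule tendsto_sandwich[OF _ _ tendsto_const lim])
    show "\<forall>\<^sub>F t in at_top. 0 \<le> gen (x t) $ i" using eventually_state[of i] by eventually_elim simp
    show "\<forall>\<^sub>F t in at_top. gen (x t) $ i \<le> (\<Sum>j\<in>-?I. gen (x t) $ j)"
      using eventually_ge_at_top[of 0]
    proof eventually_elim
      fix t :: real assume "0 \<le> t"
      then have "\<And>j. 0 \<le> gen (x t) $ j" using state by (simp add: state_space_iff)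
      then show "gen (x t) $ i \<le> (\<Sum>j\<in>-?I. gen (x t) $ j)" using False by (intro member_le_sum) auto
    qed
  qed
  moreover have "gen x0 $ i = 0" by (rule zero) (use False in simp)
  ultimately show ?thesis by simp
qed

text \<open>
  The frequencies converge, so their drifts vanish in the limit; hence so does the deviation of the line
  flows \<open>Dt *v gU\<close>. Since \<open>Dt\<close> is injective and \<open>gU\<close> is strongly monotone, the angles converge.
\<close>
lemma angle_converges: "((\<lambda>t. angle (x t)) \<longlongrightarrow> angle x0) at_top"
proof -
  have drift: "((\<lambda>t. freq_drift i (x t)) \<longlongrightarrow> 0) at_top" for i
  proof -
    have "((\<lambda>t. freq_drift i (x t) / M $ i $ i) \<longlongrightarrow> 0) at_top"
    proof (rule coordinate_drift_vanishes[where f = "\<lambda>z. freq z $ i" and P = "\<lambda>z. True" and g = "\<lambda>z. freq_drift i z / M $ i $ i", OF bounded_linear_state(1) _ _ _ freq_vanishes])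
      show "continuous_on state_space (\<lambda>z. freq_drift i z / M $ i $ i)"
        unfolding divide_inverse by (intro continuous_intros continuous_drifts)
      show "freq z' $ i = freq_drift i z / M $ i $ i" if "lhs z' = rhs z" for z z'
        by (rule velocity(2)[OF that])
    qed simp
    from tendsto_mult_left[OF this, of "M $ i $ i"] show ?thesis using pos(1)[of i] by simp
  qed
  have "((\<lambda>t. (Dt *v (gU (angle (x t)) - gU (angle x0))) $ i) \<longlongrightarrow> 0) at_top" for i
  proof -
    have "((\<lambda>t. - freq_drift i (x t) - A $ i $ i * freq (x t) $ i + (gen (x t) $ i - gen x0 $ i))
        \<longlongrightarrow> - 0 - A $ i $ i * 0 + (gen x0 $ i - gen x0 $ i)) at_top"
      by (intro tendsto_intros drift freq_vanishes gen_converges)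
    moreover have "- freq_drift i z - A $ i $ i * freq z $ i + (gen z $ i - gen x0 $ i) = (Dt *v (gU (angle z) - gU (angle x0))) $ i" for z
      unfolding freq_drift_def target_flow[OF x0, of i] by (simp add: matrix_vector_mult_diff_distrib)
    ultimately show ?thesis by simp
  qed
  then have "((\<lambda>t. Dt *v (gU (angle (x t)) - gU (angle x0))) \<longlongrightarrow> 0) at_top"
    by (intro vec_tendstoI) simp
  moreover obtain B where B: "B > 0" "\<And>v. B * norm v \<le> norm (Dt *v v)"
  proof -
    have "inj (\<lambda>v. Dt *v v)"
      by (rule injI) (metis eq_iff_diff_eq_0 matrix_vector_mult_diff_distrib tree_inj)
    then show thesis using that linear_inj_bounded_below_pos[of "\<lambda>v. Dt *v v"] by auto
  qed
  ultimately have "((\<lambda>t. 1 / (\<kappa> * B) * norm (Dt *v (gU (angle (x t)) - gU (angle x0)))) \<longlongrightarrow> 1 / (\<kappa> * B) * norm (0 :: real^'n)) at_top"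
    by (intro tendsto_intros)
  then have lim: "((\<lambda>t. 1 / (\<kappa> * B) * norm (Dt *v (gU (angle (x t)) - gU (angle x0)))) \<longlongrightarrow> 0) at_top" by simp
  have "((\<lambda>t. angle (x t) - angle x0) \<longlongrightarrow> 0) at_top"
  proof (rule Lim_null_comparison[OF _ lim])
    show "\<forall>\<^sub>F t in at_top. norm (angle (x t) - angle x0) \<le> 1 / (\<kappa> * B) * norm (Dt *v (gU (angle (x t)) - gU (angle x0)))"
      using eventually_ge_at_top[of 0]
    proof eventually_elim
      fix t :: real assume "0 \<le> t"
      have "dist (angle x0) (angle (x t)) \<le> dist x0 (x t)" by (rule dist_fst_le)
      then have "angle (x t) \<in> ball (angle x0) e" using near[OF \<open>0 \<le> t\<close>] by simp
      define d g where "d = norm (angle (x t) - angle x0)" "g = gU (angle (x t)) - gU (angle x0)"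
      have "\<kappa> * d\<^sup>2 \<le> g \<bullet> (angle (x t) - angle x0)" unfolding d_g_def by (rule monotone) fact
      also have "\<dots> \<le> norm g * d" unfolding d_g_def by (rule norm_cauchy_schwarz)
      finally have "d * (\<kappa> * d) \<le> d * norm g" by (simp add: power2_eq_square algebra_simps)
      then have "\<kappa> * d \<le> norm g" by (cases "d = 0") (auto simp: d_g_def mult_le_cancel_left)
      then have "B * (\<kappa> * d) \<le> norm (Dt *v g)" using B(2)[of g] mult_left_mono[of "\<kappa> * d" "norm g" B] B(1) by linarith
      then show "d \<le> 1 / (\<kappa> * B) * norm (Dt *v g)" using B(1) \<kappa> by (simp add: field_simps)
    qed
  qed
  then show ?thesis by (rule iffD2[OF Lim_null])
qed

text \<open>
  For an idle unit this is the only information on the drift: a positive limit of the drift along some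
  times would drive the output away from zero.
\<close>
lemma gen_drift_upper:
  assumes "\<epsilon> > 0"
  shows "\<forall>\<^sub>F t in at_top. gen_drift i (x t) / \<tau>g $ i $ i < \<epsilon>"
proof (rule barbalat_upper[where y = "\<lambda>t. gen (x t) $ i", OF _ N _ gen_converges _ assms])
  show "absolutely_continuous_on 0 T (\<lambda>t. gen (x t) $ i)" if "T \<ge> 0" for T
    by (rule absolutely_continuous_on_bounded_linear[OF ac[OF that] bounded_linear_state(3)])
  show "uniformly_continuous_on {0..} (\<lambda>t. gen_drift i (x t) / \<tau>g $ i $ i)"
    unfolding divide_inverse by (intro uniformly_continuous_along continuous_intros continuous_drifts)
  show "\<forall>\<^sub>F u in at_top. u \<notin> N \<longrightarrow> (\<exists>D\<ge>gen_drift i (x u) / \<tau>g $ i $ i. ((\<lambda>t. gen (x t) $ i) has_vector_derivative D) (at u within {0..}))"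
    using eventually_ge_at_top[of 0]
  proof eventually_elim
    fix u :: real assume u: "0 \<le> u"
    show "u \<notin> N \<longrightarrow> (\<exists>D\<ge>gen_drift i (x u) / \<tau>g $ i $ i. ((\<lambda>t. gen (x t) $ i) has_vector_derivative D) (at u within {0..}))"
    proof
      assume "u \<notin> N"
      then obtain x' where x': "(x has_vector_derivative x') (at u within {0..})" "lhs x' = rhs (x u)" using der u by blast
      have "gen_drift i (x u) / \<tau>g $ i $ i \<le> gen x' $ i"
        using pos(4)[of i] proj_plus_ge by (simp add: velocity(3)[OF x'(2)] divide_right_mono)
      then show "\<exists>D\<ge>gen_drift i (x u) / \<tau>g $ i $ i. ((\<lambda>t. gen (x t) $ i) has_vector_derivative D) (at u within {0..})"
        using bounded_linear.has_vector_derivative[OF bounded_linear_state(3) x'(1)] by blast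
    qed
  qed
qed

text \<open>
  The limits of all coordinates are known except for the bids of the idle units, for which \<open>G i = 0\<close> and
  the bound on the drift are just the conditions of an equilibrium.
\<close>
lemma limit_point_in_target:
  obtains y r where "y \<in> target" "strict_mono r" "(\<lambda>n. x (real (r n))) \<longlonglongrightarrow> y"
proof -
  have "bounded (range (\<lambda>n. x (real n)))"
    by (rule bounded_subset[OF compact_imp_bounded[OF compact_K]]) (use in_K in auto)
  then obtain y r where r: "strict_mono r" and "((\<lambda>n. x (real n)) \<circ> r) \<longlonglongrightarrow> y"
    using bounded_imp_convergent_subsequence by blast
  then have lim: "(\<lambda>n. x (real (r n))) \<longlonglongrightarrow> y" by (simp add: o_def)
  have seq: "filterlim (\<lambda>n. real (r n)) at_top sequentially"
    by (rule filterlim_compose[OF filterlim_real_sequentially filterlim_subseq[OF r]])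
  have yS: "y \<in> state_space"
    by (rule closed_sequentially[OF closed_state_space _ lim]) (simp add: state)
  have limits: "h y = c" if "continuous_on state_space h" "((\<lambda>t. h (x t)) \<longlongrightarrow> c) at_top"
    for h :: "('n, 't) state \<Rightarrow> 'a::real_normed_vector" and c
  proof (rule LIMSEQ_unique)
    show "(\<lambda>n. h (x (real (r n)))) \<longlonglongrightarrow> h y"
      by (rule continuous_on_tendsto_compose[OF that(1) lim yS]) (simp add: state)
    show "(\<lambda>n. h (x (real (r n)))) \<longlonglongrightarrow> c" by (rule filterlim_compose[OF that(2) seq])
  qed
  have "angle y = angle x0" by (rule limits[OF _ angle_converges]) (intro continuous_intros)
  moreover have "freq y = 0"
    unfolding vec_eq_iff zero_index by (intro allI limits[OF _ freq_vanishes]) (intro continuous_intros)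
  moreover have gen: "gen y = gen x0"
    unfolding vec_eq_iff by (intro allI limits[OF _ gen_converges]) (intro continuous_intros)
  moreover have mul: "mul y = mul x0" by (rule limits[OF _ mul_converges]) (intro continuous_intros)
  moreover have "G i (bid y $ i) = gen x0 $ i" for i
    by (rule limits[OF continuous_supply supply_converges])
  moreover have "bid y $ i = mul x0" if "gen x0 $ i > 0" for i
    using limits[OF _ active_bid_converges[OF that]] target_mul(2)[OF x0 that] by (simp add: continuous_intros)
  moreover have "mul x0 \<le> bid y $ i" for i
  proof -
    have "(\<lambda>n. gen_drift i (x (real (r n))) / \<tau>g $ i $ i) \<longlonglongrightarrow> gen_drift i y / \<tau>g $ i $ i"
      using continuous_on_tendsto_compose[OF continuous_drifts(3)[of UNIV] lim] pos(4)[of i]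
      by (intro tendsto_intros) auto
    then have "gen_drift i y / \<tau>g $ i $ i \<le> \<epsilon>" if "\<epsilon> > 0" for \<epsilon>
    proof (rule tendsto_upperbound)
      show "\<forall>\<^sub>F n in sequentially. gen_drift i (x (real (r n))) / \<tau>g $ i $ i \<le> \<epsilon>"
        using filterlim_iff[THEN iffD1, OF seq, rule_format, OF gen_drift_upper[OF that, of i]]
        by eventually_elim simp
    qed simp
    then have "gen_drift i y / \<tau>g $ i $ i \<le> 0" by (rule field_le_epsilon) simp
    then have "gen_drift i y \<le> 0" using pos(4)[of i] by (simp add: field_simps)
    moreover have "gen_drift i y = mul x0 - bid y $ i"
      using target_balance[OF x0] \<open>freq y = 0\<close> by (simp add: gen_drift_def gen mul inner_diff_right)
    ultimately show ?thesis by simp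
  qed
  ultimately have "y \<in> target" using targetI[OF x0, of y] yS by blast
  then show thesis using that r lim by blast
qed

end

section \<open>Attraction to the target set\<close>

context closed_loop
begin

text \<open>
  The trajectory comes arbitrarily close to a limit point in the target set and, by stability of that
  point, stays there.
\<close>
lemma attraction:
  assumes x0: "x0 \<in> target"
  obtains d where "d > 0"
    "\<And>x. \<lbrakk>trajectory x; x 0 \<in> ball x0 d\<rbrakk> \<Longrightarrow> \<exists>y\<in>target. (x \<longlongrightarrow> y) at_top"
proof -
  obtain e \<kappa> where e: "e > 0" "\<kappa> > 0"
    "\<And>\<phi>. \<phi> \<in> ball (angle x0) e \<Longrightarrow> \<kappa> * (norm (\<phi> - angle x0))\<^sup>2 \<le> (gU \<phi> - gU (angle x0)) \<bullet> (\<phi> - angle x0)"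
    using U_strongly_convex[OF target_secure[OF x0]] by blast
  obtain d where d: "d > 0"
    "\<And>x s t. \<lbrakk>trajectory x; 0 \<le> s; s \<le> t; x s \<in> ball x0 d\<rbrakk> \<Longrightarrow> x t \<in> ball x0 e"
    by (rule stability[OF x0 e(1)]) auto
  show thesis
  proof (rule that[OF d(1)])
    fix x assume x: "trajectory x" and start: "x 0 \<in> ball x0 d"
    obtain N where N: "negligible N" "\<And>T. T \<ge> 0 \<Longrightarrow> absolutely_continuous_on 0 T x"
      "\<And>t. \<lbrakk>t \<ge> 0; t \<notin> N\<rbrakk> \<Longrightarrow> \<exists>x'. (x has_vector_derivative x') (at t within {0..}) \<and> lhs x' = rhs (x t)"
      "\<And>t. t \<ge> 0 \<Longrightarrow> x t \<in> state_space"
      by (rule trajectory_facts[OF x]) auto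
    interpret trapped_trajectory \<Gamma> D Dt M A \<tau>b \<tau>g \<rho> \<sigma> \<tau>l C Pd gU G F \<mu> x x0 N e \<kappa>
      by unfold_locales (use x N x0 e d(2)[OF x order_refl _ start] in auto)
    obtain y r where y: "y \<in> target" "strict_mono r" "(\<lambda>n. x (real (r n))) \<longlonglongrightarrow> y"
      by (rule limit_point_in_target)
    have "(x \<longlongrightarrow> y) at_top"
    proof (rule tendstoI)
      fix \<epsilon> :: real assume "\<epsilon> > 0"
      obtain d' where d': "d' > 0"
        "\<And>x s t. \<lbrakk>trajectory x; 0 \<le> s; s \<le> t; x s \<in> ball y d'\<rbrakk> \<Longrightarrow> x t \<in> ball y \<epsilon>"
        by (rule stability[OF y(1) \<open>\<epsilon> > 0\<close>]) auto
      obtain n where "dist (x (real (r n))) y < d'"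
        using tendstoD[OF y(3) d'(1)] by (auto simp: eventually_sequentially)
      then have "dist (x t) y < \<epsilon>" if "t \<ge> real (r n)" for t
        using d'(2)[OF x _ that] by (simp add: dist_commute)
      then show "\<forall>\<^sub>F t in at_top. dist (x t) y < \<epsilon>"
        unfolding eventually_at_top_linorder by blast
    qed
    then show "\<exists>y\<in>target. (x \<longlongrightarrow> y) at_top" using y(1) by blast
  qed
qed

theorem target_attracts:
  "locally_asymptotically_stable trajectory target \<and> pointwise_convergent_near trajectory target"
proof -
  have "\<forall>x0\<in>target. \<exists>d>0. \<forall>x. trajectory x \<longrightarrow> x 0 \<in> ball x0 d \<longrightarrow> (\<exists>y\<in>target. (x \<longlongrightarrow> y) at_top)"
  proof
    fix x0 assume "x0 \<in> target"
    then obtain d where "d > 0" "\<And>x. \<lbrakk>trajectory x; x 0 \<in> ball x0 d\<rbrakk> \<Longrightarrow> \<exists>y\<in>target. (x \<longlongrightarrow> y) at_top"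
      by (rule attraction) auto
    then show "\<exists>d>0. \<forall>x. trajectory x \<longrightarrow> x 0 \<in> ball x0 d \<longrightarrow> (\<exists>y\<in>target. (x \<longlongrightarrow> y) at_top)" by blast
  qed
  then obtain d where d: "\<And>x0. x0 \<in> target \<Longrightarrow> d x0 > 0"
    "\<And>x0 x. \<lbrakk>x0 \<in> target; trajectory x; x 0 \<in> ball x0 (d x0)\<rbrakk> \<Longrightarrow> \<exists>y\<in>target. (x \<longlongrightarrow> y) at_top"
    by (drule_tac bchoice) blast
  let ?W = "\<Union>x0\<in>target. ball x0 (d x0)"
  have nbh: "neighborhood target (\<Union>x0\<in>target. ball x0 (\<delta> x0))" if "\<And>x0. x0 \<in> target \<Longrightarrow> \<delta> x0 > 0" for \<delta>
  proof -
    have "open (\<Union>x0\<in>target. ball x0 (\<delta> x0))" by auto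
    then show ?thesis unfolding neighborhood_def using that by (auto simp: interior_open)
  qed
  have point: "\<exists>y\<in>target. (x \<longlongrightarrow> y) at_top" if "trajectory x" "x 0 \<in> ?W" for x
    using that d(2) by blast
  have dist: "((\<lambda>t. infdist (x t) target) \<longlongrightarrow> 0) at_top" if x: "trajectory x" "x 0 \<in> ?W" for x
  proof -
    obtain y where y: "y \<in> target" "(x \<longlongrightarrow> y) at_top" using point[OF x] by blast
    have "((\<lambda>t. dist (x t) y) \<longlongrightarrow> 0) at_top" by (rule iffD1[OF tendsto_dist_iff y(2)])
    moreover have "\<forall>\<^sub>F t in at_top. norm (infdist (x t) target) \<le> dist (x t) y"
      by (rule always_eventually) (simp add: infdist_le[OF y(1)] infdist_nonneg)
    ultimately show ?thesis by (rule Lim_null_comparison[rotated])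
  qed
  have stable: "\<exists>W'. neighborhood target W' \<and> (\<forall>x. trajectory x \<and> x 0 \<in> W' \<longrightarrow> (\<forall>t\<ge>0. x t \<in> W))"
    if W: "neighborhood target W" for W
  proof -
    have "\<forall>x0\<in>target. \<exists>\<delta>>0. \<forall>x. trajectory x \<and> x 0 \<in> ball x0 \<delta> \<longrightarrow> (\<forall>t\<ge>0. x t \<in> W)"
    proof
      fix x0 assume x0: "x0 \<in> target"
      obtain e where e: "e > 0" "ball x0 e \<subseteq> W"
        using subsetD[OF W[unfolded neighborhood_def] x0] unfolding mem_interior by (elim exE conjE)
      obtain \<delta> where "\<delta> > 0" "\<And>x s t. \<lbrakk>trajectory x; 0 \<le> s; s \<le> t; x s \<in> ball x0 \<delta>\<rbrakk> \<Longrightarrow> x t \<in> ball x0 e"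
        by (rule stability[OF x0 e(1)]) auto
      then show "\<exists>\<delta>>0. \<forall>x. trajectory x \<and> x 0 \<in> ball x0 \<delta> \<longrightarrow> (\<forall>t\<ge>0. x t \<in> W)"
        using e(2) by blast
    qed
    then obtain \<delta> where \<delta>: "\<And>x0. x0 \<in> target \<Longrightarrow> \<delta> x0 > 0"
      "\<And>x0 x t. \<lbrakk>x0 \<in> target; trajectory x; x 0 \<in> ball x0 (\<delta> x0); t \<ge> 0\<rbrakk> \<Longrightarrow> x t \<in> W"
      by (drule_tac bchoice) blast
    have "neighborhood target (\<Union>x0\<in>target. ball x0 (\<delta> x0))" by (rule nbh) (rule \<delta>(1))
    moreover have "\<forall>x. trajectory x \<and> x 0 \<in> (\<Union>x0\<in>target. ball x0 (\<delta> x0)) \<longrightarrow> (\<forall>t\<ge>0. x t \<in> W)" using \<delta>(2) by blast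
    ultimately show ?thesis by blast
  qed
  have nW: "neighborhood target ?W" by (rule nbh) (rule d(1))
  show ?thesis
    unfolding locally_asymptotically_stable_def pointwise_convergent_near_def
  proof (intro conjI allI impI)
    show "\<exists>W'. neighborhood target W' \<and> (\<forall>x. trajectory x \<and> x 0 \<in> W' \<longrightarrow> (\<forall>t\<ge>0. x t \<in> W))"
      if "neighborhood target W" for W by (rule stable[OF that])
    show "\<exists>W. neighborhood target W \<and> (\<forall>x. trajectory x \<and> x 0 \<in> W \<longrightarrow> ((\<lambda>t. infdist (x t) target) \<longlongrightarrow> 0) at_top)"
      using nW dist by blast
    show "\<exists>W. neighborhood target W \<and> (\<forall>x. trajectory x \<and> x 0 \<in> W \<longrightarrow> (\<exists>y\<in>target. (x \<longlongrightarrow> y) at_top))"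
      using nW point by blast
  qed
qed

end

lemma positive_definite_diagonal_entry:
  assumes "positive_definite N"
  shows "N $ i $ i > 0"
proof -
  have "axis i 1 \<bullet> (N *v axis i 1) > 0"
    using assms unfolding positive_definite_def by (metis axis_eq_0_iff zero_neq_one)
  then show ?thesis by (simp add: matrix_vector_mult_basis column_def inner_axis')
qed

theorem theoremV3:
  fixes pos neg :: "'m::finite \<Rightarrow> 'n::finite"
    and tpos tneg :: "'t::finite \<Rightarrow> 'n"
    and D :: "real^'m^'n" and Dt :: "real^'t^'n"
    and B :: "real^'n^'n" and V :: "real^'n" and \<Gamma> :: "real^'m^'m"
    and M A \<tau>b \<tau>g :: "real^'n^'n"
    and \<rho> \<sigma> \<tau>l :: real
    and C :: "'n \<Rightarrow> real \<Rightarrow> real"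
    and Pd Pstar :: "real^'n"
  assumes "connected_graph pos neg"
    and "D = incidence pos neg"
    and "\<And>k. B $ pos k $ neg k = B $ neg k $ pos k"
    and "\<And>k. B $ pos k $ neg k > 0"
    and "\<And>i. V $ i > 0"
    and "\<Gamma> = diag (\<chi> k. B $ pos k $ neg k * V $ pos k * V $ neg k)"
    and "CARD('t) = CARD('n) - 1"
    and "tree_graph tpos tneg"
    and "Dt = incidence tpos tneg"
    and "is_diagonal M" and "\<And>i. M $ i $ i > 0"
    and "is_diagonal A" and "\<And>i. A $ i $ i > 0"
    and "\<rho> > 0" and "\<sigma> > 0" and "\<tau>l > 0"
    and "is_diagonal \<tau>b" and "positive_definite \<tau>b"
    and "is_diagonal \<tau>g" and "positive_definite \<tau>g"
    and "\<And>i x. x \<ge> 0 \<Longrightarrow> C i x \<ge> 0"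
    and "\<And>i. strongly_convex_C2 (C i)"
    and "\<And>i. gradient_within (C i) {0..} 0 \<ge> 0"
    and "0 \<le> Pd" and "1 \<bullet> Pd > 0"
    and "economic_dispatch_optimizer C Pd Pstar"
    and "\<exists>i j. i \<noteq> j \<and> Pstar $ i > 0 \<and> Pstar $ j > 0"
    and "\<exists>\<phi> \<omega>. transpose Dt *v \<omega> = 0 \<and> swing_rhs \<Gamma> D Dt A Pd \<phi> \<omega> Pstar = 0 \<and>
           angles_secure D Dt \<phi>"
  shows "locally_asymptotically_stable
           (solution (closed_loop_lhs M \<tau>b \<tau>g \<tau>l) (closed_loop_rhs \<Gamma> D Dt A C Pd \<rho> \<sigma>) state_space)
           (target_set \<Gamma> D Dt A C Pd \<rho> \<sigma>)
       \<and> pointwise_convergent_near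
           (solution (closed_loop_lhs M \<tau>b \<tau>g \<tau>l) (closed_loop_rhs \<Gamma> D Dt A C Pd \<rho> \<sigma>) state_space)
           (target_set \<Gamma> D Dt A C Pd \<rho> \<sigma>)"
proof -
  note graph = assms(1) and D = assms(2) and \<Gamma> = assms(6) and card = assms(7) and tree = assms(8) and Dt = assms(9)
  have cg: "connected_graph tpos tneg" using tree by (simp add: tree_graph_def)
  then have sg: "simple_graph tpos tneg" by (simp add: connected_graph_def)
  define \<gamma> where "\<gamma> = (\<chi> k. B $ pos k $ neg k * V $ pos k * V $ neg k)"
  have \<Gamma>_diag: "\<Gamma> = diag \<gamma>" by (simp add: \<Gamma> \<gamma>_def)
  have \<gamma>: "\<gamma> $ k > 0" for k using assms(4,5) by (simp add: \<gamma>_def)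
  have inj: "edge_angles D Dt \<phi> = 0 \<Longrightarrow> \<phi> = 0" for \<phi>
    unfolding D Dt by (rule edge_angles_injective[OF graph cg card])
  have "\<exists>G F \<mu>. \<mu> > 0 \<and> continuous_on {0..} F \<and> G 0 = 0 \<and> (\<forall>y\<ge>0. G y > 0 \<longrightarrow> F (G y) = y) \<and>
      (\<forall>y\<ge>0. \<forall>z\<ge>0. \<mu> * (G y - G z)\<^sup>2 \<le> (y - z) * (G y - G z)) \<and>
      (\<forall>y\<ge>0. (conjugate (C i) has_real_derivative G y) (at y within {0..}))" for i
    by (rule conjugate_derivative_monotone[OF assms(22,23)[of i]]) blast
  then obtain G F \<mu> where conj: "\<And>i. \<mu> i > 0" "\<And>i. continuous_on {0..} (F i)" "\<And>i. G i 0 = 0"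
    "\<And>i y. \<lbrakk>y \<ge> 0; G i y > 0\<rbrakk> \<Longrightarrow> F i (G i y) = y"
    "\<And>i y z. \<lbrakk>y \<ge> 0; z \<ge> 0\<rbrakk> \<Longrightarrow> \<mu> i * (G i y - G i z)\<^sup>2 \<le> (y - z) * (G i y - G i z)"
    "\<And>i y. y \<ge> 0 \<Longrightarrow> (conjugate (C i) has_real_derivative G i y) (at y within {0..})"
    by metis
  interpret closed_loop \<Gamma> D Dt M A \<tau>b \<tau>g \<rho> \<sigma> \<tau>l C Pd "coupling_gradient \<gamma> D Dt" G F \<mu>
  proof
    show "is_diagonal M" "is_diagonal A" "is_diagonal \<tau>b" "is_diagonal \<tau>g"
      "M $ i $ i > 0" "A $ i $ i > 0" "\<rho> > 0" "\<sigma> > 0" "\<tau>l > 0" "1 \<bullet> Pd > 0" for i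
      using assms by auto
    show "\<tau>b $ i $ i > 0" "\<tau>g $ i $ i > 0" for i
      using assms(18,20) by (auto intro: positive_definite_diagonal_entry)
    show "\<exists>c. w = c *\<^sub>R 1" if "transpose Dt *v w = 0" for w
      using transpose_incidence_kernel[OF cg, of w] that unfolding Dt by metis
    show "transpose Dt *v 1 = 0" unfolding Dt by (rule transpose_incidence_one[OF sg])
    show "z = 0" if "Dt *v z = 0" for z
      using that unfolding Dt by (rule spanning_incidence_injective[OF cg card])
    show "(potential \<Gamma> D Dt has_derivative (\<bullet>) (coupling_gradient \<gamma> D Dt \<phi>)) (at \<phi>)" for \<phi>
      unfolding \<Gamma>_diag by (rule potential_has_derivative)
    show "continuous_on UNIV (coupling_gradient \<gamma> D Dt)" by (rule continuous_coupling_gradient)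
    show "absolutely_continuous_on a b (\<lambda>t. potential \<Gamma> D Dt (\<phi> t))" if "absolutely_continuous_on a b \<phi>" for a b \<phi>
      unfolding \<Gamma>_diag by (rule absolutely_continuous_on_potential[OF that])
    show "\<exists>r>0. \<exists>\<kappa>>0. \<forall>\<phi>\<in>ball \<phi>0 r. \<kappa> * (norm (\<phi> - \<phi>0))\<^sup>2 \<le> potential \<Gamma> D Dt \<phi> - potential \<Gamma> D Dt \<phi>0
          - coupling_gradient \<gamma> D Dt \<phi>0 \<bullet> (\<phi> - \<phi>0) \<and>
        \<kappa> * (norm (\<phi> - \<phi>0))\<^sup>2 \<le> (coupling_gradient \<gamma> D Dt \<phi> - coupling_gradient \<gamma> D Dt \<phi>0) \<bullet> (\<phi> - \<phi>0)"
      if "angles_secure D Dt \<phi>0" for \<phi>0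
      unfolding \<Gamma>_diag by (rule potential_strongly_convex_near_secure[OF \<gamma> inj that]) blast+
    show "gradient_within (total_conjugate C) {0..} b = (\<chi> i. G i (b $ i))" if "0 \<le> b" for b
      by (rule gradient_total_conjugate[OF conj(6) that])
  qed (use conj in auto)
  show ?thesis by (rule target_attracts)
qed

end
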